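(* Let $R$ be a ring with unity and let $\mathcal{X}$ be a semibrick of left $R$-modules such that every $X\in\mathcal{X}$ has projective dimension at most one and $\mathrm{Hom}(X,R)=0$ for all $X\in\mathcal{X}$. Let $\mathcal{X}^{\perp_{0,1}}$ be the class of left $R$-modules $M$ with $\mathrm{Hom}(X,M)=\mathrm{Ext}^1(X,M)=0$ for all $X\in\mathcal{X}$. Then the embedding $\alpha:R\to R_{\mathcal{X}}(\infty)$ is an $\mathcal{X}^{\perp_{0,1}}$-reflection of $R$; $R_{\mathcal{X}}(\infty)$ carries a ring structure for which $\alpha$ is a ring epimorphism such that the image of the associated restriction functor is $\mathcal{X}^{\perp_{0,1}}$; and $\alpha:R\to R_{\mathcal{X}}(\infty)$ is the universal localization of $R$ at $\mathcal{X}$. In particular, $R_{\mathcal{X}}(\infty)$ is isomorphic to the universal localization $R_{\mathcal{X}}$ of $R$ at $\mathcal{X}$.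
   Context: A brick is a finitely presented left $R$-module whose endomorphism ring is a division ring. A semibrick is a class $\mathcal{X}$ of pairwise non-isomorphic bricks with $\mathrm{Hom}(X,X')=0$ for distinct $X,X'\in\mathcal{X}$. $\mathcal{X}$-universal sequences: let $Y$ be a left $R$-module. For each $X\in\mathcal{X}$, $\mathrm{Ext}^1(X,Y)$ is a left $\mathrm{End}(X)$-module (acting by pull-back; compositions written from left to right). Choose a basis $(0\to Y\to M_{X,i}\to X\to 0)_{i\in I_X}$ over the division ring $\mathrm{End}(X)$. The $\mathcal{X}$-universal short exact sequence $0\to Y\to M\to\bigoplus_{X\in\mathcal{X}}X^{(I_X)}\to 0$ starting from $Y$ is the push-out of $0\to\bigoplus_{X}Y^{(I_X)}\to\bigoplus_{X,i}M_{X,i}\to\bigoplus_{X}X^{(I_X)}\to 0$ along the summation map $\bigoplus_X Y^{(I_X)}\to Y$. Define $Y_{\mathcal{X}}(1)=Y$ and let $Y_{\mathcal{X}}(i)\to Y_{\mathcal{X}}(i+1)$ be the monomorphism of an $\mathcal{X}$-universal sequence starting from $Y_{\mathcal{X}}(i)$; $Y_{\mathcal{X}}(\infty)$ is the direct limit, with canonical embedding $\alpha:Y\to Y_{\mathcal{X}}(\infty)$. Here this is applied to $Y=R$ as a left $R$-module. For a full subcategory $\mathcal{C}$ of the category of left $R$-modules, a $\mathcal{C}$-reflection of a module $N$ is a homomorphism $\eta:N\to C$ with $C\in\mathcal{C}$ such that every homomorphism from $N$ to a module $U\in\mathcal{C}$ factors uniquely through $\eta$. Universal localization (Schofield): each $X\in\mathcal{X}$,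 being finitely presented of projective dimension at most one, has a presentation $0\to P_1\xrightarrow{\sigma_X}P_0\to X\to0$ with $P_0,P_1$ finitely generated projective. The universal localization $R\to R_{\mathcal{X}}$ of $R$ at $\mathcal{X}$ is the ring homomorphism that is universal (initial) among ring homomorphisms $R\to S$ such that $S\otimes_R\sigma_X$ is an isomorphism for all $X\in\mathcal{X}$. *)

theory Defs
  imports "HOL-Algebra.Module" "HOL-Algebra.QuotRing" "HOL-Algebra.Free_Abelian_Groups"
begin

section \<open>Left modules over arbitrary rings\<close>

text \<open>
  The library locale \<open>module\<close> requires a commutative ring of scalars. The record type is
  reused here; its inherited fields \<open>mult\<close> and \<open>one\<close> play no role for modules.
\<close>

locale left_module = R?: ring R + M?: abelian_group M
  for R :: "'r ring" (structure) and M :: "('r, 'm) module" (structure) +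
  assumes smult_closed:
      "\<lbrakk>a \<in> carrier R; x \<in> carrier M\<rbrakk> \<Longrightarrow> a \<odot>\<^bsub>M\<^esub> x \<in> carrier M"
    and smult_l_distr:
      "\<lbrakk>a \<in> carrier R; b \<in> carrier R; x \<in> carrier M\<rbrakk> \<Longrightarrow>
        (a \<oplus>\<^bsub>R\<^esub> b) \<odot>\<^bsub>M\<^esub> x = (a \<odot>\<^bsub>M\<^esub> x) \<oplus>\<^bsub>M\<^esub> (b \<odot>\<^bsub>M\<^esub> x)"
    and smult_r_distr:
      "\<lbrakk>a \<in> carrier R; x \<in> carrier M; y \<in> carrier M\<rbrakk> \<Longrightarrow>
        a \<odot>\<^bsub>M\<^esub> (x \<oplus>\<^bsub>M\<^esub> y) = (a \<odot>\<^bsub>M\<^esub> x) \<oplus>\<^bsub>M\<^esub> (a \<odot>\<^bsub>M\<^esub> y)"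
    and smult_assoc:
      "\<lbrakk>a \<in> carrier R; b \<in> carrier R; x \<in> carrier M\<rbrakk> \<Longrightarrow>
        (a \<otimes>\<^bsub>R\<^esub> b) \<odot>\<^bsub>M\<^esub> x = a \<odot>\<^bsub>M\<^esub> (b \<odot>\<^bsub>M\<^esub> x)"
    and smult_one:
      "x \<in> carrier M \<Longrightarrow> \<one>\<^bsub>R\<^esub> \<odot>\<^bsub>M\<^esub> x = x"

definition mod_hom ::
    "'r ring \<Rightarrow> ('r, 'm) module \<Rightarrow> ('r, 'n) module \<Rightarrow> ('m \<Rightarrow> 'n) set" where
  "mod_hom R M N = {h \<in> carrier M \<rightarrow> carrier N.
     (\<forall>x\<in>carrier M. \<forall>y\<in>carrier M. h (x \<oplus>\<^bsub>M\<^esub> y) = h x \<oplus>\<^bsub>N\<^esub> h y) \<and>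
     (\<forall>r\<in>carrier R. \<forall>x\<in>carrier M. h (r \<odot>\<^bsub>M\<^esub> x) = r \<odot>\<^bsub>N\<^esub> h x)}"

definition mod_iso ::
    "'r ring \<Rightarrow> ('r, 'm) module \<Rightarrow> ('r, 'n) module \<Rightarrow> ('m \<Rightarrow> 'n) set" where
  "mod_iso R M N = {h \<in> mod_hom R M N. bij_betw h (carrier M) (carrier N)}"

definition mod_isomorphic ::
    "'r ring \<Rightarrow> ('r, 'm) module \<Rightarrow> ('r, 'n) module \<Rightarrow> bool" where
  "mod_isomorphic R M N \<longleftrightarrow> mod_iso R M N \<noteq> {}"

definition Hom_zero :: "'r ring \<Rightarrow> ('r, 'm) module \<Rightarrow> ('r, 'n) module \<Rightarrow> bool" where
  "Hom_zero R M N \<longleftrightarrow> (\<forall>h\<in>mod_hom R M N. \<forall>x\<in>carrier M. h x = \<zero>\<^bsub>N\<^esub>)"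

definition regular_module :: "'r ring \<Rightarrow> ('r, 'r) module" where
  "regular_module R = \<lparr>carrier = carrier R, monoid.mult = monoid.mult R, one = one R,
     ring.zero = ring.zero R, ring.add = ring.add R, smult = monoid.mult R\<rparr>"

definition mod_prod ::
    "('r, 'm) module \<Rightarrow> ('r, 'n) module \<Rightarrow> ('r, 'm \<times> 'n) module" where
  "mod_prod M N = \<lparr>carrier = carrier M \<times> carrier N, monoid.mult = undefined, one = undefined,
     ring.zero = (\<zero>\<^bsub>M\<^esub>, \<zero>\<^bsub>N\<^esub>),
     ring.add = (\<lambda>(x, y) (x', y'). (x \<oplus>\<^bsub>M\<^esub> x', y \<oplus>\<^bsub>N\<^esub> y')),
     smult = (\<lambda>r (x, y). (r \<odot>\<^bsub>M\<^esub> x, r \<odot>\<^bsub>N\<^esub> y))\<rparr>"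

definition mod_dsum ::
    "'k set \<Rightarrow> ('k \<Rightarrow> ('r, 'm) module) \<Rightarrow> ('r, 'k \<Rightarrow> 'm) module" where
  "mod_dsum K F = \<lparr>
     carrier = {h \<in> \<Pi>\<^sub>E k\<in>K. carrier (F k). finite {k \<in> K. h k \<noteq> \<zero>\<^bsub>F k\<^esub>}},
     monoid.mult = undefined, one = undefined,
     ring.zero = (\<lambda>k\<in>K. \<zero>\<^bsub>F k\<^esub>),
     ring.add = (\<lambda>g h. \<lambda>k\<in>K. g k \<oplus>\<^bsub>F k\<^esub> h k),
     smult = (\<lambda>r h. \<lambda>k\<in>K. r \<odot>\<^bsub>F k\<^esub> h k)\<rparr>"

definition mod_quot :: "('r, 'm) module \<Rightarrow> 'm set \<Rightarrow> ('r, 'm set) module" where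
  "mod_quot M N = \<lparr>carrier = a_rcosets\<^bsub>M\<^esub> N, monoid.mult = undefined, one = undefined,
     ring.zero = N,
     ring.add = (\<lambda>A B. A <+>\<^bsub>M\<^esub> B),
     smult = (\<lambda>r A. \<Union>x\<in>A. N +>\<^bsub>M\<^esub> (r \<odot>\<^bsub>M\<^esub> x))\<rparr>"

definition free_module :: "'r ring \<Rightarrow> 'k set \<Rightarrow> ('r, 'k \<Rightarrow> 'r) module" where
  "free_module R K = mod_dsum K (\<lambda>_. regular_module R)"

definition fin_gen :: "'r ring \<Rightarrow> ('r, 'm) module \<Rightarrow> bool" where
  "fin_gen R M \<longleftrightarrow> left_module R M \<and>
     (\<exists>(n::nat) p. p \<in> mod_hom R (free_module R {..<n}) M \<and>
        p ` carrier (free_module R {..<n}) = carrier M)"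

definition fin_pres :: "'r ring \<Rightarrow> ('r, 'm) module \<Rightarrow> bool" where
  "fin_pres R M \<longleftrightarrow> left_module R M \<and>
     (\<exists>(m::nat) (n::nat) q p.
        q \<in> mod_hom R (free_module R {..<m}) (free_module R {..<n}) \<and>
        p \<in> mod_hom R (free_module R {..<n}) M \<and>
        p ` carrier (free_module R {..<n}) = carrier M \<and>
        q ` carrier (free_module R {..<m}) =
          {x \<in> carrier (free_module R {..<n}). p x = \<zero>\<^bsub>M\<^esub>})"

text \<open>
  Projective means: isomorphic to a direct summand of a free module. A module on a type
  \<open>'m\<close> is generated by a subset of \<open>'m\<close>, so bases inside \<open>'m\<close> suffice.
\<close>

definition projective_mod :: "'r ring \<Rightarrow> ('r, 'm) module \<Rightarrow> bool" where
  "projective_mod R P \<longleftrightarrow> left_module R P \<and>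
     (\<exists>(K :: 'm set) s p.
        s \<in> mod_hom R P (free_module R K) \<and> p \<in> mod_hom R (free_module R K) P \<and>
        (\<forall>x\<in>carrier P. p (s x) = x))"


section \<open>Endomorphism rings, bricks and semibricks\<close>

text \<open>Composition is written from left to right: \<open>f \<otimes> g\<close> is \<open>f\<close> followed by \<open>g\<close>.\<close>

definition endo_ring :: "'r ring \<Rightarrow> ('r, 'm) module \<Rightarrow> ('m \<Rightarrow> 'm) ring" where
  "endo_ring R M = \<lparr>carrier = mod_hom R M M \<inter> extensional (carrier M),
     monoid.mult = (\<lambda>f g. compose (carrier M) g f),
     one = (\<lambda>x\<in>carrier M. x),
     ring.zero = (\<lambda>x\<in>carrier M. \<zero>\<^bsub>M\<^esub>),
     ring.add = (\<lambda>f g. \<lambda>x\<in>carrier M. f x \<oplus>\<^bsub>M\<^esub> g x)\<rparr>"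

definition division_ring :: "'d ring \<Rightarrow> bool" where
  "division_ring D \<longleftrightarrow> ring D \<and> \<one>\<^bsub>D\<^esub> \<noteq> \<zero>\<^bsub>D\<^esub> \<and> (\<forall>x\<in>carrier D - {\<zero>\<^bsub>D\<^esub>}. x \<in> Units D)"

definition brick :: "'r ring \<Rightarrow> ('r, 'x) module \<Rightarrow> bool" where
  "brick R X \<longleftrightarrow> fin_pres R X \<and> division_ring (endo_ring R X)"

definition semibrick :: "'r ring \<Rightarrow> ('r, 'x) module set \<Rightarrow> bool" where
  "semibrick R \<X> \<longleftrightarrow> (\<forall>X\<in>\<X>. brick R X) \<and>
     (\<forall>X\<in>\<X>. \<forall>X'\<in>\<X>. X \<noteq> X' \<longrightarrow> \<not> mod_isomorphic R X X' \<and> Hom_zero R X X')"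


section \<open>Short exact sequences\<close>

text \<open>A record of this type stands for \<open>0 \<rightarrow> Y \<rightarrow> M \<rightarrow> X \<rightarrow> 0\<close>; the end terms are kept separate.\<close>

record ('r, 'y, 'm, 'x) ses =
  ses_in :: "'y \<Rightarrow> 'm"
  ses_mid :: "('r, 'm) module"
  ses_out :: "'m \<Rightarrow> 'x"

definition short_exact ::
    "'r ring \<Rightarrow> ('r, 'y) module \<Rightarrow> ('r, 'y, 'm, 'x) ses \<Rightarrow> ('r, 'x) module \<Rightarrow> bool" where
  "short_exact R Y S X \<longleftrightarrow>
     left_module R Y \<and> left_module R (ses_mid S) \<and> left_module R X \<and>
     ses_in S \<in> mod_hom R Y (ses_mid S) \<and> ses_out S \<in> mod_hom R (ses_mid S) X \<and>
     inj_on (ses_in S) (carrier Y) \<and>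
     ses_out S ` carrier (ses_mid S) = carrier X \<and>
     ses_in S ` carrier Y = {m \<in> carrier (ses_mid S). ses_out S m = \<zero>\<^bsub>X\<^esub>}"

definition ses_equiv ::
    "'r ring \<Rightarrow> ('r, 'y) module \<Rightarrow> ('r, 'x) module \<Rightarrow>
     ('r, 'y, 'm, 'x) ses \<Rightarrow> ('r, 'y, 'n, 'x) ses \<Rightarrow> bool" where
  "ses_equiv R Y X S T \<longleftrightarrow>
     (\<exists>\<phi>\<in>mod_iso R (ses_mid S) (ses_mid T).
        (\<forall>y\<in>carrier Y. \<phi> (ses_in S y) = ses_in T y) \<and>
        (\<forall>m\<in>carrier (ses_mid S). ses_out T (\<phi> m) = ses_out S m))"

definition ses_split ::
    "('r, 'y) module \<Rightarrow> ('r, 'x) module \<Rightarrow> ('r, 'y, 'y \<times> 'x, 'x) ses" where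
  "ses_split Y X = \<lparr>ses_in = (\<lambda>y. (y, \<zero>\<^bsub>X\<^esub>)), ses_mid = mod_prod Y X, ses_out = snd\<rparr>"

text \<open>Pull-back of a sequence along \<open>h\<close>, whose domain is \<open>X\<close>.\<close>

definition ses_pullback ::
    "('r, 'y, 'm, 'z) ses \<Rightarrow> ('r, 'x) module \<Rightarrow> ('x \<Rightarrow> 'z) \<Rightarrow> ('r, 'y, 'm \<times> 'x, 'x) ses" where
  "ses_pullback S X h = \<lparr>
     ses_in = (\<lambda>y. (ses_in S y, \<zero>\<^bsub>X\<^esub>)),
     ses_mid = (mod_prod (ses_mid S) X)
       \<lparr>carrier := {(m, x) \<in> carrier (ses_mid S) \<times> carrier X. ses_out S m = h x}\<rparr>,
     ses_out = snd\<rparr>"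

text \<open>
  Push-out of a sequence starting in \<open>Z\<close> along \<open>h\<close> from \<open>Z\<close> to \<open>Y\<close>; the outgoing map is
  constant on each coset.
\<close>

definition pushout_rel ::
    "('r, 'z) module \<Rightarrow> ('z \<Rightarrow> 'y) \<Rightarrow> ('r, 'z, 'm, 'x) ses \<Rightarrow> ('y \<times> 'm) set" where
  "pushout_rel Z h S = (\<lambda>z. (h z, \<ominus>\<^bsub>ses_mid S\<^esub> (ses_in S z))) ` carrier Z"

definition ses_pushout ::
    "('r, 'z) module \<Rightarrow> ('r, 'y) module \<Rightarrow> ('z \<Rightarrow> 'y) \<Rightarrow> ('r, 'z, 'm, 'x) ses \<Rightarrow>
     ('r, 'y, ('y \<times> 'm) set, 'x) ses" where
  "ses_pushout Z Y h S = \<lparr>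
     ses_in = (\<lambda>y. pushout_rel Z h S +>\<^bsub>mod_prod Y (ses_mid S)\<^esub> (y, \<zero>\<^bsub>ses_mid S\<^esub>)),
     ses_mid = mod_quot (mod_prod Y (ses_mid S)) (pushout_rel Z h S),
     ses_out = (\<lambda>A. the_elem ((\<lambda>(y, m). ses_out S m) ` A))\<rparr>"

definition ses_prod ::
    "('r, 'y, 'm, 'x) ses \<Rightarrow> ('r, 'y', 'm', 'x') ses \<Rightarrow>
     ('r, 'y \<times> 'y', 'm \<times> 'm', 'x \<times> 'x') ses" where
  "ses_prod S T = \<lparr>ses_in = map_prod (ses_in S) (ses_in T),
     ses_mid = mod_prod (ses_mid S) (ses_mid T),
     ses_out = map_prod (ses_out S) (ses_out T)\<rparr>"

definition ses_dsum ::
    "'k set \<Rightarrow> ('k \<Rightarrow> ('r, 'y, 'm, 'x) ses) \<Rightarrow> ('r, 'k \<Rightarrow> 'y, 'k \<Rightarrow> 'm, 'k \<Rightarrow> 'x) ses" where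
  "ses_dsum K S = \<lparr>ses_in = (\<lambda>h. \<lambda>k\<in>K. ses_in (S k) (h k)),
     ses_mid = mod_dsum K (\<lambda>k. ses_mid (S k)),
     ses_out = (\<lambda>h. \<lambda>k\<in>K. ses_out (S k) (h k))\<rparr>"

definition baer_sum ::
    "('r, 'y) module \<Rightarrow> ('r, 'x) module \<Rightarrow> ('r, 'y, 'm, 'x) ses \<Rightarrow> ('r, 'y, 'n, 'x) ses \<Rightarrow>
     ('r, 'y, ('y \<times> ('m \<times> 'n) \<times> 'x) set, 'x) ses" where
  "baer_sum Y X S T =
     ses_pushout (mod_prod Y Y) Y (\<lambda>(y, y'). y \<oplus>\<^bsub>Y\<^esub> y')
       (ses_pullback (ses_prod S T) X (\<lambda>x. (x, x)))"


section \<open>The group of extensions as a module over the endomorphism ring\<close>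

text \<open>
  The middle term of an extension of \<open>X\<close> by \<open>Y\<close> is in bijection with \<open>Y \<times> X\<close>. Hence every
  extension, on whatever type, is equivalent to one whose middle term lives on \<open>'y \<times> 'x\<close>, and
  its class is represented by the set of the latter.
\<close>

definition ext_class ::
    "'r ring \<Rightarrow> ('r, 'x) module \<Rightarrow> ('r, 'y) module \<Rightarrow> ('r, 'y, 'm, 'x) ses \<Rightarrow>
     ('r, 'y, 'y \<times> 'x, 'x) ses set" where
  "ext_class R X Y S = {T. short_exact R Y T X \<and> ses_equiv R Y X S T}"

definition Ext1 ::
    "'r ring \<Rightarrow> ('r, 'x) module \<Rightarrow> ('r, 'y) module \<Rightarrow>
     ('x \<Rightarrow> 'x, ('r, 'y, 'y \<times> 'x, 'x) ses set) module" where
  "Ext1 R X Y = \<lparr>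
     carrier = ext_class R X Y ` {S :: ('r, 'y, 'y \<times> 'x, 'x) ses. short_exact R Y S X},
     monoid.mult = undefined, one = undefined,
     ring.zero = ext_class R X Y (ses_split Y X),
     ring.add = (\<lambda>A B. \<Union>S\<in>A. \<Union>T\<in>B. ext_class R X Y (baer_sum Y X S T)),
     smult = (\<lambda>h A. \<Union>S\<in>A. ext_class R X Y (ses_pullback S X h))\<rparr>"

definition Ext1_zero :: "'r ring \<Rightarrow> ('r, 'x) module \<Rightarrow> ('r, 'y) module \<Rightarrow> bool" where
  "Ext1_zero R X Y \<longleftrightarrow> carrier (Ext1 R X Y) = {\<zero>\<^bsub>Ext1 R X Y\<^esub>}"

definition module_basis ::
    "'d ring \<Rightarrow> ('d, 'v) module \<Rightarrow> 'i set \<Rightarrow> ('i \<Rightarrow> 'v) \<Rightarrow> bool" where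
  "module_basis D V I b \<longleftrightarrow> b \<in> I \<rightarrow> carrier V \<and>
     (\<forall>J c. finite J \<and> J \<subseteq> I \<and> c \<in> J \<rightarrow> carrier D \<and>
        (\<Oplus>\<^bsub>V\<^esub>i\<in>J. c i \<odot>\<^bsub>V\<^esub> b i) = \<zero>\<^bsub>V\<^esub> \<longrightarrow> (\<forall>i\<in>J. c i = \<zero>\<^bsub>D\<^esub>)) \<and>
     (\<forall>v\<in>carrier V. \<exists>J c. finite J \<and> J \<subseteq> I \<and> c \<in> J \<rightarrow> carrier D \<and>
        v = (\<Oplus>\<^bsub>V\<^esub>i\<in>J. c i \<odot>\<^bsub>V\<^esub> b i))"

definition perp01 ::
    "'r ring \<Rightarrow> ('r, 'x) module set \<Rightarrow> ('r, 'm) module set" where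
  "perp01 R \<X> = {M. left_module R M \<and> (\<forall>X\<in>\<X>. Hom_zero R X M \<and> Ext1_zero R X M)}"

text \<open>
  If \<open>X\<close> on \<open>'x\<close> has projective dimension at most one, then by Schanuel's lemma the kernel of the
  canonical map from the free module on the carrier of \<open>X\<close> is projective. So resolutions on the
  type \<open>'x \<Rightarrow> 'r\<close> suffice.
\<close>

definition proj_dim_le_1 :: "'r ring \<Rightarrow> ('r, 'x) module \<Rightarrow> bool" where
  "proj_dim_le_1 R X \<longleftrightarrow>
     (\<exists>(P :: ('r, 'x \<Rightarrow> 'r) module) (S :: ('r, 'x \<Rightarrow> 'r, 'x \<Rightarrow> 'r, 'x) ses).
        projective_mod R P \<and> projective_mod R (ses_mid S) \<and> short_exact R P S X)"


section \<open>Universal sequences and their direct limit\<close>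

definition summation_map :: "'k set \<Rightarrow> ('r, 'y) module \<Rightarrow> ('k \<Rightarrow> 'y) \<Rightarrow> 'y" where
  "summation_map K Y h = (\<Oplus>\<^bsub>Y\<^esub>k\<in>{k \<in> K. h k \<noteq> \<zero>\<^bsub>Y\<^esub>}. h k)"

text \<open>
  \<open>E X i\<close> for \<open>i \<in> I X\<close> are the chosen sequences whose classes form the bases; \<open>U\<close> is a universal
  sequence up to equivalence. The direct sums range over the pairs \<open>(X, i)\<close>, and the summand at
  \<open>(X, i)\<close> of the last term is \<open>X\<close>.
\<close>

definition universal_ses ::
    "'r ring \<Rightarrow> ('r, 'x) module set \<Rightarrow> ('r, 'y) module \<Rightarrow>
     (('r, 'x) module \<Rightarrow> 'i set) \<Rightarrow> (('r, 'x) module \<Rightarrow> 'i \<Rightarrow> ('r, 'y, 'e, 'x) ses) \<Rightarrow>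
     ('r, 'y, 'm, ('r, 'x) module \<times> 'i \<Rightarrow> 'x) ses \<Rightarrow> bool" where
  "universal_ses R \<X> Y I E U \<longleftrightarrow>
     (\<forall>X\<in>\<X>. (\<forall>i\<in>I X. short_exact R Y (E X i) X) \<and>
        module_basis (endo_ring R X) (Ext1 R X Y) (I X) (\<lambda>i. ext_class R X Y (E X i))) \<and>
     short_exact R Y U (mod_dsum (Sigma \<X> I) fst) \<and>
     ses_equiv R Y (mod_dsum (Sigma \<X> I) fst)
       (ses_pushout (mod_dsum (Sigma \<X> I) (\<lambda>_. Y)) Y (summation_map (Sigma \<X> I) Y)
         (ses_dsum (Sigma \<X> I) (\<lambda>(X, i). E X i)))
       U"

text \<open>
  Iterated universal sequences starting from \<open>N\<close>. The term with index \<open>n\<close> is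
  \<open>N\<^bsub>\<X>\<^esub>(n + 1)\<close>; as all terms live on one type, the initial one is a copy of \<open>N\<close>, identified
  with it by \<open>\<iota>\<close>.
\<close>

definition universal_tower ::
    "'r ring \<Rightarrow> ('r, 'x) module set \<Rightarrow> ('r, 'n) module \<Rightarrow> ('n \<Rightarrow> 'm) \<Rightarrow>
     (nat \<Rightarrow> ('r, 'm) module) \<Rightarrow>
     (nat \<Rightarrow> ('r, 'x) module \<Rightarrow> 'i set) \<Rightarrow>
     (nat \<Rightarrow> ('r, 'x) module \<Rightarrow> 'i \<Rightarrow> ('r, 'm, 'e, 'x) ses) \<Rightarrow>
     (nat \<Rightarrow> ('r, 'm, 'm, ('r, 'x) module \<times> 'i \<Rightarrow> 'x) ses) \<Rightarrow> bool" where
  "universal_tower R \<X> N \<iota> Y I E U \<longleftrightarrow>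
     left_module R N \<and> left_module R (Y 0) \<and> \<iota> \<in> mod_iso R N (Y 0) \<and>
     (\<forall>n. ses_mid (U n) = Y (Suc n) \<and> universal_ses R \<X> (Y n) (I n) (E n) (U n))"

text \<open>
  The direct limit of \<open>Y 0 \<rightarrow> Y 1 \<rightarrow> \<dots>\<close> with maps \<open>f n\<close>, as the set of classes of pairs \<open>(i, x)\<close>
  with \<open>x\<close> in \<open>Y i\<close>; the map from \<open>Y i\<close> to \<open>Y k\<close> is \<open>fold f [i..<k]\<close>.
\<close>

definition lim_class ::
    "(nat \<Rightarrow> ('r, 'm) module) \<Rightarrow> (nat \<Rightarrow> 'm \<Rightarrow> 'm) \<Rightarrow> nat \<Rightarrow> 'm \<Rightarrow> (nat \<times> 'm) set" where
  "lim_class Y f i x = {(j, y). y \<in> carrier (Y j) \<and>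
     (\<exists>k\<ge>max i j. fold f [i..<k] x = fold f [j..<k] y)}"

definition direct_limit ::
    "(nat \<Rightarrow> ('r, 'm) module) \<Rightarrow> (nat \<Rightarrow> 'm \<Rightarrow> 'm) \<Rightarrow> ('r, (nat \<times> 'm) set) module" where
  "direct_limit Y f = \<lparr>
     carrier = {lim_class Y f i x | i x. x \<in> carrier (Y i)},
     monoid.mult = undefined, one = undefined,
     ring.zero = lim_class Y f 0 \<zero>\<^bsub>Y 0\<^esub>,
     ring.add = (\<lambda>A B. \<Union>(i, x)\<in>A. \<Union>(j, y)\<in>B. lim_class Y f (max i j)
       (fold f [i..<max i j] x \<oplus>\<^bsub>Y (max i j)\<^esub> fold f [j..<max i j] y)),
     smult = (\<lambda>r A. \<Union>(i, x)\<in>A. lim_class Y f i (r \<odot>\<^bsub>Y i\<^esub> x))\<rparr>"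

definition tower_limit ::
    "(nat \<Rightarrow> ('r, 'm) module) \<Rightarrow> (nat \<Rightarrow> ('r, 'm, 'm, 'z) ses) \<Rightarrow>
     ('r, (nat \<times> 'm) set) module" where
  "tower_limit Y U = direct_limit Y (\<lambda>n. ses_in (U n))"

definition tower_embedding ::
    "('n \<Rightarrow> 'm) \<Rightarrow> (nat \<Rightarrow> ('r, 'm) module) \<Rightarrow> (nat \<Rightarrow> ('r, 'm, 'm, 'z) ses) \<Rightarrow>
     'n \<Rightarrow> (nat \<times> 'm) set" where
  "tower_embedding \<iota> Y U = (\<lambda>x. lim_class Y (\<lambda>n. ses_in (U n)) 0 (\<iota> x))"


section \<open>Reflections, ring epimorphisms and restriction of scalars\<close>

text \<open>
  Notions that refer to all modules or all rings carry a type argument for the test objects.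
  Uniqueness of maps is uniqueness on carriers, expressed by \<open>extensional\<close>.
\<close>

definition perp01_reflection ::
    "'u itself \<Rightarrow> 'r ring \<Rightarrow> ('r, 'x) module set \<Rightarrow>
     ('r, 'n) module \<Rightarrow> ('r, 'c) module \<Rightarrow> ('n \<Rightarrow> 'c) \<Rightarrow> bool" where
  "perp01_reflection _ R \<X> N C \<eta> \<longleftrightarrow>
     C \<in> perp01 R \<X> \<and> \<eta> \<in> mod_hom R N C \<and>
     (\<forall>U \<in> (perp01 R \<X> :: ('r, 'u) module set). \<forall>h\<in>mod_hom R N U.
        \<exists>!g. g \<in> mod_hom R C U \<inter> extensional (carrier C) \<and> (\<forall>x\<in>carrier N. g (\<eta> x) = h x))"

text \<open>
  A ring structure on the abelian group of a left \<open>R\<close>-module \<open>M\<close> such that \<open>\<alpha>\<close> is a ring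
  homomorphism and induces the given action of \<open>R\<close>.
\<close>

definition ring_structure_on ::
    "'r ring \<Rightarrow> ('r, 'm) module \<Rightarrow> ('r \<Rightarrow> 'm) \<Rightarrow> 'm ring \<Rightarrow> bool" where
  "ring_structure_on R M \<alpha> S \<longleftrightarrow>
     ring S \<and> carrier S = carrier M \<and> \<zero>\<^bsub>S\<^esub> = \<zero>\<^bsub>M\<^esub> \<and>
     (\<forall>x\<in>carrier M. \<forall>y\<in>carrier M. x \<oplus>\<^bsub>S\<^esub> y = x \<oplus>\<^bsub>M\<^esub> y) \<and>
     \<alpha> \<in> ring_hom R S \<and>
     (\<forall>r\<in>carrier R. \<forall>x\<in>carrier M. r \<odot>\<^bsub>M\<^esub> x = \<alpha> r \<otimes>\<^bsub>S\<^esub> x)"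

definition ring_epi :: "'t itself \<Rightarrow> 'r ring \<Rightarrow> 's ring \<Rightarrow> ('r \<Rightarrow> 's) \<Rightarrow> bool" where
  "ring_epi _ R S \<phi> \<longleftrightarrow> \<phi> \<in> ring_hom R S \<and>
     (\<forall>T :: 't ring. ring T \<longrightarrow> (\<forall>g\<in>ring_hom S T. \<forall>h\<in>ring_hom S T.
        (\<forall>r\<in>carrier R. g (\<phi> r) = h (\<phi> r)) \<longrightarrow> (\<forall>s\<in>carrier S. g s = h s)))"

definition restrict_scalars ::
    "('r \<Rightarrow> 's) \<Rightarrow> ('s, 'v) module \<Rightarrow> ('r, 'v) module" where
  "restrict_scalars \<phi> V = \<lparr>carrier = carrier V, monoid.mult = monoid.mult V, one = one V,
     ring.zero = ring.zero V, ring.add = ring.add V, smult = (\<lambda>r x. \<phi> r \<odot>\<^bsub>V\<^esub> x)\<rparr>"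

definition restriction_image ::
    "'r ring \<Rightarrow> 's ring \<Rightarrow> ('r \<Rightarrow> 's) \<Rightarrow> ('r, 'u) module set" where
  "restriction_image R S \<phi> = {U. left_module R U \<and>
     (\<exists>V :: ('s, 'u) module. left_module S V \<and> mod_isomorphic R U (restrict_scalars \<phi> V))}"


section \<open>Universal localization\<close>

text \<open>
  The tensor product \<open>S \<otimes>\<^sub>R P\<close> for a ring homomorphism \<open>\<phi>\<close> from \<open>R\<close> to \<open>S\<close>: the free abelian
  group on \<open>S \<times> P\<close> modulo the biadditivity and balancing relations, as a left \<open>S\<close>-module.
\<close>

definition tensor_rel ::
    "'r ring \<Rightarrow> 's ring \<Rightarrow> ('r \<Rightarrow> 's) \<Rightarrow> ('r, 'p) module \<Rightarrow> ('s \<times> 'p \<Rightarrow>\<^sub>0 int) set" where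
  "tensor_rel R S \<phi> P = generate (free_Abelian_group (carrier S \<times> carrier P))
     ({frag_of (s \<oplus>\<^bsub>S\<^esub> t, x) - frag_of (s, x) - frag_of (t, x) | s t x.
         s \<in> carrier S \<and> t \<in> carrier S \<and> x \<in> carrier P} \<union>
      {frag_of (s, x \<oplus>\<^bsub>P\<^esub> y) - frag_of (s, x) - frag_of (s, y) | s x y.
         s \<in> carrier S \<and> x \<in> carrier P \<and> y \<in> carrier P} \<union>
      {frag_of (s \<otimes>\<^bsub>S\<^esub> \<phi> r, x) - frag_of (s, r \<odot>\<^bsub>P\<^esub> x) | s r x.
         s \<in> carrier S \<and> r \<in> carrier R \<and> x \<in> carrier P})"

definition tensor_class ::
    "'r ring \<Rightarrow> 's ring \<Rightarrow> ('r \<Rightarrow> 's) \<Rightarrow> ('r, 'p) module \<Rightarrow> ('s \<times> 'p \<Rightarrow>\<^sub>0 int) \<Rightarrow>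
     ('s \<times> 'p \<Rightarrow>\<^sub>0 int) set" where
  "tensor_class R S \<phi> P c =
     tensor_rel R S \<phi> P #>\<^bsub>free_Abelian_group (carrier S \<times> carrier P)\<^esub> c"

definition tensor ::
    "'r ring \<Rightarrow> 's ring \<Rightarrow> ('r \<Rightarrow> 's) \<Rightarrow> ('r, 'p) module \<Rightarrow>
     ('s, ('s \<times> 'p \<Rightarrow>\<^sub>0 int) set) module" where
  "tensor R S \<phi> P =
    (let Q = free_Abelian_group (carrier S \<times> carrier P) Mod tensor_rel R S \<phi> P in
     \<lparr>carrier = carrier Q, monoid.mult = undefined, one = undefined,
      ring.zero = one Q, ring.add = monoid.mult Q,
      smult = (\<lambda>s A. \<Union>c\<in>A. tensor_class R S \<phi> P
        (frag_extend (\<lambda>(t, x). frag_of (s \<otimes>\<^bsub>S\<^esub> t, x)) c))\<rparr>)"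

definition tensor_map ::
    "'r ring \<Rightarrow> 's ring \<Rightarrow> ('r \<Rightarrow> 's) \<Rightarrow> ('r, 'q) module \<Rightarrow> ('p \<Rightarrow> 'q) \<Rightarrow>
     ('s \<times> 'p \<Rightarrow>\<^sub>0 int) set \<Rightarrow> ('s \<times> 'q \<Rightarrow>\<^sub>0 int) set" where
  "tensor_map R S \<phi> Q \<sigma> A =
     (\<Union>c\<in>A. tensor_class R S \<phi> Q (frag_extend (\<lambda>(t, x). frag_of (t, \<sigma> x)) c))"

definition fg_proj_presentation ::
    "'r ring \<Rightarrow> ('r, 'p) module \<Rightarrow> ('r, 'p, 'q, 'x) ses \<Rightarrow> ('r, 'x) module \<Rightarrow> bool" where
  "fg_proj_presentation R P \<Sigma> X \<longleftrightarrow>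
     fin_gen R P \<and> projective_mod R P \<and>
     fin_gen R (ses_mid \<Sigma>) \<and> projective_mod R (ses_mid \<Sigma>) \<and>
     short_exact R P \<Sigma> X"

text \<open>
  \<open>P X\<close> and \<open>\<Sigma> X\<close> encode the chosen presentation \<open>0 \<rightarrow> P\<^sub>1 \<rightarrow> P\<^sub>0 \<rightarrow> X \<rightarrow> 0\<close>, with
  \<open>\<sigma>\<^sub>X = ses_in (\<Sigma> X)\<close>.
\<close>

definition inverts ::
    "'r ring \<Rightarrow> ('r, 'x) module set \<Rightarrow> (('r, 'x) module \<Rightarrow> ('r, 'p) module) \<Rightarrow>
     (('r, 'x) module \<Rightarrow> ('r, 'p, 'q, 'x) ses) \<Rightarrow> 's ring \<Rightarrow> ('r \<Rightarrow> 's) \<Rightarrow> bool" where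
  "inverts R \<X> P \<Sigma> S \<phi> \<longleftrightarrow>
     (\<forall>X\<in>\<X>. tensor_map R S \<phi> (ses_mid (\<Sigma> X)) (ses_in (\<Sigma> X))
        \<in> mod_iso S (tensor R S \<phi> (P X)) (tensor R S \<phi> (ses_mid (\<Sigma> X))))"

definition universal_localization ::
    "'t itself \<Rightarrow> 'r ring \<Rightarrow> ('r, 'x) module set \<Rightarrow>
     (('r, 'x) module \<Rightarrow> ('r, 'p) module) \<Rightarrow> (('r, 'x) module \<Rightarrow> ('r, 'p, 'q, 'x) ses) \<Rightarrow>
     'l ring \<Rightarrow> ('r \<Rightarrow> 'l) \<Rightarrow> bool" where
  "universal_localization _ R \<X> P \<Sigma> L \<psi> \<longleftrightarrow>
     ring L \<and> \<psi> \<in> ring_hom R L \<and> inverts R \<X> P \<Sigma> L \<psi> \<and>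
     (\<forall>(T :: 't ring) \<phi>. ring T \<and> \<phi> \<in> ring_hom R T \<and> inverts R \<X> P \<Sigma> T \<phi> \<longrightarrow>
        (\<exists>!g. g \<in> ring_hom L T \<inter> extensional (carrier L) \<and>
              (\<forall>r\<in>carrier R. g (\<psi> r) = \<phi> r)))"

end

theory Submission
  imports Defs
begin

text \<open>
  Fix a presentation \<open>0 \<rightarrow> K \<rightarrow> F \<rightarrow> X \<rightarrow> 0\<close> with \<open>F\<close> projective. Then \<open>Ext\<^sup>1(X, Y)\<close> is \<open>Hom(K, Y)\<close>
  modulo restrictions from \<open>F\<close>, and Baer sums and pull-backs of extensions become sums and
  composites of maps. In a universal sequence \<open>0 \<rightarrow> Y \<rightarrow> M \<rightarrow> \<Oplus>X \<rightarrow> 0\<close> the connecting map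
  \<open>Hom(X, \<Oplus>X) \<rightarrow> Ext\<^sup>1(X, Y)\<close> sends a tuple of endomorphisms to the corresponding combination of
  the basis: independence gives \<open>Hom(X, M) = 0\<close> if \<open>Hom(X, Y) = 0\<close>, and generation makes
  \<open>Ext\<^sup>1(X, Y) \<rightarrow> Ext\<^sup>1(X, M)\<close> zero. As \<open>F\<close> and \<open>K\<close> may be chosen finitely generated projective, the
  limit lies in \<open>\<X>\<^sup>\<bottom>\<close>. Maps to modules in \<open>\<X>\<^sup>\<bottom>\<close> extend uniquely along each step, so the limit \<open>L\<close>
  is the reflection of \<open>R\<close>. Right multiplication by \<open>y\<close> on \<open>L\<close> is the unique endomorphism extending
  \<open>r \<mapsto> r y\<close>. A ring homomorphism \<open>R \<rightarrow> T\<close> inverts the presentations iff restriction along them is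
  bijective on maps to \<open>T\<close>-modules, that is, iff all \<open>T\<close>-modules lie in \<open>\<X>\<^sup>\<bottom>\<close>; with the reflection
  property this is universality.
\<close>

section \<open>Left modules and homomorphisms\<close>

text \<open>The obstacle is that the vanishing of \<open>Hom\<close> and \<open>Ext^1\<close> is
  obtained for \<open>L\<close> alone, while it is needed for every \<open>S\<close>-module. It
  passes to finite powers \<open>S^m\<close> coordinate by coordinate, and this already inverts the
  extension of \<open>K -> F\<close> to \<open>S\<close>; composition with that inverse settles all
  \<open>S\<close>-modules. Hence \<open>K\<close> is kept as a summand of some \<open>R^m\<close>.

  Extensions occur with many types of middle terms: basis elements, push-outs, pull-backs, Baer
  sums. The relation \<open>rep\<close> attaches a map \<open>K -> Y\<close> to a sequence with any
  middle term, so that \<open>Ext1\<close> is computed with maps only.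

  Two kinds of presentation are in play: finite ones, derived from finite presentability and
  projective dimension, for the limit and for \<open>S\<close>-modules; and the prescribed ones, for
  tensor products. They meet in \<open>perp01\<close>, whose definition mentions neither.

  Orthogonality enters in one place: the components \<open>X -> X'\<close> of a map into the
  cokernel of a universal sequence vanish for \<open>X' \<noteq> X\<close>, and the others are
  coefficients in \<open>End(X)\<close>.\<close>

locale base_ring = ring R for R :: "'r ring" (structure)
begin

lemma module_abelian_group [simp]: "left_module R M \<Longrightarrow> abelian_group M"
  by (rule left_module.axioms(2))

lemma module_abelian_monoid [simp]: "left_module R M \<Longrightarrow> abelian_monoid M"
  using abelian_group_def module_abelian_group by blast

lemma module_smult_closed [simp]:
  "left_module R M \<Longrightarrow> a \<in> carrier R \<Longrightarrow> x \<in> carrier M \<Longrightarrow> a \<odot>\<^bsub>M\<^esub> x \<in> carrier M"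
  by (rule left_module.smult_closed)

lemma module_smult_l_distr:
  "left_module R M \<Longrightarrow> a \<in> carrier R \<Longrightarrow> b \<in> carrier R \<Longrightarrow> x \<in> carrier M \<Longrightarrow>
    (a \<oplus>\<^bsub>R\<^esub> b) \<odot>\<^bsub>M\<^esub> x = (a \<odot>\<^bsub>M\<^esub> x) \<oplus>\<^bsub>M\<^esub> (b \<odot>\<^bsub>M\<^esub> x)"
  by (rule left_module.smult_l_distr)

lemma module_smult_r_distr:
  "left_module R M \<Longrightarrow> a \<in> carrier R \<Longrightarrow> x \<in> carrier M \<Longrightarrow> y \<in> carrier M \<Longrightarrow>
    a \<odot>\<^bsub>M\<^esub> (x \<oplus>\<^bsub>M\<^esub> y) = (a \<odot>\<^bsub>M\<^esub> x) \<oplus>\<^bsub>M\<^esub> (a \<odot>\<^bsub>M\<^esub> y)"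
  by (rule left_module.smult_r_distr)

lemma module_smult_assoc:
  "left_module R M \<Longrightarrow> a \<in> carrier R \<Longrightarrow> b \<in> carrier R \<Longrightarrow> x \<in> carrier M \<Longrightarrow>
    (a \<otimes>\<^bsub>R\<^esub> b) \<odot>\<^bsub>M\<^esub> x = a \<odot>\<^bsub>M\<^esub> (b \<odot>\<^bsub>M\<^esub> x)"
  by (rule left_module.smult_assoc)

lemma module_smult_one [simp]: "left_module R M \<Longrightarrow> x \<in> carrier M \<Longrightarrow> \<one>\<^bsub>R\<^esub> \<odot>\<^bsub>M\<^esub> x = x"
  by (rule left_module.smult_one)

lemma module_add_closed [simp]:
  "left_module R M \<Longrightarrow> x \<in> carrier M \<Longrightarrow> y \<in> carrier M \<Longrightarrow> x \<oplus>\<^bsub>M\<^esub> y \<in> carrier M"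
  by (simp add: abelian_monoid.a_closed)

lemma module_zero_closed [simp]: "left_module R M \<Longrightarrow> \<zero>\<^bsub>M\<^esub> \<in> carrier M"
  by (simp add: abelian_monoid.zero_closed)

lemma module_neg_closed [simp]: "left_module R M \<Longrightarrow> x \<in> carrier M \<Longrightarrow> \<ominus>\<^bsub>M\<^esub> x \<in> carrier M"
  by (simp add: abelian_group.a_inv_closed)

lemma module_diff_closed [simp]:
  "left_module R M \<Longrightarrow> x \<in> carrier M \<Longrightarrow> y \<in> carrier M \<Longrightarrow> x \<ominus>\<^bsub>M\<^esub> y \<in> carrier M"
  by (simp add: abelian_group.minus_closed)

lemma module_l_zero [simp]: "left_module R M \<Longrightarrow> x \<in> carrier M \<Longrightarrow> \<zero>\<^bsub>M\<^esub> \<oplus>\<^bsub>M\<^esub> x = x"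
  by (simp add: abelian_monoid.l_zero)

lemma module_r_zero [simp]: "left_module R M \<Longrightarrow> x \<in> carrier M \<Longrightarrow> x \<oplus>\<^bsub>M\<^esub> \<zero>\<^bsub>M\<^esub> = x"
  by (simp add: abelian_monoid.r_zero)

lemma module_l_neg [simp]: "left_module R M \<Longrightarrow> x \<in> carrier M \<Longrightarrow> \<ominus>\<^bsub>M\<^esub> x \<oplus>\<^bsub>M\<^esub> x = \<zero>\<^bsub>M\<^esub>"
  by (simp add: abelian_group.l_neg)

lemma module_r_neg [simp]: "left_module R M \<Longrightarrow> x \<in> carrier M \<Longrightarrow> x \<oplus>\<^bsub>M\<^esub> \<ominus>\<^bsub>M\<^esub> x = \<zero>\<^bsub>M\<^esub>"
  by (simp add: abelian_group.r_neg)

lemma module_diff_eq: "x \<ominus>\<^bsub>M\<^esub> y = x \<oplus>\<^bsub>M\<^esub> \<ominus>\<^bsub>M\<^esub> y"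
  by (simp add: a_minus_def)

lemma module_add_assoc:
  "left_module R M \<Longrightarrow> x \<in> carrier M \<Longrightarrow> y \<in> carrier M \<Longrightarrow> z \<in> carrier M \<Longrightarrow>
    x \<oplus>\<^bsub>M\<^esub> y \<oplus>\<^bsub>M\<^esub> z = x \<oplus>\<^bsub>M\<^esub> (y \<oplus>\<^bsub>M\<^esub> z)"
  by (simp add: abelian_monoid.a_assoc)

lemma module_add_comm:
  "left_module R M \<Longrightarrow> x \<in> carrier M \<Longrightarrow> y \<in> carrier M \<Longrightarrow> x \<oplus>\<^bsub>M\<^esub> y = y \<oplus>\<^bsub>M\<^esub> x"
  by (simp add: abelian_monoid.a_comm)

lemma module_add_lcomm:
  "left_module R M \<Longrightarrow> x \<in> carrier M \<Longrightarrow> y \<in> carrier M \<Longrightarrow> z \<in> carrier M \<Longrightarrow>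
    x \<oplus>\<^bsub>M\<^esub> (y \<oplus>\<^bsub>M\<^esub> z) = y \<oplus>\<^bsub>M\<^esub> (x \<oplus>\<^bsub>M\<^esub> z)"
  by (simp add: abelian_monoid.a_lcomm)

lemmas module_add_ac = module_add_assoc module_add_comm module_add_lcomm

lemma module_neg_add_cancel [simp]:
  "left_module R M \<Longrightarrow> x \<in> carrier M \<Longrightarrow> y \<in> carrier M \<Longrightarrow> \<ominus>\<^bsub>M\<^esub> x \<oplus>\<^bsub>M\<^esub> (x \<oplus>\<^bsub>M\<^esub> y) = y"
  by (simp add: abelian_group.r_neg1)

lemma module_neg_add:
  "left_module R M \<Longrightarrow> x \<in> carrier M \<Longrightarrow> y \<in> carrier M \<Longrightarrow>
    \<ominus>\<^bsub>M\<^esub> (x \<oplus>\<^bsub>M\<^esub> y) = \<ominus>\<^bsub>M\<^esub> x \<oplus>\<^bsub>M\<^esub> \<ominus>\<^bsub>M\<^esub> y"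
  by (simp add: abelian_group.minus_add)

lemma module_neg_neg [simp]: "left_module R M \<Longrightarrow> x \<in> carrier M \<Longrightarrow> \<ominus>\<^bsub>M\<^esub> (\<ominus>\<^bsub>M\<^esub> x) = x"
  by (simp add: abelian_group.minus_minus)

lemma module_neg_zero [simp]: "left_module R M \<Longrightarrow> \<ominus>\<^bsub>M\<^esub> \<zero>\<^bsub>M\<^esub> = \<zero>\<^bsub>M\<^esub>"
  by (metis module_l_neg module_neg_closed module_r_zero module_zero_closed)

lemma module_add_cancel:
  "left_module R M \<Longrightarrow> x \<in> carrier M \<Longrightarrow> y \<in> carrier M \<Longrightarrow> z \<in> carrier M \<Longrightarrow>
    x \<oplus>\<^bsub>M\<^esub> y = x \<oplus>\<^bsub>M\<^esub> z \<longleftrightarrow> y = z"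
  by (metis module_neg_add_cancel)

lemma module_diff_zero [simp]: "left_module R M \<Longrightarrow> x \<in> carrier M \<Longrightarrow> x \<ominus>\<^bsub>M\<^esub> \<zero>\<^bsub>M\<^esub> = x"
  by (simp add: module_diff_eq)

lemma module_diff_add_cancel [simp]:
  "left_module R M \<Longrightarrow> x \<in> carrier M \<Longrightarrow> y \<in> carrier M \<Longrightarrow> (x \<ominus>\<^bsub>M\<^esub> y) \<oplus>\<^bsub>M\<^esub> y = x"
  by (simp add: module_diff_eq module_add_assoc)

lemma module_diff_zero_iff [simp]:
  "left_module R M \<Longrightarrow> x \<in> carrier M \<Longrightarrow> y \<in> carrier M \<Longrightarrow> x \<ominus>\<^bsub>M\<^esub> y = \<zero>\<^bsub>M\<^esub> \<longleftrightarrow> x = y"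
  by (metis module_diff_add_cancel module_l_zero module_diff_eq module_r_neg)

lemma module_diff_self [simp]: "left_module R M \<Longrightarrow> x \<in> carrier M \<Longrightarrow> x \<ominus>\<^bsub>M\<^esub> x = \<zero>\<^bsub>M\<^esub>"
  by simp

lemma module_add_diff_cancel [simp]:
  "left_module R M \<Longrightarrow> x \<in> carrier M \<Longrightarrow> y \<in> carrier M \<Longrightarrow> (x \<oplus>\<^bsub>M\<^esub> y) \<ominus>\<^bsub>M\<^esub> y = x"
  by (simp add: module_diff_eq module_add_assoc)

lemma module_add_diff_cancel_left [simp]:
  "left_module R M \<Longrightarrow> x \<in> carrier M \<Longrightarrow> y \<in> carrier M \<Longrightarrow> (y \<oplus>\<^bsub>M\<^esub> x) \<ominus>\<^bsub>M\<^esub> y = x"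
  by (metis module_add_comm module_add_diff_cancel)

lemma module_smult_zero [simp]:
  assumes "left_module R M" "r \<in> carrier R" shows "r \<odot>\<^bsub>M\<^esub> \<zero>\<^bsub>M\<^esub> = \<zero>\<^bsub>M\<^esub>"
proof -
  have "r \<odot>\<^bsub>M\<^esub> \<zero>\<^bsub>M\<^esub> \<oplus>\<^bsub>M\<^esub> r \<odot>\<^bsub>M\<^esub> \<zero>\<^bsub>M\<^esub> = r \<odot>\<^bsub>M\<^esub> \<zero>\<^bsub>M\<^esub> \<oplus>\<^bsub>M\<^esub> \<zero>\<^bsub>M\<^esub>"
    using assms by (simp flip: module_smult_r_distr)
  then show ?thesis using assms by (subst (asm) module_add_cancel) auto
qed

lemma module_smult_zero_left [simp]:
  assumes "left_module R M" "x \<in> carrier M" shows "\<zero>\<^bsub>R\<^esub> \<odot>\<^bsub>M\<^esub> x = \<zero>\<^bsub>M\<^esub>"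
proof -
  have "\<zero>\<^bsub>R\<^esub> \<odot>\<^bsub>M\<^esub> x \<oplus>\<^bsub>M\<^esub> \<zero>\<^bsub>R\<^esub> \<odot>\<^bsub>M\<^esub> x = \<zero>\<^bsub>R\<^esub> \<odot>\<^bsub>M\<^esub> x \<oplus>\<^bsub>M\<^esub> \<zero>\<^bsub>M\<^esub>"
    using assms by (simp flip: module_smult_l_distr)
  then show ?thesis using assms by (subst (asm) module_add_cancel) auto
qed

lemma module_smult_neg:
  assumes "left_module R M" "r \<in> carrier R" "x \<in> carrier M"
  shows "r \<odot>\<^bsub>M\<^esub> (\<ominus>\<^bsub>M\<^esub> x) = \<ominus>\<^bsub>M\<^esub> (r \<odot>\<^bsub>M\<^esub> x)"
proof -
  have "r \<odot>\<^bsub>M\<^esub> x \<oplus>\<^bsub>M\<^esub> r \<odot>\<^bsub>M\<^esub> (\<ominus>\<^bsub>M\<^esub> x) = r \<odot>\<^bsub>M\<^esub> x \<oplus>\<^bsub>M\<^esub> \<ominus>\<^bsub>M\<^esub> (r \<odot>\<^bsub>M\<^esub> x)"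
    using assms by (simp flip: module_smult_r_distr)
  then show ?thesis using assms by (subst (asm) module_add_cancel) auto
qed

lemma left_moduleI:
  assumes "abelian_group M"
    and "\<And>a x. a \<in> carrier R \<Longrightarrow> x \<in> carrier M \<Longrightarrow> a \<odot>\<^bsub>M\<^esub> x \<in> carrier M"
    and "\<And>a b x. a \<in> carrier R \<Longrightarrow> b \<in> carrier R \<Longrightarrow> x \<in> carrier M \<Longrightarrow>
        (a \<oplus>\<^bsub>R\<^esub> b) \<odot>\<^bsub>M\<^esub> x = (a \<odot>\<^bsub>M\<^esub> x) \<oplus>\<^bsub>M\<^esub> (b \<odot>\<^bsub>M\<^esub> x)"
    and "\<And>a x y. a \<in> carrier R \<Longrightarrow> x \<in> carrier M \<Longrightarrow> y \<in> carrier M \<Longrightarrow>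
        a \<odot>\<^bsub>M\<^esub> (x \<oplus>\<^bsub>M\<^esub> y) = (a \<odot>\<^bsub>M\<^esub> x) \<oplus>\<^bsub>M\<^esub> (a \<odot>\<^bsub>M\<^esub> y)"
    and "\<And>a b x. a \<in> carrier R \<Longrightarrow> b \<in> carrier R \<Longrightarrow> x \<in> carrier M \<Longrightarrow>
        (a \<otimes>\<^bsub>R\<^esub> b) \<odot>\<^bsub>M\<^esub> x = a \<odot>\<^bsub>M\<^esub> (b \<odot>\<^bsub>M\<^esub> x)"
    and "\<And>x. x \<in> carrier M \<Longrightarrow> \<one>\<^bsub>R\<^esub> \<odot>\<^bsub>M\<^esub> x = x"
  shows "left_module R M"
  unfolding left_module_def left_module_axioms_def using assms ring_axioms by auto

section \<open>Homomorphisms and their factorizations\<close>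

lemma mod_hom_closed: "h \<in> mod_hom R M N \<Longrightarrow> x \<in> carrier M \<Longrightarrow> h x \<in> carrier N"
  by (auto simp: mod_hom_def)

lemma mod_hom_add: "h \<in> mod_hom R M N \<Longrightarrow> x \<in> carrier M \<Longrightarrow> y \<in> carrier M \<Longrightarrow>
    h (x \<oplus>\<^bsub>M\<^esub> y) = h x \<oplus>\<^bsub>N\<^esub> h y"
  by (auto simp: mod_hom_def)

lemma mod_hom_smult: "h \<in> mod_hom R M N \<Longrightarrow> r \<in> carrier R \<Longrightarrow> x \<in> carrier M \<Longrightarrow>
    h (r \<odot>\<^bsub>M\<^esub> x) = r \<odot>\<^bsub>N\<^esub> h x"
  by (auto simp: mod_hom_def)

lemma mod_homI:
  assumes "\<And>x. x \<in> carrier M \<Longrightarrow> h x \<in> carrier N"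
    and "\<And>x y. x \<in> carrier M \<Longrightarrow> y \<in> carrier M \<Longrightarrow> h (x \<oplus>\<^bsub>M\<^esub> y) = h x \<oplus>\<^bsub>N\<^esub> h y"
    and "\<And>r x. r \<in> carrier R \<Longrightarrow> x \<in> carrier M \<Longrightarrow> h (r \<odot>\<^bsub>M\<^esub> x) = r \<odot>\<^bsub>N\<^esub> h x"
  shows "h \<in> mod_hom R M N"
  using assms by (auto simp: mod_hom_def)

lemma mod_hom_zero:
  assumes "h \<in> mod_hom R M N" "left_module R M" "left_module R N"
  shows "h \<zero>\<^bsub>M\<^esub> = \<zero>\<^bsub>N\<^esub>"
proof -
  have "h \<zero>\<^bsub>M\<^esub> \<oplus>\<^bsub>N\<^esub> h \<zero>\<^bsub>M\<^esub> = h \<zero>\<^bsub>M\<^esub> \<oplus>\<^bsub>N\<^esub> \<zero>\<^bsub>N\<^esub>"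
    using assms by (simp add: mod_hom_closed flip: mod_hom_add[OF assms(1)])
  then show ?thesis using assms by (subst (asm) module_add_cancel) (auto simp: mod_hom_closed)
qed

lemma mod_hom_neg:
  assumes "h \<in> mod_hom R M N" "left_module R M" "left_module R N" "x \<in> carrier M"
  shows "h (\<ominus>\<^bsub>M\<^esub> x) = \<ominus>\<^bsub>N\<^esub> h x"
proof -
  have "h x \<oplus>\<^bsub>N\<^esub> h (\<ominus>\<^bsub>M\<^esub> x) = h x \<oplus>\<^bsub>N\<^esub> \<ominus>\<^bsub>N\<^esub> h x"
    using assms by (simp add: mod_hom_closed mod_hom_zero flip: mod_hom_add[OF assms(1)])
  then show ?thesis using assms by (subst (asm) module_add_cancel) (auto simp: mod_hom_closed)
qed

lemma mod_hom_diff: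
  assumes "h \<in> mod_hom R M N" "left_module R M" "left_module R N" "x \<in> carrier M" "y \<in> carrier M"
  shows "h (x \<ominus>\<^bsub>M\<^esub> y) = h x \<ominus>\<^bsub>N\<^esub> h y"
  using assms by (simp add: module_diff_eq mod_hom_add mod_hom_neg)

lemmas mod_hom_basic = mod_hom_closed mod_hom_add mod_hom_smult mod_hom_zero mod_hom_neg mod_hom_diff

text \<open>Homomorphisms are functions on a whole type that are constrained on the carrier only.
  Membership is insensitive to values elsewhere, so a map may be replaced by its restriction or by
  any pointwise equal expression.\<close>

lemma mod_hom_cong:
  "f \<in> mod_hom R M N \<Longrightarrow> left_module R M \<Longrightarrow> (\<And>x. x \<in> carrier M \<Longrightarrow> f x = g x) \<Longrightarrow> g \<in> mod_hom R M N"
  by (intro mod_homI; metis mod_hom_closed mod_hom_add mod_hom_smult module_add_closed module_smult_closed)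

lemma mod_hom_id: "(\<lambda>x. x) \<in> mod_hom R M M"
  by (auto simp: mod_hom_def)

lemma mod_hom_compose:
  "f \<in> mod_hom R A B \<Longrightarrow> g \<in> mod_hom R B C \<Longrightarrow> (\<lambda>x. g (f x)) \<in> mod_hom R A C"
  by (auto simp: mod_hom_def Pi_iff)

lemma mod_hom_zero_map: "left_module R B \<Longrightarrow> (\<lambda>x. \<zero>\<^bsub>B\<^esub>) \<in> mod_hom R A B"
  by (auto simp: mod_hom_def)

lemma mod_hom_plus:
  "left_module R B \<Longrightarrow> f \<in> mod_hom R A B \<Longrightarrow> g \<in> mod_hom R A B \<Longrightarrow>
    (\<lambda>x. f x \<oplus>\<^bsub>B\<^esub> g x) \<in> mod_hom R A B"
  by (rule mod_homI) (simp_all add: mod_hom_closed mod_hom_add mod_hom_smult module_add_ac module_smult_r_distr)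

lemma mod_hom_uminus:
  "left_module R B \<Longrightarrow> f \<in> mod_hom R A B \<Longrightarrow> (\<lambda>x. \<ominus>\<^bsub>B\<^esub> f x) \<in> mod_hom R A B"
  by (rule mod_homI) (simp_all add: mod_hom_closed mod_hom_add mod_hom_smult module_neg_add module_smult_neg)

lemma mod_hom_minus:
  "left_module R B \<Longrightarrow> f \<in> mod_hom R A B \<Longrightarrow> g \<in> mod_hom R A B \<Longrightarrow>
    (\<lambda>x. f x \<ominus>\<^bsub>B\<^esub> g x) \<in> mod_hom R A B"
  unfolding module_diff_eq by (intro mod_hom_plus mod_hom_uminus)

lemma mod_hom_inj_iff:
  assumes "h \<in> mod_hom R M N" "left_module R M" "left_module R N"
  shows "inj_on h (carrier M) \<longleftrightarrow> (\<forall>x\<in>carrier M. h x = \<zero>\<^bsub>N\<^esub> \<longrightarrow> x = \<zero>\<^bsub>M\<^esub>)" (is "_ \<longleftrightarrow> ?k")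
proof
  assume ?k
  show "inj_on h (carrier M)"
  proof (rule inj_onI)
    fix x y assume xy: "x \<in> carrier M" "y \<in> carrier M" "h x = h y"
    then have "h (x \<ominus>\<^bsub>M\<^esub> y) = \<zero>\<^bsub>N\<^esub>" using assms by (simp add: mod_hom_diff mod_hom_closed)
    then show "x = y" using \<open>?k\<close> xy assms(2) by (metis module_diff_zero_iff module_diff_closed)
  qed
next
  assume "inj_on h (carrier M)"
  then show ?k using assms by (metis inj_on_def mod_hom_zero module_zero_closed)
qed

text \<open>\<open>G\<close> is evaluated at an arbitrary preimage. Two preimages differ by an
  element of the kernel of \<open>p\<close>, where \<open>g\<close> vanishes, so the choice does not
  matter.\<close>

lemma mod_hom_through_surj:
  assumes "left_module R A" "left_module R B" "left_module R W"
    and p: "p \<in> mod_hom R A B" "p ` carrier A = carrier B"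
    and g: "g \<in> mod_hom R A W" "\<And>a. a \<in> carrier A \<Longrightarrow> p a = \<zero>\<^bsub>B\<^esub> \<Longrightarrow> g a = \<zero>\<^bsub>W\<^esub>"
  obtains G where "G \<in> mod_hom R B W" "\<And>a. a \<in> carrier A \<Longrightarrow> G (p a) = g a"
proof
  define G where "G b = g (inv_into (carrier A) p b)" for b
  have *: "G (p a) = g a" if "a \<in> carrier A" for a
  proof -
    define a' where "a' = inv_into (carrier A) p (p a)"
    have a': "a' \<in> carrier A" "p a' = p a"
      using that by (auto simp: a'_def inv_into_into f_inv_into_f)
    then have "p (a' \<ominus>\<^bsub>A\<^esub> a) = \<zero>\<^bsub>B\<^esub>" using that assms by (simp add: mod_hom_basic)
    then have "g a' \<ominus>\<^bsub>W\<^esub> g a = \<zero>\<^bsub>W\<^esub>"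
      using g(2)[of "a' \<ominus>\<^bsub>A\<^esub> a"] a' that assms by (simp add: mod_hom_basic)
    then show ?thesis using a' that assms by (simp add: mod_hom_basic G_def a'_def)
  qed
  show "G (p a) = g a" if "a \<in> carrier A" for a by (rule * [OF that])
  show "G \<in> mod_hom R B W"
  proof (rule mod_homI)
    fix x assume "x \<in> carrier B"
    then obtain a where a: "a \<in> carrier A" "x = p a" using p(2) by auto
    then show "G x \<in> carrier W" using * g(1) by (simp add: mod_hom_closed)
    fix r assume "r \<in> carrier R"
    then show "G (r \<odot>\<^bsub>B\<^esub> x) = r \<odot>\<^bsub>W\<^esub> G x"
      using a assms by (metis * mod_hom_smult module_smult_closed)
  next
    fix x y assume "x \<in> carrier B" "y \<in> carrier B"
    then obtain a b where a: "a \<in> carrier A" "x = p a" "b \<in> carrier A" "y = p b" using p(2) by (metis imageE)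
    then show "G (x \<oplus>\<^bsub>B\<^esub> y) = G x \<oplus>\<^bsub>W\<^esub> G y"
      using assms by (metis * mod_hom_add module_add_closed)
  qed
qed

text \<open>The preimage of \<open>f a\<close> under \<open>i\<close> is unique, so taking preimages
  pointwise respects the operations.\<close>

lemma mod_hom_through_inj:
  assumes "left_module R A" "left_module R Y" "left_module R M"
    and i: "i \<in> mod_hom R Y M" "inj_on i (carrier Y)"
    and f: "f \<in> mod_hom R A M" "\<And>a. a \<in> carrier A \<Longrightarrow> f a \<in> i ` carrier Y"
  obtains g where "g \<in> mod_hom R A Y" "\<And>a. a \<in> carrier A \<Longrightarrow> i (g a) = f a"
proof
  define g where "g a = inv_into (carrier Y) i (f a)" for a
  have gc: "g a \<in> carrier Y" and *: "i (g a) = f a" if "a \<in> carrier A" for a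
    using f(2)[OF that] by (auto simp: g_def inv_into_into f_inv_into_f)
  show "i (g a) = f a" if "a \<in> carrier A" for a by (rule * [OF that])
  show "g \<in> mod_hom R A Y"
  proof (rule mod_homI)
    fix x assume x: "x \<in> carrier A"
    show "g x \<in> carrier Y" by (rule gc[OF x])
    fix r assume r: "r \<in> carrier R"
    have "i (g (r \<odot>\<^bsub>A\<^esub> x)) = i (r \<odot>\<^bsub>Y\<^esub> g x)"
      using x r assms gc by (simp add: * mod_hom_basic)
    then show "g (r \<odot>\<^bsub>A\<^esub> x) = r \<odot>\<^bsub>Y\<^esub> g x"
      using x r assms gc by (intro inj_onD[OF i(2)]) auto
  next
    fix x y assume x: "x \<in> carrier A" "y \<in> carrier A"
    have "i (g (x \<oplus>\<^bsub>A\<^esub> y)) = i (g x \<oplus>\<^bsub>Y\<^esub> g y)"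
      using x assms gc by (simp add: * mod_hom_basic)
    then show "g (x \<oplus>\<^bsub>A\<^esub> y) = g x \<oplus>\<^bsub>Y\<^esub> g y"
      using x assms gc by (intro inj_onD[OF i(2)]) auto
  qed
qed

lemma mod_iso_inverse:
  assumes "h \<in> mod_iso R M N" "left_module R M" "left_module R N"
  obtains g where "g \<in> mod_iso R N M" "\<And>x. x \<in> carrier M \<Longrightarrow> g (h x) = x"
    "\<And>y. y \<in> carrier N \<Longrightarrow> h (g y) = y"
proof -
  have h: "h \<in> mod_hom R M N" and b: "inj_on h (carrier M)" "h ` carrier M = carrier N"
    using assms by (auto simp: mod_iso_def bij_betw_def)
  obtain g where g: "g \<in> mod_hom R N M" "\<And>y. y \<in> carrier N \<Longrightarrow> h (g y) = y"
    using mod_hom_through_inj[OF assms(3,2,3) h b(1) mod_hom_id] b(2) by metis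
  have gh: "g (h x) = x" if "x \<in> carrier M" for x
    using that b(1) g h by (meson inj_onD mod_hom_closed)
  have "bij_betw g (carrier N) (carrier M)"
    by (rule bij_betw_byWitness[where f' = h]) (use g gh h in \<open>auto simp: mod_hom_closed\<close>)
  with g gh show thesis by (intro that) (auto simp: mod_iso_def)
qed

text \<open>Covers both homomorphic images and directed unions of such.\<close>

lemma left_module_locally:
  fixes Q :: "('r, 'q) module"
  assumes ne: "carrier Q \<noteq> {}"
    and loc: "\<And>x y z. x \<in> carrier Q \<Longrightarrow> y \<in> carrier Q \<Longrightarrow> z \<in> carrier Q \<Longrightarrow>
      \<exists>(M :: ('r, 'm) module) \<pi>. left_module R M \<and> \<pi> \<in> mod_hom R M Q \<and> \<pi> \<zero>\<^bsub>M\<^esub> = \<zero>\<^bsub>Q\<^esub> \<and>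
        {x, y, z} \<subseteq> \<pi> ` carrier M"
  shows "left_module R Q"
proof -
  have *: "\<exists>(M :: ('r, 'm) module) \<pi> a b c. left_module R M \<and> \<pi> \<in> mod_hom R M Q \<and> \<pi> \<zero>\<^bsub>M\<^esub> = \<zero>\<^bsub>Q\<^esub> \<and>
      a \<in> carrier M \<and> b \<in> carrier M \<and> c \<in> carrier M \<and> x = \<pi> a \<and> y = \<pi> b \<and> z = \<pi> c"
    if xyz: "x \<in> carrier Q" "y \<in> carrier Q" "z \<in> carrier Q" for x y z
  proof -
    obtain M :: "('r, 'm) module" and \<pi> where M: "left_module R M" "\<pi> \<in> mod_hom R M Q" "\<pi> \<zero>\<^bsub>M\<^esub> = \<zero>\<^bsub>Q\<^esub>"
        and sub: "{x, y, z} \<subseteq> \<pi> ` carrier M"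
      using loc[OF xyz] by blast
    from sub obtain a b c where "a \<in> carrier M" "b \<in> carrier M" "c \<in> carrier M" "x = \<pi> a" "y = \<pi> b" "z = \<pi> c"
      by (auto elim!: imageE)
    with M show ?thesis by blast
  qed
  show ?thesis
  proof (rule left_moduleI)
    show "abelian_group Q"
    proof (rule abelian_groupI)
      fix x y z assume c: "x \<in> carrier Q" "y \<in> carrier Q" "z \<in> carrier Q"
      obtain M :: "('r, 'm) module" and \<pi> a b d where M: "left_module R M" and \<pi>: "\<pi> \<in> mod_hom R M Q" "\<pi> \<zero>\<^bsub>M\<^esub> = \<zero>\<^bsub>Q\<^esub>"
          and abd: "a \<in> carrier M" "b \<in> carrier M" "d \<in> carrier M" and e: "x = \<pi> a" "y = \<pi> b" "z = \<pi> d"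
        using *[OF c] by blast
      have add: "\<pi> u \<oplus>\<^bsub>Q\<^esub> \<pi> v = \<pi> (u \<oplus>\<^bsub>M\<^esub> v)" if "u \<in> carrier M" "v \<in> carrier M" for u v
        using mod_hom_add[OF \<pi>(1)] that by simp
      note s = e add abd M mod_hom_closed[OF \<pi>(1)] \<pi>(2)[symmetric]
      show "x \<oplus>\<^bsub>Q\<^esub> y \<in> carrier Q" by (simp add: s)
      show "x \<oplus>\<^bsub>Q\<^esub> y \<oplus>\<^bsub>Q\<^esub> z = x \<oplus>\<^bsub>Q\<^esub> (y \<oplus>\<^bsub>Q\<^esub> z)" by (simp add: s module_add_assoc)
      show "x \<oplus>\<^bsub>Q\<^esub> y = y \<oplus>\<^bsub>Q\<^esub> x" by (simp add: s module_add_comm)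
      show "\<zero>\<^bsub>Q\<^esub> \<oplus>\<^bsub>Q\<^esub> x = x" by (simp add: s)
      show "\<exists>y\<in>carrier Q. y \<oplus>\<^bsub>Q\<^esub> x = \<zero>\<^bsub>Q\<^esub>"
        by (intro bexI[of _ "\<pi> (\<ominus>\<^bsub>M\<^esub> a)"]) (simp_all add: s)
    next
      obtain x where "x \<in> carrier Q" using ne by auto
      with *[of x x x] show "\<zero>\<^bsub>Q\<^esub> \<in> carrier Q" by (metis mod_hom_closed module_zero_closed)
    qed
  next
    fix r r' x y assume r: "r \<in> carrier R" and x: "x \<in> carrier Q"
    obtain M :: "('r, 'm) module" and \<pi> a where M: "left_module R M" and \<pi>: "\<pi> \<in> mod_hom R M Q"
        and abd: "a \<in> carrier M" and e: "x = \<pi> a"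
      using *[OF x x x] by blast
    have add: "\<pi> u \<oplus>\<^bsub>Q\<^esub> \<pi> v = \<pi> (u \<oplus>\<^bsub>M\<^esub> v)" if "u \<in> carrier M" "v \<in> carrier M" for u v
      using mod_hom_add[OF \<pi>(1)] that by simp
    have sm: "q \<odot>\<^bsub>Q\<^esub> \<pi> v = \<pi> (q \<odot>\<^bsub>M\<^esub> v)" if "q \<in> carrier R" "v \<in> carrier M" for q v
      using mod_hom_smult[OF \<pi>(1)] that by simp
    note s = e add sm abd M mod_hom_closed[OF \<pi>(1)] r
    show "r \<odot>\<^bsub>Q\<^esub> x \<in> carrier Q" by (simp add: s)
    show "r \<odot>\<^bsub>Q\<^esub> (x \<oplus>\<^bsub>Q\<^esub> y) = r \<odot>\<^bsub>Q\<^esub> x \<oplus>\<^bsub>Q\<^esub> r \<odot>\<^bsub>Q\<^esub> y" if y: "y \<in> carrier Q"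
    proof -
      obtain M :: "('r, 'm) module" and \<pi> a b where M: "left_module R M" and \<pi>: "\<pi> \<in> mod_hom R M Q"
          and abd: "a \<in> carrier M" "b \<in> carrier M" and e: "x = \<pi> a" "y = \<pi> b"
        using *[OF x y x] by blast
      show ?thesis using M abd r
        by (simp add: e module_smult_r_distr flip: mod_hom_add[OF \<pi>] mod_hom_smult[OF \<pi>])
    qed
    assume r': "r' \<in> carrier R"
    show "(r \<oplus> r') \<odot>\<^bsub>Q\<^esub> x = r \<odot>\<^bsub>Q\<^esub> x \<oplus>\<^bsub>Q\<^esub> r' \<odot>\<^bsub>Q\<^esub> x"
      by (simp add: s r' module_smult_l_distr)
    show "r \<otimes> r' \<odot>\<^bsub>Q\<^esub> x = r \<odot>\<^bsub>Q\<^esub> (r' \<odot>\<^bsub>Q\<^esub> x)"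
      by (simp add: s r' module_smult_assoc)
  next
    fix x assume x: "x \<in> carrier Q"
    then show "\<one> \<odot>\<^bsub>Q\<^esub> x = x"
      using *[OF x x x] by (metis mod_hom_smult module_smult_one one_closed)
  qed
qed

lemma left_module_image:
  fixes M :: "('r, 'a) module"
  assumes "left_module R M" "\<pi> \<in> mod_hom R M Q" "\<pi> \<zero>\<^bsub>M\<^esub> = \<zero>\<^bsub>Q\<^esub>" "\<pi> ` carrier M = carrier Q"
  shows "left_module R Q"
proof (rule left_module_locally)
  show "carrier Q \<noteq> {}" using assms by (metis empty_iff image_is_empty module_zero_closed)
  show "\<exists>(M' :: ('r, 'a) module) \<pi>. left_module R M' \<and> \<pi> \<in> mod_hom R M' Q \<and> \<pi> \<zero>\<^bsub>M'\<^esub> = \<zero>\<^bsub>Q\<^esub> \<and>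
      {x, y, z} \<subseteq> \<pi> ` carrier M'" if "x \<in> carrier Q" "y \<in> carrier Q" "z \<in> carrier Q" for x y z
    using assms that by (intro exI[of _ M] exI[of _ \<pi>]) simp
qed

lemma left_module_submodule:
  assumes M: "left_module R M" and N: "N \<subseteq> carrier M" "\<zero>\<^bsub>M\<^esub> \<in> N"
    "\<And>x y. x \<in> N \<Longrightarrow> y \<in> N \<Longrightarrow> x \<oplus>\<^bsub>M\<^esub> y \<in> N" "\<And>r x. r \<in> carrier R \<Longrightarrow> x \<in> N \<Longrightarrow> r \<odot>\<^bsub>M\<^esub> x \<in> N"
  shows "left_module R (M\<lparr>carrier := N\<rparr>)"
proof (rule left_moduleI)
  \<comment> \<open>Negatives are the multiples by \<open>\<ominus> \<one>\<close>, so closure under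
    scalars supplies them.\<close>
  have neg: "\<ominus>\<^bsub>M\<^esub> x \<in> N" if "x \<in> N" for x
  proof -
    have x: "x \<in> carrier M" using that N(1) by auto
    have "x \<oplus>\<^bsub>M\<^esub> (\<ominus>\<^bsub>R\<^esub> \<one>\<^bsub>R\<^esub>) \<odot>\<^bsub>M\<^esub> x = (\<one>\<^bsub>R\<^esub> \<oplus>\<^bsub>R\<^esub> \<ominus>\<^bsub>R\<^esub> \<one>\<^bsub>R\<^esub>) \<odot>\<^bsub>M\<^esub> x"
      using x M by (simp add: module_smult_l_distr)
    also have "\<dots> = \<zero>\<^bsub>R\<^esub> \<odot>\<^bsub>M\<^esub> x" by (simp add: r_neg)
    also have "\<dots> = \<zero>\<^bsub>M\<^esub>" using x M by simp
    finally have "\<ominus>\<^bsub>M\<^esub> x = (\<ominus>\<^bsub>R\<^esub> \<one>\<^bsub>R\<^esub>) \<odot>\<^bsub>M\<^esub> x"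
      using x M by (metis a_inv_closed one_closed module_neg_add_cancel module_neg_closed
          module_r_zero module_smult_closed)
    then show ?thesis using N(4) that by simp
  qed
  show "abelian_group (M\<lparr>carrier := N\<rparr>)"
  proof (rule abelian_groupI)
    show "\<exists>y\<in>carrier (M\<lparr>carrier := N\<rparr>). y \<oplus>\<^bsub>M\<lparr>carrier := N\<rparr>\<^esub> x = \<zero>\<^bsub>M\<lparr>carrier := N\<rparr>\<^esub>"
      if "x \<in> carrier (M\<lparr>carrier := N\<rparr>)" for x
      using that neg M N(1) by (auto intro!: bexI[of _ "\<ominus>\<^bsub>M\<^esub> x"])
  qed (use M N in \<open>auto simp: subset_iff module_add_ac\<close>)
qed (use M N in \<open>auto simp: subset_iff module_smult_r_distr module_smult_l_distr module_smult_assoc\<close>)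

section \<open>The regular module and binary products\<close>

lemma regular_module_simps [simp]:
  "carrier (regular_module R) = carrier R" "\<zero>\<^bsub>regular_module R\<^esub> = \<zero>\<^bsub>R\<^esub>"
  "x \<oplus>\<^bsub>regular_module R\<^esub> y = x \<oplus>\<^bsub>R\<^esub> y" "x \<odot>\<^bsub>regular_module R\<^esub> y = x \<otimes>\<^bsub>R\<^esub> y"
  by (auto simp: regular_module_def)

lemma left_module_regular [simp]: "left_module R (regular_module R)"
proof (rule left_moduleI)
  show "abelian_group (regular_module R)"
    by (rule abelian_groupI) (auto simp: a_ac l_neg intro: bexI[of _ "\<ominus>\<^bsub>R\<^esub> x" for x] simp: a_comm)
qed (auto simp: l_distr r_distr m_assoc)

lemma mod_hom_smult_right: "left_module R M \<Longrightarrow> x \<in> carrier M \<Longrightarrow>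
    (\<lambda>r. r \<odot>\<^bsub>M\<^esub> x) \<in> mod_hom R (regular_module R) M"
  by (rule mod_homI) (auto simp: module_smult_l_distr module_smult_assoc)

lemma mod_prod_simps [simp]:
  "carrier (mod_prod M N) = carrier M \<times> carrier N" "\<zero>\<^bsub>mod_prod M N\<^esub> = (\<zero>\<^bsub>M\<^esub>, \<zero>\<^bsub>N\<^esub>)"
  "(x, y) \<oplus>\<^bsub>mod_prod M N\<^esub> (x', y') = (x \<oplus>\<^bsub>M\<^esub> x', y \<oplus>\<^bsub>N\<^esub> y')"
  "r \<odot>\<^bsub>mod_prod M N\<^esub> (x, y) = (r \<odot>\<^bsub>M\<^esub> x, r \<odot>\<^bsub>N\<^esub> y)"
  by (auto simp: mod_prod_def)

lemma left_module_prod [simp]: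
  assumes "left_module R M" "left_module R N"
  shows "left_module R (mod_prod M N)"
proof (rule left_moduleI)
  show "abelian_group (mod_prod M N)"
  proof (rule abelian_groupI)
    show "\<exists>y\<in>carrier (mod_prod M N). y \<oplus>\<^bsub>mod_prod M N\<^esub> x = \<zero>\<^bsub>mod_prod M N\<^esub>"
      if "x \<in> carrier (mod_prod M N)" for x
      using that assms by (cases x) (auto intro!: bexI[of _ "\<ominus>\<^bsub>M\<^esub> fst x"] bexI[of _ "\<ominus>\<^bsub>N\<^esub> snd x"])
  qed (use assms in \<open>auto simp: module_add_ac\<close>)
qed (use assms in \<open>auto simp: module_smult_r_distr module_smult_l_distr module_smult_assoc\<close>)

lemma mod_hom_prod_sum:
  assumes "left_module R W" "f \<in> mod_hom R A W" "g \<in> mod_hom R B W"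
  shows "(\<lambda>(a, b). f a \<oplus>\<^bsub>W\<^esub> g b) \<in> mod_hom R (mod_prod A B) W"
  by (rule mod_homI)
    (use assms in \<open>auto simp: mod_hom_closed mod_hom_add mod_hom_smult module_add_ac module_smult_r_distr\<close>)

lemma mod_hom_pair:
  "f \<in> mod_hom R A B \<Longrightarrow> g \<in> mod_hom R A C \<Longrightarrow> (\<lambda>x. (f x, g x)) \<in> mod_hom R A (mod_prod B C)"
  by (rule mod_homI) (auto simp: mod_hom_closed mod_hom_add mod_hom_smult)

end

section \<open>Quotients, direct sums and free modules\<close>

text \<open>Quotients, limits, tensor products and \<open>Ext1\<close> all define operations on
  classes as unions over representatives. Such a union is a single class as soon as the result does
  not depend on the representative.\<close>

lemma UN_eq_const: "a \<in> A \<Longrightarrow> (\<And>x. x \<in> A \<Longrightarrow> f x = c) \<Longrightarrow> (\<Union>x\<in>A. f x) = c"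
  by auto

definition dsum_single :: "'k set \<Rightarrow> ('k \<Rightarrow> ('r, 'm) module) \<Rightarrow> 'k \<Rightarrow> 'm \<Rightarrow> 'k \<Rightarrow> 'm" where
  "dsum_single K F k x = (\<lambda>j\<in>K. if j = k then x else \<zero>\<^bsub>F j\<^esub>)"

definition free_gen :: "'r ring \<Rightarrow> 'k set \<Rightarrow> 'k \<Rightarrow> 'k \<Rightarrow> 'r" where
  "free_gen R K k = dsum_single K (\<lambda>_. regular_module R) k \<one>\<^bsub>R\<^esub>"

text \<open>Projectivity with the basis on an arbitrary type: \<open>projective_mod\<close> draws
  bases from the type of the module itself, whereas finite presentations have the index set
  \<open>{..<m}\<close>.\<close>

definition retract_of_free :: "'r ring \<Rightarrow> ('r, 'p) module \<Rightarrow> 'k set \<Rightarrow> bool" where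
  "retract_of_free R P K \<longleftrightarrow> left_module R P \<and>
     (\<exists>s p. s \<in> mod_hom R P (free_module R K) \<and> p \<in> mod_hom R (free_module R K) P \<and>
        (\<forall>x\<in>carrier P. p (s x) = x))"

context base_ring
begin

section \<open>Submodules and quotients\<close>

definition submod :: "('r, 'm) module \<Rightarrow> 'm set \<Rightarrow> bool" where
  "submod M N \<longleftrightarrow> N \<subseteq> carrier M \<and> \<zero>\<^bsub>M\<^esub> \<in> N \<and> (\<forall>x\<in>N. \<forall>y\<in>N. x \<oplus>\<^bsub>M\<^esub> y \<in> N) \<and>
     (\<forall>r\<in>carrier R. \<forall>x\<in>N. r \<odot>\<^bsub>M\<^esub> x \<in> N)"

lemma submod_module: "left_module R M \<Longrightarrow> submod M N \<Longrightarrow> left_module R (M\<lparr>carrier := N\<rparr>)"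
  by (intro left_module_submodule) (auto simp: submod_def)

lemma submod_neg:
  assumes M: "left_module R M" and N: "submod M N" and x: "x \<in> N"
  shows "\<ominus>\<^bsub>M\<^esub> x \<in> N"
proof -
  \<comment> \<open>Negation is not a field of the record, so it is carried from the submodule to
    \<open>M\<close> along the inclusion.\<close>
  have i: "(\<lambda>x. x) \<in> mod_hom R (M\<lparr>carrier := N\<rparr>) M"
    by (rule mod_homI) (use N in \<open>auto simp: submod_def\<close>)
  note Nm = submod_module[OF M N]
  have "\<ominus>\<^bsub>M\<lparr>carrier := N\<rparr>\<^esub> x \<in> N" using module_neg_closed[OF Nm] x by simp
  then show ?thesis using mod_hom_neg[OF i Nm M] x by simp
qed

lemma submod_kernel:
  "left_module R A \<Longrightarrow> left_module R B \<Longrightarrow> f \<in> mod_hom R A B \<Longrightarrow> submod A {x \<in> carrier A. f x = \<zero>\<^bsub>B\<^esub>}"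
  by (auto simp: submod_def mod_hom_basic)

lemma submod_image:
  assumes A: "left_module R A" and B: "left_module R B" and f: "f \<in> mod_hom R A B"
  shows "submod B (f ` carrier A)"
  unfolding submod_def
proof (intro conjI ballI)
  show "f ` carrier A \<subseteq> carrier B" using f by (auto simp: mod_hom_closed)
  show "\<zero>\<^bsub>B\<^esub> \<in> f ` carrier A" using A B mod_hom_zero[OF f A B] by (metis image_eqI module_zero_closed)
  fix x assume x: "x \<in> f ` carrier A"
  show "x \<oplus>\<^bsub>B\<^esub> y \<in> f ` carrier A" if y: "y \<in> f ` carrier A" for y
    using x y A by (auto simp flip: mod_hom_add[OF f])
  show "r \<odot>\<^bsub>B\<^esub> x \<in> f ` carrier A" if "r \<in> carrier R" for r
    using x that A by (auto simp flip: mod_hom_smult[OF f])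
qed

lemma coset_eq_iff:
  assumes M: "left_module R M" and N: "submod M N" and xy: "x \<in> carrier M" "y \<in> carrier M"
  shows "N +>\<^bsub>M\<^esub> x = N +>\<^bsub>M\<^esub> y \<longleftrightarrow> x \<ominus>\<^bsub>M\<^esub> y \<in> N"
proof
  have Nc: "n \<in> carrier M" if "n \<in> N" for n using that N by (auto simp: submod_def)
  assume "N +>\<^bsub>M\<^esub> x = N +>\<^bsub>M\<^esub> y"
  moreover have "x \<in> N +>\<^bsub>M\<^esub> x" using N M xy by (force simp: a_r_coset_def' submod_def)
  ultimately obtain n where "n \<in> N" "x = n \<oplus>\<^bsub>M\<^esub> y" by (auto simp: a_r_coset_def')
  then show "x \<ominus>\<^bsub>M\<^esub> y \<in> N" using M xy Nc by simp
next
  have Nc: "n \<in> carrier M" if "n \<in> N" for n using that N by (auto simp: submod_def)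
  have *: "N +>\<^bsub>M\<^esub> x \<subseteq> N +>\<^bsub>M\<^esub> y" if d: "x \<ominus>\<^bsub>M\<^esub> y \<in> N" "x \<in> carrier M" "y \<in> carrier M" for x y
  proof
    fix z assume "z \<in> N +>\<^bsub>M\<^esub> x"
    then obtain n where n: "n \<in> N" "z = n \<oplus>\<^bsub>M\<^esub> x" by (auto simp: a_r_coset_def')
    then have "z = (n \<oplus>\<^bsub>M\<^esub> (x \<ominus>\<^bsub>M\<^esub> y)) \<oplus>\<^bsub>M\<^esub> y"
      using M d Nc by (simp add: module_add_assoc)
    moreover have "n \<oplus>\<^bsub>M\<^esub> (x \<ominus>\<^bsub>M\<^esub> y) \<in> N" using n d N by (auto simp: submod_def)
    ultimately show "z \<in> N +>\<^bsub>M\<^esub> y" by (auto simp: a_r_coset_def')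
  qed
  assume d: "x \<ominus>\<^bsub>M\<^esub> y \<in> N"
  have "y \<ominus>\<^bsub>M\<^esub> x = \<ominus>\<^bsub>M\<^esub> (x \<ominus>\<^bsub>M\<^esub> y)"
    using M xy by (simp add: module_diff_eq module_neg_add module_add_comm)
  then have "y \<ominus>\<^bsub>M\<^esub> x \<in> N" using submod_neg[OF M N d] by simp
  then show "N +>\<^bsub>M\<^esub> x = N +>\<^bsub>M\<^esub> y" using * d xy by blast
qed

lemma coset_self: "left_module R M \<Longrightarrow> submod M N \<Longrightarrow> x \<in> carrier M \<Longrightarrow> x \<in> N +>\<^bsub>M\<^esub> x"
  by (force simp: a_r_coset_def' submod_def)

lemma coset_memD:
  "left_module R M \<Longrightarrow> submod M N \<Longrightarrow> x \<in> carrier M \<Longrightarrow> y \<in> N +>\<^bsub>M\<^esub> x \<Longrightarrow>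
    y \<in> carrier M \<and> y \<ominus>\<^bsub>M\<^esub> x \<in> N"
  by (auto simp: a_r_coset_def' submod_def subset_iff)

lemma coset_zero:
  assumes M: "left_module R M" and N: "submod M N" shows "N +>\<^bsub>M\<^esub> \<zero>\<^bsub>M\<^esub> = N"
proof -
  have "n \<oplus>\<^bsub>M\<^esub> \<zero>\<^bsub>M\<^esub> = n" if "n \<in> N" for n using that M N by (auto simp: submod_def)
  then show ?thesis by (auto simp: a_r_coset_def')
qed

lemma quot_hom:
  assumes M: "left_module R M" and N: "submod M N"
  shows "(\<lambda>x. N +>\<^bsub>M\<^esub> x) \<in> mod_hom R M (mod_quot M N)"
proof (rule mod_homI)
  show "N +>\<^bsub>M\<^esub> x \<in> carrier (mod_quot M N)" if "x \<in> carrier M" for x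
    using that by (auto simp: mod_quot_def A_RCOSETS_def')
  fix x assume x: "x \<in> carrier M"
  show "N +>\<^bsub>M\<^esub> (x \<oplus>\<^bsub>M\<^esub> y) = (N +>\<^bsub>M\<^esub> x) \<oplus>\<^bsub>mod_quot M N\<^esub> (N +>\<^bsub>M\<^esub> y)" if y: "y \<in> carrier M" for y
  proof -
    interpret G: abelian_group M using M by simp
    interpret H: abelian_subgroup N M
    proof (rule abelian_subgroupI3[OF additive_subgroup.intro G.abelian_group_axioms], rule G.add.subgroupI)
      show "\<ominus>\<^bsub>M\<^esub> a \<in> N" if "a \<in> N" for a using submod_neg[OF M N that] .
    qed (use N in \<open>auto simp: submod_def\<close>)
    show ?thesis using H.a_rcos_sum[OF x y] by (simp add: mod_quot_def)
  qed
  fix r assume r: "r \<in> carrier R"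
  \<comment> \<open>The scalar multiple of a coset is defined as a union over its elements; all of
    them give the same coset because \<open>N\<close> is closed under scalars.\<close>
  have *: "N +>\<^bsub>M\<^esub> (r \<odot>\<^bsub>M\<^esub> x') = N +>\<^bsub>M\<^esub> (r \<odot>\<^bsub>M\<^esub> x)" if "x' \<in> N +>\<^bsub>M\<^esub> x" for x'
  proof -
    have x': "x' \<in> carrier M" "x' \<ominus>\<^bsub>M\<^esub> x \<in> N" using coset_memD[OF M N x that] by auto
    then have "r \<odot>\<^bsub>M\<^esub> x' \<ominus>\<^bsub>M\<^esub> r \<odot>\<^bsub>M\<^esub> x = r \<odot>\<^bsub>M\<^esub> (x' \<ominus>\<^bsub>M\<^esub> x)"
      using M x r by (simp add: module_diff_eq module_smult_r_distr module_smult_neg)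
    then show ?thesis using x' x r M N by (subst coset_eq_iff) (auto simp: submod_def)
  qed
  show "N +>\<^bsub>M\<^esub> (r \<odot>\<^bsub>M\<^esub> x) = r \<odot>\<^bsub>mod_quot M N\<^esub> (N +>\<^bsub>M\<^esub> x)"
    using UN_eq_const[OF coset_self[OF M N x] *] by (simp add: mod_quot_def)
qed

lemma quot_zero: "\<zero>\<^bsub>mod_quot M N\<^esub> = N" by (simp add: mod_quot_def)

lemma quot_surj: "(\<lambda>x. N +>\<^bsub>M\<^esub> x) ` carrier M = carrier (mod_quot M N)"
  by (auto simp: mod_quot_def A_RCOSETS_def')

lemma left_module_quot:
  assumes M: "left_module R M" and N: "submod M N"
  shows "left_module R (mod_quot M N)"
  by (rule left_module_image[OF M quot_hom[OF M N] _ quot_surj]) (simp add: coset_zero[OF M N] quot_zero)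

section \<open>Direct sums and maps out of them\<close>

lemma dsum_zero: "\<zero>\<^bsub>mod_dsum K F\<^esub> = (\<lambda>k\<in>K. \<zero>\<^bsub>F k\<^esub>)" by (simp add: mod_dsum_def)
lemma dsum_add: "g \<oplus>\<^bsub>mod_dsum K F\<^esub> h = (\<lambda>k\<in>K. g k \<oplus>\<^bsub>F k\<^esub> h k)" by (simp add: mod_dsum_def)
lemma dsum_smult: "r \<odot>\<^bsub>mod_dsum K F\<^esub> h = (\<lambda>k\<in>K. r \<odot>\<^bsub>F k\<^esub> h k)" by (simp add: mod_dsum_def)

lemma dsum_carrier_iff: "h \<in> carrier (mod_dsum K F) \<longleftrightarrow>
    h \<in> extensional K \<and> (\<forall>k\<in>K. h k \<in> carrier (F k)) \<and> finite {k \<in> K. h k \<noteq> \<zero>\<^bsub>F k\<^esub>}"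
  by (auto simp: mod_dsum_def PiE_def)

lemma dsum_eqI: "g \<in> carrier (mod_dsum K F) \<Longrightarrow> h \<in> carrier (mod_dsum K F) \<Longrightarrow>
    (\<And>k. k \<in> K \<Longrightarrow> g k = h k) \<Longrightarrow> g = h"
  by (auto simp: dsum_carrier_iff intro: extensionalityI)

lemma left_module_dsum:
  assumes F: "\<And>k. k \<in> K \<Longrightarrow> left_module R (F k)"
  shows "left_module R (mod_dsum K F)"
proof -
  have add: "g \<oplus>\<^bsub>mod_dsum K F\<^esub> h \<in> carrier (mod_dsum K F)"
    if "g \<in> carrier (mod_dsum K F)" "h \<in> carrier (mod_dsum K F)" for g h
  proof -
    have "{k \<in> K. g k \<oplus>\<^bsub>F k\<^esub> h k \<noteq> \<zero>\<^bsub>F k\<^esub>} \<subseteq> {k \<in> K. g k \<noteq> \<zero>\<^bsub>F k\<^esub>} \<union> {k \<in> K. h k \<noteq> \<zero>\<^bsub>F k\<^esub>}"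
      using F by auto
    then have "finite {k \<in> K. g k \<oplus>\<^bsub>F k\<^esub> h k \<noteq> \<zero>\<^bsub>F k\<^esub>}"
      by (rule finite_subset) (use that in \<open>auto simp: dsum_carrier_iff\<close>)
    then show ?thesis using that F by (auto simp: dsum_carrier_iff dsum_add cong: conj_cong)
  qed
  have sm: "r \<odot>\<^bsub>mod_dsum K F\<^esub> h \<in> carrier (mod_dsum K F)"
    if "r \<in> carrier R" "h \<in> carrier (mod_dsum K F)" for r h
  proof -
    have "{k \<in> K. r \<odot>\<^bsub>F k\<^esub> h k \<noteq> \<zero>\<^bsub>F k\<^esub>} \<subseteq> {k \<in> K. h k \<noteq> \<zero>\<^bsub>F k\<^esub>}"
      using F that by auto
    then have "finite {k \<in> K. r \<odot>\<^bsub>F k\<^esub> h k \<noteq> \<zero>\<^bsub>F k\<^esub>}"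
      by (rule finite_subset) (use that in \<open>auto simp: dsum_carrier_iff\<close>)
    then show ?thesis using that F by (auto simp: dsum_carrier_iff dsum_smult cong: conj_cong)
  qed
  have neg: "(\<lambda>k\<in>K. \<ominus>\<^bsub>F k\<^esub> h k) \<in> carrier (mod_dsum K F)" if "h \<in> carrier (mod_dsum K F)" for h
  proof -
    have "{k \<in> K. \<ominus>\<^bsub>F k\<^esub> h k \<noteq> \<zero>\<^bsub>F k\<^esub>} \<subseteq> {k \<in> K. h k \<noteq> \<zero>\<^bsub>F k\<^esub>}" using F by auto
    then have "finite {k \<in> K. \<ominus>\<^bsub>F k\<^esub> h k \<noteq> \<zero>\<^bsub>F k\<^esub>}"
      by (rule finite_subset) (use that in \<open>auto simp: dsum_carrier_iff\<close>)
    then show ?thesis using that F by (auto simp: dsum_carrier_iff cong: conj_cong)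
  qed
  have ext: "h k = undefined" if "h \<in> carrier (mod_dsum K F)" "k \<notin> K" for h k
    using that by (auto simp: dsum_carrier_iff extensional_def)
  have mem: "h k \<in> carrier (F k)" if "h \<in> carrier (mod_dsum K F)" "k \<in> K" for h k
    using that by (auto simp: dsum_carrier_iff)
  show ?thesis
  proof (rule left_moduleI)
    show "abelian_group (mod_dsum K F)"
    proof (rule abelian_groupI)
      show "\<zero>\<^bsub>mod_dsum K F\<^esub> \<in> carrier (mod_dsum K F)"
        using F by (auto simp: dsum_carrier_iff dsum_zero cong: conj_cong)
      fix x assume x: "x \<in> carrier (mod_dsum K F)"
      then show "\<exists>y\<in>carrier (mod_dsum K F). y \<oplus>\<^bsub>mod_dsum K F\<^esub> x = \<zero>\<^bsub>mod_dsum K F\<^esub>"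
        by (intro bexI[OF _ neg[OF x]]) (auto simp: dsum_add dsum_zero fun_eq_iff F mem)
      show "\<zero>\<^bsub>mod_dsum K F\<^esub> \<oplus>\<^bsub>mod_dsum K F\<^esub> x = x"
        by (auto simp: dsum_add dsum_zero fun_eq_iff F mem[OF x] ext[OF x])
      fix y assume y: "y \<in> carrier (mod_dsum K F)"
      show "x \<oplus>\<^bsub>mod_dsum K F\<^esub> y \<in> carrier (mod_dsum K F)" by (rule add[OF x y])
      show "x \<oplus>\<^bsub>mod_dsum K F\<^esub> y = y \<oplus>\<^bsub>mod_dsum K F\<^esub> x"
        by (auto simp: dsum_add fun_eq_iff F mem[OF x] mem[OF y] intro!: module_add_comm)
      fix z assume z: "z \<in> carrier (mod_dsum K F)"
      show "x \<oplus>\<^bsub>mod_dsum K F\<^esub> y \<oplus>\<^bsub>mod_dsum K F\<^esub> z = x \<oplus>\<^bsub>mod_dsum K F\<^esub> (y \<oplus>\<^bsub>mod_dsum K F\<^esub> z)"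
        by (auto simp: dsum_add fun_eq_iff F mem[OF x] mem[OF y] mem[OF z] intro!: module_add_assoc)
    qed
  qed (rule sm, assumption+, auto simp: dsum_add dsum_smult fun_eq_iff F mem ext
        intro!: module_smult_r_distr module_smult_l_distr module_smult_assoc)
qed

lemma dsum_coord: "k \<in> K \<Longrightarrow> (\<lambda>h. h k) \<in> mod_hom R (mod_dsum K F) (F k)"
  by (rule mod_homI) (auto simp: dsum_add dsum_smult dsum_carrier_iff)

lemma dsum_single_closed:
  assumes "\<And>k. k \<in> K \<Longrightarrow> left_module R (F k)" "k \<in> K" "x \<in> carrier (F k)"
  shows "dsum_single K F k x \<in> carrier (mod_dsum K F)"
proof -
  have "{j \<in> K. dsum_single K F k x j \<noteq> \<zero>\<^bsub>F j\<^esub>} \<subseteq> {k}" by (auto simp: dsum_single_def)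
  then have "finite {j \<in> K. dsum_single K F k x j \<noteq> \<zero>\<^bsub>F j\<^esub>}" by (rule finite_subset) auto
  then show ?thesis using assms by (auto simp: dsum_carrier_iff) (auto simp: dsum_single_def)
qed

lemma dsum_single_hom:
  assumes "\<And>k. k \<in> K \<Longrightarrow> left_module R (F k)" "k \<in> K"
  shows "dsum_single K F k \<in> mod_hom R (F k) (mod_dsum K F)"
  by (rule mod_homI)
    (use assms in \<open>auto simp: dsum_single_closed, auto simp: dsum_single_def dsum_add dsum_smult fun_eq_iff\<close>)

text \<open>Induction on the finite support: one coordinate is reset to zero at a time and added
  back as a one-coordinate element.\<close>

lemma dsum_induct:
  assumes F: "\<And>k. k \<in> K \<Longrightarrow> left_module R (F k)" and h: "h \<in> carrier (mod_dsum K F)"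
    and zero: "P \<zero>\<^bsub>mod_dsum K F\<^esub>"
    and step: "\<And>g k x. g \<in> carrier (mod_dsum K F) \<Longrightarrow> k \<in> K \<Longrightarrow> x \<in> carrier (F k) \<Longrightarrow> P g \<Longrightarrow>
      P (g \<oplus>\<^bsub>mod_dsum K F\<^esub> dsum_single K F k x)"
  shows "P h"
proof -
  have "\<And>h. h \<in> carrier (mod_dsum K F) \<Longrightarrow> {k \<in> K. h k \<noteq> \<zero>\<^bsub>F k\<^esub>} = A \<Longrightarrow> P h" if "finite A" for A
    using that
  proof (induction A rule: finite_induct)
    case empty
    then have "h = \<zero>\<^bsub>mod_dsum K F\<^esub>"
      by (auto simp: fun_eq_iff dsum_carrier_iff extensional_def dsum_zero)
    then show ?case using zero by simp
  next
    case (insert a A)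
    define g where "g = (\<lambda>k\<in>K. if k = a then \<zero>\<^bsub>F k\<^esub> else h k)"
    have a: "a \<in> K" using insert.prems by blast
    have ga: "{k \<in> K. g k \<noteq> \<zero>\<^bsub>F k\<^esub>} = A"
    proof -
      have "k \<in> K \<and> h k \<noteq> \<zero>\<^bsub>F k\<^esub> \<longleftrightarrow> k = a \<or> k \<in> A" for k
        using insert.prems(2) by (metis (mono_tags, lifting) insert_iff mem_Collect_eq)
      then show ?thesis using insert.hyps by (auto simp: g_def)
    qed
    have gc: "g \<in> carrier (mod_dsum K F)"
      unfolding dsum_carrier_iff ga using insert.hyps insert.prems(1) F
      by (auto simp: g_def dsum_carrier_iff)
    have ha: "h a \<in> carrier (F a)" using insert.prems(1) a by (auto simp: dsum_carrier_iff)
    have "h = g \<oplus>\<^bsub>mod_dsum K F\<^esub> dsum_single K F a (h a)"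
      using insert.prems(1) F
      by (auto simp: g_def dsum_add dsum_single_def fun_eq_iff dsum_carrier_iff extensional_def)
    then show ?case using step[OF gc a ha insert.IH[OF gc ga]] by simp
  qed
  then show ?thesis using h by (auto simp: dsum_carrier_iff)
qed

lemma dsum_hom_eqI:
  assumes F: "\<And>k. k \<in> K \<Longrightarrow> left_module R (F k)" and W: "left_module R W"
    and f: "f \<in> mod_hom R (mod_dsum K F) W" and g: "g \<in> mod_hom R (mod_dsum K F) W"
    and eq: "\<And>k x. k \<in> K \<Longrightarrow> x \<in> carrier (F k) \<Longrightarrow> f (dsum_single K F k x) = g (dsum_single K F k x)"
    and h: "h \<in> carrier (mod_dsum K F)"
  shows "f h = g h"
proof -
  note D = left_module_dsum[of K F, OF F]
  show ?thesis
    by (rule dsum_induct[OF F h])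
      (use D in \<open>simp_all add: mod_hom_zero[OF f D W] mod_hom_zero[OF g D W]
        mod_hom_add[OF f] mod_hom_add[OF g] dsum_single_closed F eq\<close>)
qed

text \<open>The map out of a direct sum induced by the family \<open>g\<close>. Summing over the
  support alone keeps the sum finite. \<open>summation_map\<close> is the instance in which every
  \<open>g k\<close> is the identity.\<close>

definition dsum_sum :: "'k set \<Rightarrow> ('k \<Rightarrow> ('r, 'm) module) \<Rightarrow> ('r, 'w) module \<Rightarrow> ('k \<Rightarrow> 'm \<Rightarrow> 'w) \<Rightarrow> ('k \<Rightarrow> 'm) \<Rightarrow> 'w" where
  "dsum_sum K F W g h = (\<Oplus>\<^bsub>W\<^esub>k\<in>{k \<in> K. h k \<noteq> \<zero>\<^bsub>F k\<^esub>}. g k (h k))"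

lemma module_smult_finsum:
  assumes W: "left_module R W" and r: "r \<in> carrier R" and A: "finite A" "f \<in> A \<rightarrow> carrier W"
  shows "r \<odot>\<^bsub>W\<^esub> (\<Oplus>\<^bsub>W\<^esub>k\<in>A. f k) = (\<Oplus>\<^bsub>W\<^esub>k\<in>A. r \<odot>\<^bsub>W\<^esub> f k)"
  using A
proof (induction A rule: finite_induct)
  case empty
  interpret abelian_group W using W by simp
  show ?case using W r by simp
next
  case (insert a A)
  interpret WG: abelian_group W using W by simp
  have "(\<Oplus>\<^bsub>W\<^esub>k\<in>insert a A. r \<odot>\<^bsub>W\<^esub> f k) = r \<odot>\<^bsub>W\<^esub> f a \<oplus>\<^bsub>W\<^esub> (\<Oplus>\<^bsub>W\<^esub>k\<in>A. r \<odot>\<^bsub>W\<^esub> f k)"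
    using insert W r by (intro WG.finsum_insert) (auto simp: Pi_iff)
  then show ?case
    using insert W r by (simp add: WG.finsum_insert module_smult_r_distr WG.finsum_closed)
qed

lemma dsum_sum_superset:
  assumes F: "\<And>k. k \<in> K \<Longrightarrow> left_module R (F k)" and W: "left_module R W"
    and g: "\<And>k. k \<in> K \<Longrightarrow> g k \<in> mod_hom R (F k) W" and h: "h \<in> carrier (mod_dsum K F)"
    and A: "finite A" "A \<subseteq> K" "{k \<in> K. h k \<noteq> \<zero>\<^bsub>F k\<^esub>} \<subseteq> A"
  shows "dsum_sum K F W g h = (\<Oplus>\<^bsub>W\<^esub>k\<in>A. g k (h k))"
proof -
  interpret WG: abelian_group W using W by simp
  show ?thesis unfolding dsum_sum_def
  proof (rule WG.add.finprod_mono_neutral_cong_left)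
    show "(\<lambda>k. g k (h k)) \<in> A \<rightarrow> carrier W"
      using A h g by (auto simp: dsum_carrier_iff intro!: mod_hom_closed[OF g])
    show "g i (h i) = \<zero>\<^bsub>W\<^esub>" if "i \<in> A - {k \<in> K. h k \<noteq> \<zero>\<^bsub>F k\<^esub>}" for i
      using that A mod_hom_zero[OF g F W] by auto
  qed (use A in auto)
qed

lemma dsum_sum_hom:
  assumes F: "\<And>k. k \<in> K \<Longrightarrow> left_module R (F k)" and W: "left_module R W"
    and g: "\<And>k. k \<in> K \<Longrightarrow> g k \<in> mod_hom R (F k) W"
  shows "dsum_sum K F W g \<in> mod_hom R (mod_dsum K F) W"
proof (rule mod_homI)
  interpret WG: abelian_group W using W by simp
  let ?s = "\<lambda>h. {k \<in> K. h k \<noteq> \<zero>\<^bsub>F k\<^esub>}"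
  have D: "left_module R (mod_dsum K F)" by (rule left_module_dsum[OF F])
  have c: "(\<lambda>k. g k (h k)) \<in> A \<rightarrow> carrier W" if "h \<in> carrier (mod_dsum K F)" "A \<subseteq> K" for A h
    using that by (auto simp: dsum_carrier_iff intro!: mod_hom_closed[OF g])
  have fin: "finite (?s h)" if "h \<in> carrier (mod_dsum K F)" for h
    using that by (simp add: dsum_carrier_iff)
  fix x assume x: "x \<in> carrier (mod_dsum K F)"
  show "dsum_sum K F W g x \<in> carrier W"
    unfolding dsum_sum_def by (rule WG.finsum_closed[OF c[OF x]]) auto
  show "dsum_sum K F W g (x \<oplus>\<^bsub>mod_dsum K F\<^esub> y) = dsum_sum K F W g x \<oplus>\<^bsub>W\<^esub> dsum_sum K F W g y"
    if y: "y \<in> carrier (mod_dsum K F)" for y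
  proof -
    define A where "A = ?s x \<union> ?s y"
    have A: "finite A" "A \<subseteq> K" using fin[OF x] fin[OF y] by (auto simp: A_def)
    have xy: "x \<oplus>\<^bsub>mod_dsum K F\<^esub> y \<in> carrier (mod_dsum K F)" using D x y by simp
    have "?s (x \<oplus>\<^bsub>mod_dsum K F\<^esub> y) \<subseteq> A" using F by (auto simp: A_def dsum_add)
    then have "dsum_sum K F W g (x \<oplus>\<^bsub>mod_dsum K F\<^esub> y) = (\<Oplus>\<^bsub>W\<^esub>k\<in>A. g k ((x \<oplus>\<^bsub>mod_dsum K F\<^esub> y) k))"
      by (intro dsum_sum_superset F W g xy A)
    also have "\<dots> = (\<Oplus>\<^bsub>W\<^esub>k\<in>A. g k (x k) \<oplus>\<^bsub>W\<^esub> g k (y k))"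
      using A x y c by (intro WG.finsum_cong')
        (auto simp: dsum_add dsum_carrier_iff subset_iff mod_hom_add[OF g] mod_hom_closed[OF g])
    also have "\<dots> = (\<Oplus>\<^bsub>W\<^esub>k\<in>A. g k (x k)) \<oplus>\<^bsub>W\<^esub> (\<Oplus>\<^bsub>W\<^esub>k\<in>A. g k (y k))"
      by (intro WG.finsum_addf c x y A)
    also have "(\<Oplus>\<^bsub>W\<^esub>k\<in>A. g k (x k)) = dsum_sum K F W g x"
      by (rule dsum_sum_superset[symmetric]) (use F W g x A in \<open>auto simp: A_def\<close>)
    also have "(\<Oplus>\<^bsub>W\<^esub>k\<in>A. g k (y k)) = dsum_sum K F W g y"
      by (rule dsum_sum_superset[symmetric]) (use F W g y A in \<open>auto simp: A_def\<close>)
    finally show ?thesis .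
  qed
  fix r assume r: "r \<in> carrier R"
  have rx: "r \<odot>\<^bsub>mod_dsum K F\<^esub> x \<in> carrier (mod_dsum K F)" using D x r by simp
  have "?s (r \<odot>\<^bsub>mod_dsum K F\<^esub> x) \<subseteq> ?s x" using F r by (auto simp: dsum_smult)
  then have "dsum_sum K F W g (r \<odot>\<^bsub>mod_dsum K F\<^esub> x) = (\<Oplus>\<^bsub>W\<^esub>k\<in>?s x. g k ((r \<odot>\<^bsub>mod_dsum K F\<^esub> x) k))"
    by (intro dsum_sum_superset F W g rx fin x) auto
  also have "\<dots> = (\<Oplus>\<^bsub>W\<^esub>k\<in>?s x. r \<odot>\<^bsub>W\<^esub> g k (x k))"
    using x c W r by (intro WG.finsum_cong')
      (auto simp: dsum_smult dsum_carrier_iff subset_iff mod_hom_smult[OF g] mod_hom_closed[OF g])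
  also have "\<dots> = r \<odot>\<^bsub>W\<^esub> dsum_sum K F W g x"
    unfolding dsum_sum_def by (intro module_smult_finsum[symmetric] W r fin c x) auto
  finally show "dsum_sum K F W g (r \<odot>\<^bsub>mod_dsum K F\<^esub> x) = r \<odot>\<^bsub>W\<^esub> dsum_sum K F W g x" .
qed

lemma dsum_sum_single:
  assumes F: "\<And>k. k \<in> K \<Longrightarrow> left_module R (F k)" and W: "left_module R W"
    and g: "\<And>k. k \<in> K \<Longrightarrow> g k \<in> mod_hom R (F k) W" and k: "k \<in> K" "x \<in> carrier (F k)"
  shows "dsum_sum K F W g (dsum_single K F k x) = g k x"
proof -
  interpret WG: abelian_group W using W by simp
  have "dsum_sum K F W g (dsum_single K F k x) = (\<Oplus>\<^bsub>W\<^esub>j\<in>{k}. g j (dsum_single K F k x j))"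
    by (rule dsum_sum_superset)
      (use F W g k in \<open>auto simp: dsum_single_closed, auto simp: dsum_single_def split: if_splits\<close>)
  also have "\<dots> = g k x"
    using k mod_hom_closed[OF g[OF k(1)] k(2)] by (simp add: dsum_single_def)
  finally show ?thesis .
qed

section \<open>Free modules and lifting through surjections\<close>

lemma left_module_free [simp]: "left_module R (free_module R K)"
  unfolding free_module_def by (rule left_module_dsum) simp

lemma free_gen_closed: "k \<in> K \<Longrightarrow> free_gen R K k \<in> carrier (free_module R K)"
  unfolding free_gen_def free_module_def by (rule dsum_single_closed) auto

lemma dsum_single_regular:
  "r \<in> carrier R \<Longrightarrow> dsum_single K (\<lambda>_. regular_module R) k r = r \<odot>\<^bsub>free_module R K\<^esub> free_gen R K k"
  by (auto simp: free_gen_def free_module_def dsum_smult dsum_single_def fun_eq_iff)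

lemma free_extend:
  assumes W: "left_module R W" and w: "\<And>k. k \<in> K \<Longrightarrow> w k \<in> carrier W"
  obtains g where "g \<in> mod_hom R (free_module R K) W" "\<And>k. k \<in> K \<Longrightarrow> g (free_gen R K k) = w k"
proof -
  have h: "(\<lambda>r. r \<odot>\<^bsub>W\<^esub> w k) \<in> mod_hom R (regular_module R) W" if "k \<in> K" for k
    using mod_hom_smult_right[OF W w[OF that]] .
  show thesis
  proof (rule that)
    show "dsum_sum K (\<lambda>_. regular_module R) W (\<lambda>k r. r \<odot>\<^bsub>W\<^esub> w k) \<in> mod_hom R (free_module R K) W"
      unfolding free_module_def by (rule dsum_sum_hom) (use W h in auto)
    show "dsum_sum K (\<lambda>_. regular_module R) W (\<lambda>k r. r \<odot>\<^bsub>W\<^esub> w k) (free_gen R K k) = w k" if "k \<in> K" for k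
      unfolding free_gen_def
      using dsum_sum_single[where F = "\<lambda>_. regular_module R" and x = \<one>, OF left_module_regular W h that] that W w
      by simp
  qed
qed

lemma free_hom_eqI:
  assumes W: "left_module R W" and f: "f \<in> mod_hom R (free_module R K) W" and g: "g \<in> mod_hom R (free_module R K) W"
    and eq: "\<And>k. k \<in> K \<Longrightarrow> f (free_gen R K k) = g (free_gen R K k)"
    and h: "h \<in> carrier (free_module R K)"
  shows "f h = g h"
proof (rule dsum_hom_eqI[of K "\<lambda>_. regular_module R" W])
  show "f (dsum_single K (\<lambda>_. regular_module R) k x) = g (dsum_single K (\<lambda>_. regular_module R) k x)"
    if "k \<in> K" "x \<in> carrier (regular_module R)" for k x
    using that by (simp add: dsum_single_regular mod_hom_smult[OF f] mod_hom_smult[OF g] free_gen_closed eq)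
qed (use assms in \<open>auto simp: free_module_def\<close>)

lemma retract_of_free_free: "retract_of_free R (free_module R K) K"
  unfolding retract_of_free_def using mod_hom_id by auto

lemma projective_retract_of_free:
  assumes "projective_mod R (P :: ('r, 'p) module)"
  obtains K :: "'p set" where "retract_of_free R P K"
  using assms unfolding projective_mod_def retract_of_free_def by blast

text \<open>The images of the free generators are lifted one by one. Precomposing with the section
  \<open>s\<close> turns the resulting map on the free module into one on \<open>P\<close>.\<close>

lemma retract_of_free_lift:
  assumes P: "retract_of_free R P K" and B: "left_module R B" "left_module R C"
    and q: "q \<in> mod_hom R B C" "q ` carrier B = carrier C" and f: "f \<in> mod_hom R P C"
  obtains g where "g \<in> mod_hom R P B" "\<And>x. x \<in> carrier P \<Longrightarrow> q (g x) = f x"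
proof -
  obtain s p where sp: "s \<in> mod_hom R P (free_module R K)" "p \<in> mod_hom R (free_module R K) P"
    "\<And>x. x \<in> carrier P \<Longrightarrow> p (s x) = x" using P by (auto simp: retract_of_free_def)
  have "\<exists>b\<in>carrier B. q b = f (p (free_gen R K k))" if "k \<in> K" for k
  proof -
    have "f (p (free_gen R K k)) \<in> q ` carrier B"
      unfolding q(2) using that by (intro mod_hom_closed[OF f] mod_hom_closed[OF sp(2)] free_gen_closed)
    then show ?thesis by auto
  qed
  then obtain w where w: "\<And>k. k \<in> K \<Longrightarrow> w k \<in> carrier B" "\<And>k. k \<in> K \<Longrightarrow> q (w k) = f (p (free_gen R K k))"
    by metis
  obtain g where g: "g \<in> mod_hom R (free_module R K) B" "\<And>k. k \<in> K \<Longrightarrow> g (free_gen R K k) = w k"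
    by (rule free_extend[OF B(1), of K w]) (use w in auto)
  have "q (g y) = f (p y)" if "y \<in> carrier (free_module R K)" for y
    by (rule free_hom_eqI[OF B(2) mod_hom_compose[OF g(1) q(1)] mod_hom_compose[OF sp(2) f] _ that])
      (simp add: g(2) w(2))
  then have "q (g (s x)) = f x" if "x \<in> carrier P" for x
    using that sp mod_hom_closed[OF sp(1)] by simp
  with mod_hom_compose[OF sp(1) g(1)] show thesis by (rule that)
qed

end

section \<open>Short exact sequences\<close>

context base_ring
begin

lemma mod_hom_fst: "fst \<in> mod_hom R (mod_prod A B) A"
  by (rule mod_homI) auto

lemma mod_hom_snd: "snd \<in> mod_hom R (mod_prod A B) B"
  by (rule mod_homI) auto

text \<open>Additive inverses in a product are characterized abstractly and not given by a formula,
  so differences are read off through the two projections.\<close>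

lemma mod_prod_diff:
  assumes "left_module R A" "left_module R B"
    "x \<in> carrier A" "x' \<in> carrier A" "y \<in> carrier B" "y' \<in> carrier B"
  shows "(x, y) \<ominus>\<^bsub>mod_prod A B\<^esub> (x', y') = (x \<ominus>\<^bsub>A\<^esub> x', y \<ominus>\<^bsub>B\<^esub> y')"
proof (rule prod_eqI)
  have c: "(x, y) \<in> carrier (mod_prod A B)" "(x', y') \<in> carrier (mod_prod A B)" using assms by auto
  show "fst ((x, y) \<ominus>\<^bsub>mod_prod A B\<^esub> (x', y')) = fst (x \<ominus>\<^bsub>A\<^esub> x', y \<ominus>\<^bsub>B\<^esub> y')"
    using mod_hom_diff[OF mod_hom_fst left_module_prod _ c] assms by simp
  show "snd ((x, y) \<ominus>\<^bsub>mod_prod A B\<^esub> (x', y')) = snd (x \<ominus>\<^bsub>A\<^esub> x', y \<ominus>\<^bsub>B\<^esub> y')"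
    using mod_hom_diff[OF mod_hom_snd left_module_prod _ c] assms by simp
qed

lemma short_exactD:
  assumes "short_exact R Y S X"
  shows "left_module R Y" "left_module R (ses_mid S)" "left_module R X"
    "ses_in S \<in> mod_hom R Y (ses_mid S)" "ses_out S \<in> mod_hom R (ses_mid S) X"
    "inj_on (ses_in S) (carrier Y)" "ses_out S ` carrier (ses_mid S) = carrier X"
    "\<And>y. y \<in> carrier Y \<Longrightarrow> ses_in S y \<in> carrier (ses_mid S)"
    "\<And>m. m \<in> carrier (ses_mid S) \<Longrightarrow> ses_out S m \<in> carrier X"
    "\<And>y. y \<in> carrier Y \<Longrightarrow> ses_out S (ses_in S y) = \<zero>\<^bsub>X\<^esub>"
proof -
  show "\<And>y. y \<in> carrier Y \<Longrightarrow> ses_out S (ses_in S y) = \<zero>\<^bsub>X\<^esub>"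
    using assms unfolding short_exact_def by blast
qed (use assms in \<open>auto simp: short_exact_def mod_hom_def\<close>)

lemma short_exact_kernel:
  assumes "short_exact R Y S X" "m \<in> carrier (ses_mid S)" "ses_out S m = \<zero>\<^bsub>X\<^esub>"
  shows "m \<in> ses_in S ` carrier Y"
  using assms unfolding short_exact_def by blast

lemma short_exact_preimage:
  assumes "short_exact R Y S X" "x \<in> carrier X"
  shows "\<exists>m\<in>carrier (ses_mid S). ses_out S m = x"
proof -
  have "x \<in> ses_out S ` carrier (ses_mid S)" using assms short_exactD(7) by metis
  then show ?thesis by blast
qed

lemma short_exactI:
  assumes "left_module R Y" "left_module R (ses_mid S)" "left_module R X"
    "ses_in S \<in> mod_hom R Y (ses_mid S)" "ses_out S \<in> mod_hom R (ses_mid S) X"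
    "\<And>y. y \<in> carrier Y \<Longrightarrow> ses_in S y = \<zero>\<^bsub>ses_mid S\<^esub> \<Longrightarrow> y = \<zero>\<^bsub>Y\<^esub>"
    "\<And>x. x \<in> carrier X \<Longrightarrow> \<exists>m\<in>carrier (ses_mid S). ses_out S m = x"
    "\<And>y. y \<in> carrier Y \<Longrightarrow> ses_out S (ses_in S y) = \<zero>\<^bsub>X\<^esub>"
    "\<And>m. m \<in> carrier (ses_mid S) \<Longrightarrow> ses_out S m = \<zero>\<^bsub>X\<^esub> \<Longrightarrow> \<exists>y\<in>carrier Y. m = ses_in S y"
  shows "short_exact R Y S X"
  unfolding short_exact_def
proof (intro conjI)
  show "inj_on (ses_in S) (carrier Y)" using mod_hom_inj_iff[OF assms(4,1,2)] assms(6) by blast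
  show "ses_out S ` carrier (ses_mid S) = carrier X"
    using assms(7) mod_hom_closed[OF assms(5)] by force
  show "ses_in S ` carrier Y = {m \<in> carrier (ses_mid S). ses_out S m = \<zero>\<^bsub>X\<^esub>}"
    using assms(8,9) mod_hom_closed[OF assms(4)] by force
qed (use assms in auto)

lemma short_exact_zero_in:
  "short_exact R Y S X \<Longrightarrow> y \<in> carrier Y \<Longrightarrow> ses_in S y = \<zero>\<^bsub>ses_mid S\<^esub> \<Longrightarrow> y = \<zero>\<^bsub>Y\<^esub>"
  using mod_hom_inj_iff[of "ses_in S" Y "ses_mid S"] short_exactD[of Y S X] by blast

text \<open>The short five lemma with identities at both ends. For surjectivity, \<open>n\<close> is
  corrected by the image of some \<open>m\<close> with the same outgoing value, and the remainder
  comes from \<open>Y\<close>.\<close>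

lemma ses_map_iso:
  assumes S: "short_exact R Y S X" and T: "short_exact R Y T X"
    and G: "G \<in> mod_hom R (ses_mid S) (ses_mid T)"
    and i: "\<And>y. y \<in> carrier Y \<Longrightarrow> G (ses_in S y) = ses_in T y"
    and o: "\<And>m. m \<in> carrier (ses_mid S) \<Longrightarrow> ses_out T (G m) = ses_out S m"
  shows "G \<in> mod_iso R (ses_mid S) (ses_mid T)"
proof -
  note s = short_exactD[OF S] and t = short_exactD[OF T]
  have "inj_on G (carrier (ses_mid S))"
    unfolding mod_hom_inj_iff[OF G s(2) t(2)]
  proof (intro ballI impI)
    fix m assume m: "m \<in> carrier (ses_mid S)" "G m = \<zero>\<^bsub>ses_mid T\<^esub>"
    then have "ses_out S m = \<zero>\<^bsub>X\<^esub>" using o[OF m(1)] mod_hom_zero[OF t(5,2,3)] by simp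
    then obtain y where y: "y \<in> carrier Y" "m = ses_in S y" using short_exact_kernel[OF S m(1)] by blast
    then have "ses_in T y = \<zero>\<^bsub>ses_mid T\<^esub>" using m(2) i by simp
    then have "y = \<zero>\<^bsub>Y\<^esub>" using short_exact_zero_in[OF T] y by simp
    then show "m = \<zero>\<^bsub>ses_mid S\<^esub>" using y mod_hom_zero[OF s(4,1,2)] by simp
  qed
  moreover have "\<exists>m\<in>carrier (ses_mid S). G m = n" if n: "n \<in> carrier (ses_mid T)" for n
  proof -
    obtain m where m: "m \<in> carrier (ses_mid S)" "ses_out S m = ses_out T n"
      using short_exact_preimage[OF S] t(9)[OF n] by blast
    have Gm: "G m \<in> carrier (ses_mid T)" using mod_hom_closed[OF G m(1)] .
    have "ses_out T (n \<ominus>\<^bsub>ses_mid T\<^esub> G m) = \<zero>\<^bsub>X\<^esub>"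
      using m n Gm t o[OF m(1)] by (simp add: mod_hom_diff[OF t(5,2,3)])
    then obtain y where y: "y \<in> carrier Y" "n \<ominus>\<^bsub>ses_mid T\<^esub> G m = ses_in T y"
      using short_exact_kernel[OF T] n Gm t(2) by (metis imageE module_diff_closed)
    have "n = (n \<ominus>\<^bsub>ses_mid T\<^esub> G m) \<oplus>\<^bsub>ses_mid T\<^esub> G m" using n Gm t(2) by simp
    also have "\<dots> = G (ses_in S y \<oplus>\<^bsub>ses_mid S\<^esub> m)"
      using y s m by (simp add: mod_hom_add[OF G] i)
    finally show ?thesis using y s m by (metis module_add_closed)
  qed
  ultimately show ?thesis using G mod_hom_closed[OF G] by (auto simp: mod_iso_def bij_betw_def) 
qed

lemma ses_equivI:
  assumes "short_exact R Y S X" "short_exact R Y T X"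
    and "G \<in> mod_hom R (ses_mid S) (ses_mid T)"
    and "\<And>y. y \<in> carrier Y \<Longrightarrow> G (ses_in S y) = ses_in T y"
    and "\<And>m. m \<in> carrier (ses_mid S) \<Longrightarrow> ses_out T (G m) = ses_out S m"
  shows "ses_equiv R Y X S T"
  unfolding ses_equiv_def using ses_map_iso[OF assms] assms by blast

lemma ses_equivE:
  assumes "ses_equiv R Y X S T"
  obtains G where "G \<in> mod_hom R (ses_mid S) (ses_mid T)"
    "\<And>y. y \<in> carrier Y \<Longrightarrow> G (ses_in S y) = ses_in T y"
    "\<And>m. m \<in> carrier (ses_mid S) \<Longrightarrow> ses_out T (G m) = ses_out S m"
  using assms unfolding ses_equiv_def mod_iso_def by blast

lemma module_transport:
  fixes M :: "('r, 'a) module" and \<beta> :: "'a \<Rightarrow> 'b"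
  assumes M: "left_module R M" and inj: "inj_on \<beta> (carrier M)"
  obtains N :: "('r, 'b) module" where "left_module R N" "\<beta> \<in> mod_iso R M N"
proof -
  define \<gamma> where "\<gamma> = inv_into (carrier M) \<beta>"
  have g: "\<gamma> (\<beta> x) = x" if "x \<in> carrier M" for x using that inj by (simp add: \<gamma>_def)
  define N :: "('r, 'b) module" where "N = \<lparr>carrier = \<beta> ` carrier M, monoid.mult = undefined,
    one = undefined, ring.zero = \<beta> \<zero>\<^bsub>M\<^esub>, ring.add = (\<lambda>a b. \<beta> (\<gamma> a \<oplus>\<^bsub>M\<^esub> \<gamma> b)),
    smult = (\<lambda>r a. \<beta> (r \<odot>\<^bsub>M\<^esub> \<gamma> a))\<rparr>"
  have h: "\<beta> \<in> mod_hom R M N" by (rule mod_homI) (simp_all add: N_def g)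
  have "left_module R N" by (rule left_module_image[OF M h]) (simp_all add: N_def)
  moreover have "\<beta> \<in> mod_iso R M N" using h inj by (simp add: mod_iso_def bij_betw_def N_def)
  ultimately show thesis by (rule that)
qed

text \<open>\<open>Ext1\<close> collects only middle terms on \<open>'y \<times> 'x\<close>. Every
  middle term injects into that type: \<open>m\<close> is recorded by its image in \<open>X\<close>
  and by the element of \<open>Y\<close> that measures its distance from a chosen preimage of that
  image. The section \<open>\<sigma>\<close> is one of sets; linearity is restored by transporting
  the module structure along \<open>\<beta>\<close>.\<close>

lemma ses_transport:
  fixes S :: "('r, 'y, 'm, 'x) ses"
  assumes S: "short_exact R Y S X"
  obtains T :: "('r, 'y, 'y \<times> 'x, 'x) ses" where "short_exact R Y T X" "ses_equiv R Y X S T"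
proof -
  note s = short_exactD[OF S]
  let ?M = "ses_mid S"
  define \<sigma> where "\<sigma> x = (SOME m. m \<in> carrier ?M \<and> ses_out S m = x)" for x
  have \<sigma>: "\<sigma> x \<in> carrier ?M" "ses_out S (\<sigma> x) = x" if "x \<in> carrier X" for x
    using someI_ex[of "\<lambda>m. m \<in> carrier ?M \<and> ses_out S m = x"] short_exact_preimage[OF S that]
    by (auto simp: \<sigma>_def)
  define \<beta> where "\<beta> m = (inv_into (carrier Y) (ses_in S) (m \<ominus>\<^bsub>?M\<^esub> \<sigma> (ses_out S m)), ses_out S m)" for m
  have "inj_on \<beta> (carrier ?M)"
  proof (rule inj_onI)
    have k: "m \<ominus>\<^bsub>?M\<^esub> \<sigma> (ses_out S m) \<in> ses_in S ` carrier Y" if "m \<in> carrier ?M" for m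
      by (rule short_exact_kernel[OF S]) (use that s \<sigma> in \<open>simp_all add: mod_hom_diff[OF s(5,2,3)]\<close>)
    fix m n assume m: "m \<in> carrier ?M" and n: "n \<in> carrier ?M" and e: "\<beta> m = \<beta> n"
    then have o: "ses_out S m = ses_out S n" by (simp add: \<beta>_def)
    have "m \<ominus>\<^bsub>?M\<^esub> \<sigma> (ses_out S m) = n \<ominus>\<^bsub>?M\<^esub> \<sigma> (ses_out S n)"
      using e k[OF m] k[OF n] by (auto simp: \<beta>_def intro: inv_into_injective)
    then show "m = n" using o m n s \<sigma> by (metis module_diff_add_cancel)
  qed
  then obtain N where N: "left_module R N" "\<beta> \<in> mod_iso R ?M N"
    by (rule module_transport[OF s(2)])
  obtain \<gamma> where \<gamma>: "\<gamma> \<in> mod_iso R N ?M" "\<And>x. x \<in> carrier ?M \<Longrightarrow> \<gamma> (\<beta> x) = x"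
    "\<And>y. y \<in> carrier N \<Longrightarrow> \<beta> (\<gamma> y) = y" using mod_iso_inverse[OF N(2) s(2) N(1)] by blast
  have b: "\<beta> \<in> mod_hom R ?M N" "\<gamma> \<in> mod_hom R N ?M" using N \<gamma> by (auto simp: mod_iso_def)
  define T where "T = \<lparr>ses_in = (\<lambda>y. \<beta> (ses_in S y)), ses_mid = N, ses_out = (\<lambda>n. ses_out S (\<gamma> n))\<rparr>"
  have T: "short_exact R Y T X"
  proof (rule short_exactI)
    show "ses_in T \<in> mod_hom R Y (ses_mid T)" using mod_hom_compose[OF s(4) b(1)] by (simp add: T_def)
    show "ses_out T \<in> mod_hom R (ses_mid T) X" using mod_hom_compose[OF b(2) s(5)] by (simp add: T_def)
    show "y = \<zero>\<^bsub>Y\<^esub>" if "y \<in> carrier Y" "ses_in T y = \<zero>\<^bsub>ses_mid T\<^esub>" for y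
    proof -
      have "ses_in S y = \<gamma> (\<beta> (ses_in S y))" using \<gamma>(2) s that by simp
      also have "\<dots> = \<zero>\<^bsub>?M\<^esub>" using that mod_hom_zero[OF b(2) N(1) s(2)] by (simp add: T_def)
      finally show ?thesis using short_exact_zero_in[OF S] that by simp
    qed
    show "\<exists>m\<in>carrier (ses_mid T). ses_out T m = x" if x: "x \<in> carrier X" for x
      by (intro bexI[of _ "\<beta> (\<sigma> x)"]) (use \<sigma> x \<gamma> mod_hom_closed[OF b(1)] in \<open>auto simp: T_def\<close>)
    show "ses_out T (ses_in T y) = \<zero>\<^bsub>X\<^esub>" if "y \<in> carrier Y" for y
      using that s \<gamma>(2) by (simp add: T_def)
    show "\<exists>y\<in>carrier Y. m = ses_in T y" if m: "m \<in> carrier (ses_mid T)" "ses_out T m = \<zero>\<^bsub>X\<^esub>" for m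
    proof -
      have "\<gamma> m \<in> ses_in S ` carrier Y"
        using m mod_hom_closed[OF b(2)] by (intro short_exact_kernel[OF S]) (auto simp: T_def)
      then obtain y where "y \<in> carrier Y" "\<gamma> m = ses_in S y" by auto
      then show ?thesis using \<gamma>(3)[of m] m by (auto simp: T_def)
    qed
  qed (use s N in \<open>simp_all add: T_def\<close>)
  moreover have "ses_equiv R Y X S T"
    by (rule ses_equivI[OF S T, of \<beta>]) (use b \<gamma> in \<open>auto simp: T_def\<close>)
  ultimately show thesis by (rule that)
qed

section \<open>Split sequences, pull-backs and products\<close>

lemma short_exact_split:
  assumes "left_module R Y" "left_module R X"
  shows "short_exact R Y (ses_split Y X) X"
proof (rule short_exactI)
  show "ses_in (ses_split Y X) \<in> mod_hom R Y (ses_mid (ses_split Y X))"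
    using mod_hom_pair[OF mod_hom_id mod_hom_zero_map[OF assms(2)]] by (simp add: ses_split_def)
  show "ses_out (ses_split Y X) \<in> mod_hom R (ses_mid (ses_split Y X)) X"
    using mod_hom_snd by (simp add: ses_split_def)
  show "\<exists>m\<in>carrier (ses_mid (ses_split Y X)). ses_out (ses_split Y X) m = x" if "x \<in> carrier X" for x
    by (rule bexI[of _ "(\<zero>\<^bsub>Y\<^esub>, x)"]) (use that assms in \<open>auto simp: ses_split_def\<close>)
qed (use assms in \<open>auto simp: ses_split_def\<close>)

lemma pullback_simps:
  "ses_in (ses_pullback S X h) y = (ses_in S y, \<zero>\<^bsub>X\<^esub>)"
  "ses_out (ses_pullback S X h) = snd"
  "carrier (ses_mid (ses_pullback S X h)) =
    {(m, x). m \<in> carrier (ses_mid S) \<and> x \<in> carrier X \<and> ses_out S m = h x}"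
  "\<zero>\<^bsub>ses_mid (ses_pullback S X h)\<^esub> = (\<zero>\<^bsub>ses_mid S\<^esub>, \<zero>\<^bsub>X\<^esub>)"
  "(m, x) \<oplus>\<^bsub>ses_mid (ses_pullback S X h)\<^esub> (m', x') = (m \<oplus>\<^bsub>ses_mid S\<^esub> m', x \<oplus>\<^bsub>X\<^esub> x')"
  "r \<odot>\<^bsub>ses_mid (ses_pullback S X h)\<^esub> (m, x) = (r \<odot>\<^bsub>ses_mid S\<^esub> m, r \<odot>\<^bsub>X\<^esub> x)"
  by (auto simp: ses_pullback_def mod_prod_def)

lemma short_exact_pullback:
  assumes S: "short_exact R Y S Z" and X: "left_module R X" and h: "h \<in> mod_hom R X Z"
  shows "short_exact R Y (ses_pullback S X h) X"
proof (rule short_exactI)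
  note s = short_exactD[OF S]
  have hz: "h \<zero>\<^bsub>X\<^esub> = \<zero>\<^bsub>Z\<^esub>" by (rule mod_hom_zero[OF h X s(3)])
  show "left_module R (ses_mid (ses_pullback S X h))"
    unfolding ses_pullback_def ses.simps
    by (rule left_module_submodule[OF left_module_prod[OF s(2) X]])
      (use s X h in \<open>auto simp: mod_hom_zero[OF s(5,2,3)] mod_hom_zero[OF h X s(3)]
        mod_hom_add[OF s(5)] mod_hom_add[OF h] mod_hom_smult[OF s(5)] mod_hom_smult[OF h]\<close>)
  show "ses_in (ses_pullback S X h) \<in> mod_hom R Y (ses_mid (ses_pullback S X h))"
    by (rule mod_homI) (use s X hz in \<open>auto simp: pullback_simps mod_hom_add[OF s(4)] mod_hom_smult[OF s(4)]\<close>)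
  show "ses_out (ses_pullback S X h) \<in> mod_hom R (ses_mid (ses_pullback S X h)) X"
    by (rule mod_homI) (auto simp: pullback_simps)
  show "\<exists>m\<in>carrier (ses_mid (ses_pullback S X h)). ses_out (ses_pullback S X h) m = x" if "x \<in> carrier X" for x
    using short_exact_preimage[OF S mod_hom_closed[OF h that]] that by (auto simp: pullback_simps)
  show "\<exists>y\<in>carrier Y. m = ses_in (ses_pullback S X h) y"
    if "m \<in> carrier (ses_mid (ses_pullback S X h))" "ses_out (ses_pullback S X h) m = \<zero>\<^bsub>X\<^esub>" for m
    using that short_exact_kernel[OF S, of "fst m"] hz by (force simp: pullback_simps)
qed (use short_exactD[OF S] short_exact_zero_in[OF S] X in \<open>auto simp: pullback_simps\<close>)

lemma short_exact_prod:
  assumes S: "short_exact R Y S X" and T: "short_exact R Y' T X'"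
  shows "short_exact R (mod_prod Y Y') (ses_prod S T) (mod_prod X X')"
proof (rule short_exactI)
  note s = short_exactD[OF S] and t = short_exactD[OF T]
  show "ses_in (ses_prod S T) \<in> mod_hom R (mod_prod Y Y') (ses_mid (ses_prod S T))"
    by (rule mod_homI) (use s t in \<open>auto simp: ses_prod_def mod_hom_add[OF s(4)] mod_hom_add[OF t(4)]
        mod_hom_smult[OF s(4)] mod_hom_smult[OF t(4)]\<close>)
  show "ses_out (ses_prod S T) \<in> mod_hom R (ses_mid (ses_prod S T)) (mod_prod X X')"
    by (rule mod_homI) (use s t in \<open>auto simp: ses_prod_def mod_hom_add[OF s(5)] mod_hom_add[OF t(5)]
        mod_hom_smult[OF s(5)] mod_hom_smult[OF t(5)]\<close>)
  show "\<exists>m\<in>carrier (ses_mid (ses_prod S T)). ses_out (ses_prod S T) m = x" if "x \<in> carrier (mod_prod X X')" for x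
    using that short_exact_preimage[OF S, of "fst x"] short_exact_preimage[OF T, of "snd x"]
    by (force simp: ses_prod_def)
  show "\<exists>y\<in>carrier (mod_prod Y Y'). m = ses_in (ses_prod S T) y"
    if "m \<in> carrier (ses_mid (ses_prod S T))" "ses_out (ses_prod S T) m = \<zero>\<^bsub>mod_prod X X'\<^esub>" for m
    using that short_exact_kernel[OF S, of "fst m"] short_exact_kernel[OF T, of "snd m"]
    by (force simp: ses_prod_def)
qed (use short_exactD[OF S] short_exactD[OF T] short_exact_zero_in[OF S] short_exact_zero_in[OF T] in
    \<open>auto simp: ses_prod_def\<close>)

section \<open>Push-outs\<close>

lemma pushout_rel_submod:
  assumes S: "short_exact R Z S X" and Y: "left_module R Y" and h: "h \<in> mod_hom R Z Y"
  shows "submod (mod_prod Y (ses_mid S)) (pushout_rel Z h S)"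
proof -
  note s = short_exactD[OF S]
  show ?thesis unfolding pushout_rel_def
    by (rule submod_image[OF s(1) left_module_prod[OF Y s(2)]
          mod_hom_pair[OF h mod_hom_uminus[OF s(2,4)]]])
qed

text \<open>The structure map from the old middle term to the new one. \<open>ses_pushout\<close>
  itself keeps only the maps from \<open>Y\<close> and to \<open>X\<close>.\<close>

definition pushout_map :: "('r, 'z) module \<Rightarrow> ('r, 'y) module \<Rightarrow> ('z \<Rightarrow> 'y) \<Rightarrow> ('r, 'z, 'm, 'x) ses \<Rightarrow> 'm \<Rightarrow> ('y \<times> 'm) set" where
  "pushout_map Z Y h S m = pushout_rel Z h S +>\<^bsub>mod_prod Y (ses_mid S)\<^esub> (\<zero>\<^bsub>Y\<^esub>, m)"

lemma pushout_facts:
  assumes S: "short_exact R Z S X" and Y: "left_module R Y" and h: "h \<in> mod_hom R Z Y"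
  defines "P \<equiv> ses_pushout Z Y h S"
  shows "short_exact R Y P X"
    and "pushout_map Z Y h S \<in> mod_hom R (ses_mid S) (ses_mid P)"
    and "\<And>z. z \<in> carrier Z \<Longrightarrow> pushout_map Z Y h S (ses_in S z) = ses_in P (h z)"
    and "\<And>m. m \<in> carrier (ses_mid S) \<Longrightarrow> ses_out P (pushout_map Z Y h S m) = ses_out S m"
proof -
  note s = short_exactD[OF S]
  let ?A = "mod_prod Y (ses_mid S)" and ?N = "pushout_rel Z h S"
  let ?q = "\<lambda>a. ?N +>\<^bsub>?A\<^esub> a"
  have A: "left_module R ?A" using Y s by simp
  note N = pushout_rel_submod[OF S Y h]
  have mid: "ses_mid P = mod_quot ?A ?N" and inP: "ses_in P y = ?q (y, \<zero>\<^bsub>ses_mid S\<^esub>)" for y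
    by (simp_all add: P_def ses_pushout_def)
  note q = quot_hom[OF A N, folded mid]
  have Q: "left_module R (ses_mid P)" unfolding mid by (rule left_module_quot[OF A N])
  have qs: "?q ` carrier ?A = carrier (ses_mid P)" unfolding mid by (rule quot_surj)
  have qeq: "?q a = ?q b \<longleftrightarrow> a \<ominus>\<^bsub>?A\<^esub> b \<in> ?N" if "a \<in> carrier ?A" "b \<in> carrier ?A" for a b
    by (rule coset_eq_iff[OF A N that])
  \<comment> \<open>The outgoing map is defined by \<open>the_elem\<close>. All elements of a coset
    have the same value, since a relation changes the second component only by an element coming
    from \<open>Z\<close>.\<close>
  have out: "ses_out P (?q (y, m)) = ses_out S m" if ym: "y \<in> carrier Y" "m \<in> carrier (ses_mid S)" for y m
  proof -
    have *: "ses_out S m' = ses_out S m" if "(y', m') \<in> ?q (y, m)" for y' m'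
    proof -
      have c: "(y', m') \<in> carrier ?A" "(y', m') \<ominus>\<^bsub>?A\<^esub> (y, m) \<in> ?N"
        using coset_memD[OF A N _ that] ym by auto
      then obtain z where "z \<in> carrier Z" "m' \<ominus>\<^bsub>ses_mid S\<^esub> m = \<ominus>\<^bsub>ses_mid S\<^esub> ses_in S z"
        using ym Y s by (auto simp: pushout_rel_def mod_prod_diff)
      then have "ses_out S (m' \<ominus>\<^bsub>ses_mid S\<^esub> m) = \<zero>\<^bsub>X\<^esub>"
        using s by (simp add: mod_hom_neg[OF s(5,2,3)])
      then show ?thesis using c ym s by (simp add: mod_hom_diff[OF s(5,2,3)])
    qed
    have "(y, m) \<in> ?q (y, m)" using coset_self[OF A N] ym by auto
    have "(\<lambda>(y, m). ses_out S m) ` ?q (y, m) = (\<lambda>_. ses_out S m) ` ?q (y, m)"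
    proof (rule image_cong[OF refl])
      fix a assume "a \<in> ?q (y, m)"
      then show "(case a of (y, m) \<Rightarrow> ses_out S m) = ses_out S m" using *[of "fst a" "snd a"] by (simp add: case_prod_beta)
    qed
    also have "\<dots> = {ses_out S m}" using \<open>(y, m) \<in> ?q (y, m)\<close> by blast
    finally have "(\<lambda>(y, m). ses_out S m) ` ?q (y, m) = {ses_out S m}" .
    then show ?thesis by (simp add: P_def ses_pushout_def)
  qed
  have inhom: "ses_in P \<in> mod_hom R Y (ses_mid P)"
    using mod_hom_compose[OF mod_hom_pair[OF mod_hom_id mod_hom_zero_map[OF s(2)]] q]
    by (rule mod_hom_cong) (use Y in \<open>simp_all add: inP\<close>)
  show j: "pushout_map Z Y h S \<in> mod_hom R (ses_mid S) (ses_mid P)"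
    using mod_hom_compose[OF mod_hom_pair[OF mod_hom_zero_map[OF Y] mod_hom_id] q]
    by (rule mod_hom_cong) (use s in \<open>simp_all add: pushout_map_def\<close>)
  have gen: "\<exists>y\<in>carrier Y. \<exists>m\<in>carrier (ses_mid S). p = ?q (y, m)" if "p \<in> carrier (ses_mid P)" for p
  proof -
    have "p \<in> ?q ` carrier ?A" using that qs by simp
    then obtain a where "a \<in> carrier ?A" "p = ?q a" by blast
    then show ?thesis by (cases a) auto
  qed
  have zQ: "\<zero>\<^bsub>ses_mid P\<^esub> = ?q (\<zero>\<^bsub>Y\<^esub>, \<zero>\<^bsub>ses_mid S\<^esub>)"
    using mod_hom_zero[OF q A Q] by simp
  show jin: "pushout_map Z Y h S (ses_in S z) = ses_in P (h z)" if z: "z \<in> carrier Z" for z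
  proof -
    have "(\<zero>\<^bsub>Y\<^esub>, ses_in S z) \<ominus>\<^bsub>?A\<^esub> (h z, \<zero>\<^bsub>ses_mid S\<^esub>) = (h (\<ominus>\<^bsub>Z\<^esub> z), \<ominus>\<^bsub>ses_mid S\<^esub> ses_in S (\<ominus>\<^bsub>Z\<^esub> z))"
      using z Y s mod_hom_closed[OF h z]
      by (subst mod_prod_diff) (simp_all add: mod_hom_neg[OF h s(1) Y] mod_hom_neg[OF s(4,1,2)] module_diff_eq)
    moreover have "\<dots> \<in> ?N" using z s by (simp add: pushout_rel_def)
    ultimately show ?thesis unfolding inP pushout_map_def
      using z s Y mod_hom_closed[OF h z] by (subst qeq) auto
  qed
  show jout: "ses_out P (pushout_map Z Y h S m) = ses_out S m" if "m \<in> carrier (ses_mid S)" for m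
    using out that Y by (simp add: pushout_map_def)
  show "short_exact R Y P X"
  proof (rule short_exactI[OF Y Q s(3) inhom])
    show "ses_out P \<in> mod_hom R (ses_mid P) X"
    proof (rule mod_homI)
      fix p assume "p \<in> carrier (ses_mid P)"
      then obtain y m where p: "y \<in> carrier Y" "m \<in> carrier (ses_mid S)" "p = ?q (y, m)" using gen by blast
      then show "ses_out P p \<in> carrier X" using out s by simp
      show "ses_out P (r \<odot>\<^bsub>ses_mid P\<^esub> p) = r \<odot>\<^bsub>X\<^esub> ses_out P p" if r: "r \<in> carrier R" for r
        using p r Y s mod_hom_smult[OF q r, of "(y, m)", symmetric] by (simp add: out mod_hom_smult[OF s(5)])
      fix p' assume "p' \<in> carrier (ses_mid P)"
      then obtain y' m' where p': "y' \<in> carrier Y" "m' \<in> carrier (ses_mid S)" "p' = ?q (y', m')" using gen by blast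
      show "ses_out P (p \<oplus>\<^bsub>ses_mid P\<^esub> p') = ses_out P p \<oplus>\<^bsub>X\<^esub> ses_out P p'"
        using p p' Y s mod_hom_add[OF q, of "(y, m)" "(y', m')", symmetric] by (simp add: out mod_hom_add[OF s(5)])
    qed
    \<comment> \<open>A relation of the form \<open>(y, 0)\<close> comes from some \<open>z\<close>
      with \<open>ses_in S z = 0\<close>; then \<open>z = 0\<close>, and
      \<open>y = h z = 0\<close>.\<close>
    show "y = \<zero>\<^bsub>Y\<^esub>" if y: "y \<in> carrier Y" "ses_in P y = \<zero>\<^bsub>ses_mid P\<^esub>" for y
    proof -
      have "(y, \<zero>\<^bsub>ses_mid S\<^esub>) \<ominus>\<^bsub>?A\<^esub> (\<zero>\<^bsub>Y\<^esub>, \<zero>\<^bsub>ses_mid S\<^esub>) \<in> ?N"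
        using y Y s by (subst qeq[symmetric]) (auto simp: inP zQ)
      then obtain z where z: "z \<in> carrier Z" "y = h z" "\<zero>\<^bsub>ses_mid S\<^esub> = \<ominus>\<^bsub>ses_mid S\<^esub> ses_in S z"
        using y Y s by (auto simp: mod_prod_diff pushout_rel_def)
      then have "ses_in S z = \<zero>\<^bsub>ses_mid S\<^esub>" using s by (metis module_neg_neg module_neg_zero)
      then have "z = \<zero>\<^bsub>Z\<^esub>" using short_exact_zero_in[OF S] z by simp
      then show ?thesis using z mod_hom_zero[OF h s(1) Y] by simp
    qed
    show "\<exists>m\<in>carrier (ses_mid P). ses_out P m = x" if x: "x \<in> carrier X" for x
    proof -
      obtain m where m: "m \<in> carrier (ses_mid S)" "ses_out S m = x" using short_exact_preimage[OF S x] by blast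
      then show ?thesis using jout mod_hom_closed[OF j] by blast
    qed
    show "ses_out P (ses_in P y) = \<zero>\<^bsub>X\<^esub>" if "y \<in> carrier Y" for y
      using that s out mod_hom_zero[OF s(5,2,3)] by (simp add: inP)
    show "\<exists>y\<in>carrier Y. p = ses_in P y" if p: "p \<in> carrier (ses_mid P)" "ses_out P p = \<zero>\<^bsub>X\<^esub>" for p
    proof -
      obtain y m where ym: "y \<in> carrier Y" "m \<in> carrier (ses_mid S)" "p = ?q (y, m)" using gen p(1) by blast
      then have "ses_out S m = \<zero>\<^bsub>X\<^esub>" using p out by simp
      then obtain z where z: "z \<in> carrier Z" "m = ses_in S z" using short_exact_kernel[OF S ym(2)] by blast
      have "p = ?q ((y, \<zero>\<^bsub>ses_mid S\<^esub>) \<oplus>\<^bsub>?A\<^esub> (\<zero>\<^bsub>Y\<^esub>, m))" using ym Y s by simp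
      also have "\<dots> = ?q (y, \<zero>\<^bsub>ses_mid S\<^esub>) \<oplus>\<^bsub>ses_mid P\<^esub> ?q (\<zero>\<^bsub>Y\<^esub>, m)"
        using ym Y s by (intro mod_hom_add[OF q]) auto
      also have "\<dots> = ses_in P y \<oplus>\<^bsub>ses_mid P\<^esub> ses_in P (h z)"
        using jin[OF z(1)] z by (simp add: inP pushout_map_def)
      also have "\<dots> = ses_in P (y \<oplus>\<^bsub>Y\<^esub> h z)"
        using ym mod_hom_closed[OF h z(1)] by (simp add: mod_hom_add[OF inhom])
      finally show ?thesis using ym Y mod_hom_closed[OF h z(1)] by (metis module_add_closed)
    qed
  qed
qed

section \<open>Direct sums of exact sequences\<close>

lemma dsum_map_hom:
  assumes A: "\<And>k. k \<in> K \<Longrightarrow> left_module R (A k)" and B: "\<And>k. k \<in> K \<Longrightarrow> left_module R (B k)"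
    and f: "\<And>k. k \<in> K \<Longrightarrow> f k \<in> mod_hom R (A k) (B k)"
  shows "(\<lambda>h. \<lambda>k\<in>K. f k (h k)) \<in> mod_hom R (mod_dsum K A) (mod_dsum K B)"
proof (rule mod_homI)
  fix x assume x: "x \<in> carrier (mod_dsum K A)"
  have "{k \<in> K. f k (x k) \<noteq> \<zero>\<^bsub>B k\<^esub>} \<subseteq> {k \<in> K. x k \<noteq> \<zero>\<^bsub>A k\<^esub>}"
    using mod_hom_zero[OF f A B] by auto
  then have "finite {k \<in> K. f k (x k) \<noteq> \<zero>\<^bsub>B k\<^esub>}"
    by (rule finite_subset) (use x in \<open>simp add: dsum_carrier_iff\<close>)
  then show "(\<lambda>k\<in>K. f k (x k)) \<in> carrier (mod_dsum K B)"
    using x by (auto simp: dsum_carrier_iff mod_hom_closed[OF f] cong: conj_cong)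
qed (auto simp: fun_eq_iff dsum_add dsum_smult dsum_carrier_iff mod_hom_add[OF f] mod_hom_smult[OF f])

lemma short_exact_dsum:
  assumes S: "\<And>k. k \<in> K \<Longrightarrow> short_exact R (Y k) (S k) (X k)"
  shows "short_exact R (mod_dsum K Y) (ses_dsum K S) (mod_dsum K X)"
proof -
  note s = short_exactD[OF S]

  have mids: "ses_mid (ses_dsum K S) = mod_dsum K (\<lambda>k. ses_mid (S k))"
    and outs: "ses_out (ses_dsum K S) h = (\<lambda>k\<in>K. ses_out (S k) (h k))"
    and ins: "ses_in (ses_dsum K S) g = (\<lambda>k\<in>K. ses_in (S k) (g k))" for h g
    by (simp_all add: ses_dsum_def)
  show ?thesis
  proof (rule short_exactI)
    show "left_module R (mod_dsum K Y)" "left_module R (mod_dsum K X)" "left_module R (ses_mid (ses_dsum K S))"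
      unfolding mids by (rule left_module_dsum, rule s, assumption)+
    show "ses_in (ses_dsum K S) \<in> mod_hom R (mod_dsum K Y) (ses_mid (ses_dsum K S))"
      using dsum_map_hom[of K, OF s(1,2,4)] by (simp add: ses_dsum_def)
    show "ses_out (ses_dsum K S) \<in> mod_hom R (ses_mid (ses_dsum K S)) (mod_dsum K X)"
      using dsum_map_hom[of K, OF s(2,3,5)] by (simp add: ses_dsum_def)
    show "y = \<zero>\<^bsub>mod_dsum K Y\<^esub>"
      if "y \<in> carrier (mod_dsum K Y)" "ses_in (ses_dsum K S) y = \<zero>\<^bsub>ses_mid (ses_dsum K S)\<^esub>" for y
    proof (rule dsum_eqI[OF that(1)])
      fix k assume k: "k \<in> K"
      then have "ses_in (S k) (y k) = \<zero>\<^bsub>ses_mid (S k)\<^esub>"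
        using fun_cong[OF that(2), of k] by (simp add: ins mids dsum_zero)
      then show "y k = \<zero>\<^bsub>mod_dsum K Y\<^esub> k"
        using short_exact_zero_in[OF S] k that(1) by (auto simp: dsum_zero dsum_carrier_iff)
    qed (rule module_zero_closed, rule left_module_dsum, rule s)
    show "ses_out (ses_dsum K S) (ses_in (ses_dsum K S) y) = \<zero>\<^bsub>mod_dsum K X\<^esub>" if "y \<in> carrier (mod_dsum K Y)" for y
      using that s by (auto simp: ins outs dsum_zero fun_eq_iff dsum_carrier_iff)
    show "\<exists>m\<in>carrier (ses_mid (ses_dsum K S)). ses_out (ses_dsum K S) m = x" if x: "x \<in> carrier (mod_dsum K X)" for x
    proof -
      \<comment> \<open>Preimages are taken to be zero wherever \<open>x\<close> is zero; an
        arbitrary choice need not have finite support.\<close>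
      have "\<exists>m. m \<in> carrier (ses_mid (S k)) \<and> ses_out (S k) m = x k \<and> (x k = \<zero>\<^bsub>X k\<^esub> \<longrightarrow> m = \<zero>\<^bsub>ses_mid (S k)\<^esub>)"
        if k: "k \<in> K" for k
        using short_exact_preimage[OF S[OF k], of "x k"] x k s(2,3,5)[OF k] mod_hom_zero[of "ses_out (S k)"]
        by (cases "x k = \<zero>\<^bsub>X k\<^esub>") (auto simp: dsum_carrier_iff)
      then obtain m where m: "\<And>k. k \<in> K \<Longrightarrow> m k \<in> carrier (ses_mid (S k))" "\<And>k. k \<in> K \<Longrightarrow> ses_out (S k) (m k) = x k"
        "\<And>k. k \<in> K \<Longrightarrow> x k = \<zero>\<^bsub>X k\<^esub> \<Longrightarrow> m k = \<zero>\<^bsub>ses_mid (S k)\<^esub>" by metis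
      have "{k \<in> K. m k \<noteq> \<zero>\<^bsub>ses_mid (S k)\<^esub>} \<subseteq> {k \<in> K. x k \<noteq> \<zero>\<^bsub>X k\<^esub>}" using m by auto
      then have "finite {k \<in> K. m k \<noteq> \<zero>\<^bsub>ses_mid (S k)\<^esub>}"
        by (rule finite_subset) (use x in \<open>simp add: dsum_carrier_iff\<close>)
      then have "restrict m K \<in> carrier (ses_mid (ses_dsum K S))"
        using m by (auto simp: mids dsum_carrier_iff cong: conj_cong)
      moreover have "ses_out (ses_dsum K S) (restrict m K) = x"
        using m x by (auto simp: outs fun_eq_iff dsum_carrier_iff extensional_def)
      ultimately show ?thesis by blast
    qed
    show "\<exists>y\<in>carrier (mod_dsum K Y). m = ses_in (ses_dsum K S) y"
      if m: "m \<in> carrier (ses_mid (ses_dsum K S))" "ses_out (ses_dsum K S) m = \<zero>\<^bsub>mod_dsum K X\<^esub>" for m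
    proof -
      have mk: "m k \<in> carrier (ses_mid (S k))" "ses_out (S k) (m k) = \<zero>\<^bsub>X k\<^esub>" if "k \<in> K" for k
        using m(1) that fun_cong[OF m(2), of k] by (auto simp: mids outs dsum_carrier_iff dsum_zero)
      have "\<exists>y\<in>carrier (Y k). m k = ses_in (S k) y" if "k \<in> K" for k
        using short_exact_kernel[OF S[OF that] mk[OF that]] by blast
      then obtain y where y: "\<And>k. k \<in> K \<Longrightarrow> y k \<in> carrier (Y k)" "\<And>k. k \<in> K \<Longrightarrow> m k = ses_in (S k) (y k)" by metis
      have "y k = \<zero>\<^bsub>Y k\<^esub>" if "k \<in> K" "m k = \<zero>\<^bsub>ses_mid (S k)\<^esub>" for k
        using short_exact_zero_in[OF S[OF that(1)] y(1)[OF that(1)]] y(2) that by simp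
      then have "{k \<in> K. y k \<noteq> \<zero>\<^bsub>Y k\<^esub>} \<subseteq> {k \<in> K. m k \<noteq> \<zero>\<^bsub>ses_mid (S k)\<^esub>}" by auto
      then have "finite {k \<in> K. y k \<noteq> \<zero>\<^bsub>Y k\<^esub>}"
        by (rule finite_subset) (use m in \<open>simp add: dsum_carrier_iff mids\<close>)
      then have "restrict y K \<in> carrier (mod_dsum K Y)"
        using y by (auto simp: dsum_carrier_iff cong: conj_cong)
      moreover have "m = ses_in (ses_dsum K S) (restrict y K)"
        using m y by (auto simp: ins mids fun_eq_iff dsum_carrier_iff extensional_def)
      ultimately show ?thesis by blast
    qed
  qed
qed

end

section \<open>Extensions through a presentation\<close>

text \<open>Projectivity is added only in the next locale, because gluing along a push-out is used a
  second time with the direct sum of the chosen extensions in place of the presentation.\<close>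

locale presentation = base_ring R for R :: "'r ring" (structure) +
  fixes K :: "('r, 'k) module" and T :: "('r, 'k, 'f, 'x) ses" and X :: "('r, 'x) module"
  assumes exact_T: "short_exact R K T X"
begin

abbreviation "F \<equiv> ses_mid T"
abbreviation "\<kappa> \<equiv> ses_in T"
abbreviation "p \<equiv> ses_out T"

lemmas presD = short_exactD[OF exact_T]

text \<open>\<open>S\<close> is the push-out of the presentation along \<open>\<phi>\<close>, as witnessed by the map \<open>\<psi>\<close> of middle terms.\<close>

definition rep_by :: "('r, 'y) module \<Rightarrow> ('r, 'y, 'm, 'x) ses \<Rightarrow> ('k \<Rightarrow> 'y) \<Rightarrow> ('f \<Rightarrow> 'm) \<Rightarrow> bool" where
  "rep_by Y S \<phi> \<psi> \<longleftrightarrow> \<phi> \<in> mod_hom R K Y \<and> \<psi> \<in> mod_hom R F (ses_mid S) \<and>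
     (\<forall>x\<in>carrier F. ses_out S (\<psi> x) = p x) \<and> (\<forall>k\<in>carrier K. \<psi> (\<kappa> k) = ses_in S (\<phi> k))"

lemma rep_byD:
  assumes "rep_by Y S \<phi> \<psi>"
  shows "\<phi> \<in> mod_hom R K Y" "\<psi> \<in> mod_hom R F (ses_mid S)"
    "\<And>x. x \<in> carrier F \<Longrightarrow> ses_out S (\<psi> x) = p x"
    "\<And>k. k \<in> carrier K \<Longrightarrow> \<psi> (\<kappa> k) = ses_in S (\<phi> k)"
    "\<And>k. k \<in> carrier K \<Longrightarrow> \<phi> k \<in> carrier Y"
    "\<And>x. x \<in> carrier F \<Longrightarrow> \<psi> x \<in> carrier (ses_mid S)"
  using assms by (auto simp: rep_by_def mod_hom_closed)

text \<open>The middle term of \<open>S\<close> is the quotient of \<open>Y \<times> F\<close> by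
  the copy of \<open>K\<close> consisting of the pairs \<open>(- \<phi> k, \<kappa> k)\<close>. A
  map out of it is thus a pair of maps that match on \<open>K\<close>.\<close>

lemma glue:
  assumes S: "short_exact R Y S X" and r: "rep_by Y S \<phi> \<psi>" and W: "left_module R W"
    and h: "h \<in> mod_hom R Y W" and \<rho>: "\<rho> \<in> mod_hom R F W" and eq: "\<And>k. k \<in> carrier K \<Longrightarrow> \<rho> (\<kappa> k) = h (\<phi> k)"
  obtains G where "G \<in> mod_hom R (ses_mid S) W" "\<And>y. y \<in> carrier Y \<Longrightarrow> G (ses_in S y) = h y"
    "\<And>x. x \<in> carrier F \<Longrightarrow> G (\<psi> x) = \<rho> x"
proof -
  note s = short_exactD[OF S] and r = rep_byD[OF r]
  let ?A = "mod_prod Y F" and ?M = "ses_mid S"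
  let ?\<pi> = "\<lambda>(y, x). ses_in S y \<oplus>\<^bsub>?M\<^esub> \<psi> x" and ?g = "\<lambda>(y, x). h y \<oplus>\<^bsub>W\<^esub> \<rho> x"
  have A: "left_module R ?A" using s presD by simp
  have \<pi>: "?\<pi> \<in> mod_hom R ?A ?M" by (rule mod_hom_prod_sum[OF s(2,4) r(2)])
  have g: "?g \<in> mod_hom R ?A W" by (rule mod_hom_prod_sum[OF W h \<rho>])
  have surj: "?\<pi> ` carrier ?A = carrier ?M"
  proof (intro equalityI subsetI)
    fix m assume m: "m \<in> carrier ?M"
    obtain x where x: "x \<in> carrier F" "p x = ses_out S m"
      using short_exact_preimage[OF exact_T s(9)[OF m]] by blast
    have "ses_out S (m \<ominus>\<^bsub>?M\<^esub> \<psi> x) = \<zero>\<^bsub>X\<^esub>"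
      using x m s r by (simp add: mod_hom_diff[OF s(5,2,3)])
    then obtain y where y: "y \<in> carrier Y" "m \<ominus>\<^bsub>?M\<^esub> \<psi> x = ses_in S y"
      using short_exact_kernel[OF S] m x r s(2) by (metis imageE module_diff_closed)
    then have "m = ?\<pi> (y, x)" using m x r(6) s(2) by (simp add: y(2)[symmetric])
    then show "m \<in> ?\<pi> ` carrier ?A" using x y by (intro image_eqI[of _ _ "(y, x)"]) auto
  qed (use mod_hom_closed[OF \<pi>] in auto)
  have ker: "?g a = \<zero>\<^bsub>W\<^esub>" if a: "a \<in> carrier ?A" "?\<pi> a = \<zero>\<^bsub>?M\<^esub>" for a
  proof -
    obtain y x where yx: "a = (y, x)" "y \<in> carrier Y" "x \<in> carrier F" using a by (cases a) auto
    have e: "ses_in S y \<oplus>\<^bsub>?M\<^esub> \<psi> x = \<zero>\<^bsub>?M\<^esub>" using a yx by simp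
    have "p x = ses_out S (ses_in S y \<oplus>\<^bsub>?M\<^esub> \<psi> x)"
      using yx s r presD(9) by (simp add: mod_hom_add[OF s(5)])
    then have "p x = \<zero>\<^bsub>X\<^esub>" using e mod_hom_zero[OF s(5,2,3)] by simp
    then obtain k where k: "k \<in> carrier K" "x = \<kappa> k" using short_exact_kernel[OF exact_T yx(3)] by blast
    have "ses_in S (y \<oplus>\<^bsub>Y\<^esub> \<phi> k) = \<zero>\<^bsub>?M\<^esub>" using e k yx r by (simp add: mod_hom_add[OF s(4)])
    then have 0: "y \<oplus>\<^bsub>Y\<^esub> \<phi> k = \<zero>\<^bsub>Y\<^esub>" using short_exact_zero_in[OF S] yx k r s by simp
    have "?g a = h (y \<oplus>\<^bsub>Y\<^esub> \<phi> k)" using yx k r eq by (simp add: mod_hom_add[OF h])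
    then show ?thesis using 0 mod_hom_zero[OF h s(1) W] by simp
  qed
  obtain G where G: "G \<in> mod_hom R ?M W" "\<And>a. a \<in> carrier ?A \<Longrightarrow> G (?\<pi> a) = ?g a"
    using mod_hom_through_surj[OF A s(2) W \<pi> surj g ker] by blast
  show thesis
  proof (rule that[OF G(1)])
    show "G (ses_in S y) = h y" if y: "y \<in> carrier Y" for y
      using G(2)[of "(y, \<zero>\<^bsub>F\<^esub>)"] y s presD W mod_hom_closed[OF h y]
        mod_hom_zero[OF r(2) presD(2) s(2)] mod_hom_zero[OF \<rho> presD(2) W] by simp
    show "G (\<psi> x) = \<rho> x" if x: "x \<in> carrier F" for x
      using G(2)[of "(\<zero>\<^bsub>Y\<^esub>, x)"] x s r W mod_hom_closed[OF \<rho> x]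
        mod_hom_zero[OF s(4,1,2)] mod_hom_zero[OF h s(1) W] by simp
  qed
qed

text \<open>The images of \<open>ses_in S\<close> and \<open>\<psi>\<close> together span the middle
  term, as every \<open>m\<close> differs from some \<open>\<psi> x\<close> by an element of
  \<open>Y\<close>.\<close>

lemma mid_hom_eqI:
  assumes S: "short_exact R Y S X" and r: "rep_by Y S \<phi> \<psi>" and W: "left_module R W"
    and g: "g \<in> mod_hom R (ses_mid S) W" and h: "h \<in> mod_hom R (ses_mid S) W"
    and "\<And>y. y \<in> carrier Y \<Longrightarrow> g (ses_in S y) = h (ses_in S y)"
    and "\<And>x. x \<in> carrier F \<Longrightarrow> g (\<psi> x) = h (\<psi> x)" and m: "m \<in> carrier (ses_mid S)"
  shows "g m = h m"
proof -
  note s = short_exactD[OF S] and r = rep_byD[OF r]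
  let ?M = "ses_mid S"
  obtain x where x: "x \<in> carrier F" "p x = ses_out S m"
    using short_exact_preimage[OF exact_T s(9)[OF m]] by blast
  have "ses_out S (m \<ominus>\<^bsub>?M\<^esub> \<psi> x) = \<zero>\<^bsub>X\<^esub>"
    using x m s r by (simp add: mod_hom_diff[OF s(5,2,3)])
  then obtain y where y: "y \<in> carrier Y" "m \<ominus>\<^bsub>?M\<^esub> \<psi> x = ses_in S y"
    using short_exact_kernel[OF S] m x r s(2) by (metis imageE module_diff_closed)
  then have "m = ses_in S y \<oplus>\<^bsub>?M\<^esub> \<psi> x" using m x r(6) s(2) by (simp add: y(2)[symmetric])
  then show ?thesis using assms(6,7) x y r s by (simp add: mod_hom_add[OF g] mod_hom_add[OF h])
qed

end

section \<open>Classification of extensions by maps out of the kernel\<close>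

locale proj_presentation = presentation R K T X
  for R :: "'r ring" (structure) and K :: "('r, 'k) module" and T :: "('r, 'k, 'f, 'x) ses" and X :: "('r, 'x) module" +
  fixes J :: "'j set"
  assumes retract_T: "retract_of_free R (ses_mid T) J"
begin

text \<open>The restrictions from \<open>F\<close> form the subgroup of \<open>Hom(K, Y)\<close>
  that represents the split extension; every comparison of extensions is reduced to membership in
  it.\<close>

definition extends :: "('r, 'y) module \<Rightarrow> ('k \<Rightarrow> 'y) \<Rightarrow> bool" where
  "extends Y \<phi> \<longleftrightarrow> (\<exists>\<theta>\<in>mod_hom R F Y. \<forall>k\<in>carrier K. \<theta> (\<kappa> k) = \<phi> k)"

text \<open>The type of the middle term is left open, since push-outs, pull-backs and Baer sums each
  produce a different one.\<close>

definition rep :: "('r, 'y) module \<Rightarrow> ('r, 'y, 'm, 'x) ses \<Rightarrow> ('k \<Rightarrow> 'y) \<Rightarrow> bool" where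
  "rep Y S \<phi> \<longleftrightarrow> (\<exists>\<psi>. rep_by Y S \<phi> \<psi>)"

text \<open>Projectivity of \<open>F\<close> lifts \<open>p\<close> to the middle term of
  \<open>S\<close>. On \<open>K\<close> the lift falls into the kernel of \<open>ses_out S\<close>,
  which is the image of \<open>Y\<close>.\<close>

lemma rep_exists:
  assumes S: "short_exact R Y S X"
  obtains \<phi> \<psi> where "rep_by Y S \<phi> \<psi>"
proof -
  note s = short_exactD[OF S]
  obtain \<psi> where \<psi>: "\<psi> \<in> mod_hom R F (ses_mid S)" "\<And>x. x \<in> carrier F \<Longrightarrow> ses_out S (\<psi> x) = p x"
    using retract_of_free_lift[OF retract_T s(2,3,5,7) presD(5)] by blast
  have "\<psi> (\<kappa> k) \<in> ses_in S ` carrier Y" if "k \<in> carrier K" for k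
    by (rule short_exact_kernel[OF S]) (use that presD \<psi> mod_hom_closed[OF \<psi>(1)] in auto)
  then obtain \<phi> where "\<phi> \<in> mod_hom R K Y" "\<And>k. k \<in> carrier K \<Longrightarrow> ses_in S (\<phi> k) = \<psi> (\<kappa> k)"
    using mod_hom_through_inj[OF presD(1) s(1,2,4,6) mod_hom_compose[OF presD(4) \<psi>(1)]] by blast
  with \<psi> show thesis by (intro that[of \<phi> \<psi>]) (auto simp: rep_by_def)
qed

text \<open>If \<open>\<theta>\<close> extends \<open>\<phi>' - \<phi>\<close>, then subtracting
  \<open>\<theta>\<close> from \<open>\<psi>'\<close> gives another lift of \<open>p\<close> to
  \<open>S'\<close>, whose restriction to \<open>K\<close> is \<open>\<phi>\<close>. Together with
  the inclusion of \<open>Y\<close> it glues to a map of extensions.\<close>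

lemma rep_equiv:
  assumes S: "short_exact R Y S X" and S': "short_exact R Y S' X"
    and r: "rep Y S \<phi>" and r': "rep Y S' \<phi>'" and e: "extends Y (\<lambda>k. \<phi>' k \<ominus>\<^bsub>Y\<^esub> \<phi> k)"
  shows "ses_equiv R Y X S S'"
proof -
  note s = short_exactD[OF S] and t = short_exactD[OF S']
  obtain \<psi> where r: "rep_by Y S \<phi> \<psi>" using r by (auto simp: rep_def)
  obtain \<psi>' where r': "rep_by Y S' \<phi>' \<psi>'" using r' by (auto simp: rep_def)
  obtain \<theta> where \<theta>: "\<theta> \<in> mod_hom R F Y" "\<And>k. k \<in> carrier K \<Longrightarrow> \<theta> (\<kappa> k) = \<phi>' k \<ominus>\<^bsub>Y\<^esub> \<phi> k"
    using e by (auto simp: extends_def)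
  note rD = rep_byD[OF r] and rD' = rep_byD[OF r']
  let ?\<rho> = "\<lambda>x. \<psi>' x \<ominus>\<^bsub>ses_mid S'\<^esub> ses_in S' (\<theta> x)"
  have \<rho>: "?\<rho> \<in> mod_hom R F (ses_mid S')"
    by (intro mod_hom_minus t rD' mod_hom_compose[OF \<theta>(1) t(4)])
  have eq: "?\<rho> (\<kappa> k) = ses_in S' (\<phi> k)" if k: "k \<in> carrier K" for k
  proof -
    have "\<phi>' k \<ominus>\<^bsub>Y\<^esub> (\<phi>' k \<ominus>\<^bsub>Y\<^esub> \<phi> k) = \<phi> k"
      using k s rD rD' by (simp add: module_diff_eq module_neg_add flip: module_add_assoc)
    then show ?thesis using k s rD rD' \<theta>(2) by (simp flip: mod_hom_diff[OF t(4,1,2)])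
  qed
  obtain G where G: "G \<in> mod_hom R (ses_mid S) (ses_mid S')"
      "\<And>y. y \<in> carrier Y \<Longrightarrow> G (ses_in S y) = ses_in S' y" "\<And>x. x \<in> carrier F \<Longrightarrow> G (\<psi> x) = ?\<rho> x"
    using glue[OF S r t(2,4) \<rho> eq] by blast
  show ?thesis
  proof (rule ses_equivI[OF S S' G(1,2)])
    show "ses_out S' (G m) = ses_out S m" if "m \<in> carrier (ses_mid S)" for m
    proof (rule mid_hom_eqI[OF S r s(3) mod_hom_compose[OF G(1) t(5)] s(5) _ _ that])
      show "ses_out S' (G (ses_in S y)) = ses_out S (ses_in S y)" if "y \<in> carrier Y" for y
        using that G s t by simp
      show "ses_out S' (G (\<psi> x)) = ses_out S (\<psi> x)" if "x \<in> carrier F" for x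
        using that G s t rD rD' mod_hom_closed[OF \<theta>(1)] presD(9)
        by (simp add: mod_hom_diff[OF t(5,2,3)])
    qed
  qed auto
qed

text \<open>After the equivalence is applied, \<open>\<psi>\<close> and \<open>\<psi>'\<close> are
  two lifts of \<open>p\<close> into the same middle term. They differ by a map
  \<open>F -> Y\<close>, which on \<open>K\<close> is \<open>\<phi> - \<phi>'\<close>.\<close>

lemma rep_unique:
  assumes S: "short_exact R Y S X" and S': "short_exact R Y S' X"
    and r: "rep Y S \<phi>" and r': "rep Y S' \<phi>'" and e: "ses_equiv R Y X S S'"
  shows "extends Y (\<lambda>k. \<phi> k \<ominus>\<^bsub>Y\<^esub> \<phi>' k)"
proof -
  note s = short_exactD[OF S] and t = short_exactD[OF S']
  obtain \<psi> where r: "rep_by Y S \<phi> \<psi>" using r by (auto simp: rep_def)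
  obtain \<psi>' where r': "rep_by Y S' \<phi>' \<psi>'" using r' by (auto simp: rep_def)
  note rD = rep_byD[OF r] and rD' = rep_byD[OF r']
  obtain G where G: "G \<in> mod_hom R (ses_mid S) (ses_mid S')"
    "\<And>y. y \<in> carrier Y \<Longrightarrow> G (ses_in S y) = ses_in S' y"
    "\<And>m. m \<in> carrier (ses_mid S) \<Longrightarrow> ses_out S' (G m) = ses_out S m" using ses_equivE[OF e] by blast
  let ?d = "\<lambda>x. G (\<psi> x) \<ominus>\<^bsub>ses_mid S'\<^esub> \<psi>' x"
  have d: "?d \<in> mod_hom R F (ses_mid S')"
    by (intro mod_hom_minus t rD' mod_hom_compose[OF rD(2) G(1)])
  have "?d x \<in> ses_in S' ` carrier Y" if x: "x \<in> carrier F" for x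
    by (rule short_exact_kernel[OF S' mod_hom_closed[OF d x]])
      (use x rD rD' G t presD(9) mod_hom_closed[OF G(1)] in \<open>simp add: mod_hom_diff[OF t(5,2,3)]\<close>)
  then obtain \<theta> where \<theta>: "\<theta> \<in> mod_hom R F Y" "\<And>x. x \<in> carrier F \<Longrightarrow> ses_in S' (\<theta> x) = ?d x"
    using mod_hom_through_inj[OF presD(2) t(1,2,4,6) d] by blast
  have "\<theta> (\<kappa> k) = \<phi> k \<ominus>\<^bsub>Y\<^esub> \<phi>' k" if k: "k \<in> carrier K" for k
  proof (rule inj_onD[OF t(6)])
    show "ses_in S' (\<theta> (\<kappa> k)) = ses_in S' (\<phi> k \<ominus>\<^bsub>Y\<^esub> \<phi>' k)"
      using k \<theta>(2) presD(8) rD rD' G by (simp add: mod_hom_diff[OF t(4,1,2)])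
  qed (use k presD rD rD' s mod_hom_closed[OF \<theta>(1)] in auto)
  then show ?thesis using \<theta>(1) by (auto simp: extends_def)
qed

lemma rep_transfer:
  assumes r: "rep Y S \<phi>" and e: "ses_equiv R Y X S S'"
  shows "rep Y S' \<phi>"
proof -
  obtain \<psi> where r: "rep_by Y S \<phi> \<psi>" using r by (auto simp: rep_def)
  obtain G where G: "G \<in> mod_hom R (ses_mid S) (ses_mid S')"
    "\<And>y. y \<in> carrier Y \<Longrightarrow> G (ses_in S y) = ses_in S' y"
    "\<And>m. m \<in> carrier (ses_mid S) \<Longrightarrow> ses_out S' (G m) = ses_out S m" using ses_equivE[OF e] by blast
  have "rep_by Y S' \<phi> (\<lambda>x. G (\<psi> x))"
    using mod_hom_compose[OF rep_byD(2)[OF r] G(1)] rep_byD[OF r] G by (simp add: rep_by_def)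
  then show ?thesis by (auto simp: rep_def)
qed

lemma extends_zero: "left_module R Y \<Longrightarrow> extends Y (\<lambda>k. \<zero>\<^bsub>Y\<^esub>)"
  unfolding extends_def by (intro bexI[of _ "\<lambda>x. \<zero>\<^bsub>Y\<^esub>"]) (auto intro: mod_hom_zero_map)

lemma extends_cong: "extends Y \<phi> \<Longrightarrow> (\<And>k. k \<in> carrier K \<Longrightarrow> \<phi> k = \<phi>' k) \<Longrightarrow> extends Y \<phi>'"
  by (auto simp: extends_def)

text \<open>The connecting map \<open>Hom(K, Y) -> Ext^1(X, Y)\<close>, with its values in the form
  that \<open>ext_class\<close> produces.\<close>

definition cl :: "('r, 'y) module \<Rightarrow> ('k \<Rightarrow> 'y) \<Rightarrow> ('r, 'y, 'y \<times> 'x, 'x) ses set" where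
  "cl Y \<phi> = {S. short_exact R Y S X \<and> rep Y S \<phi>}"

lemma rep_hom: "rep Y S \<phi> \<Longrightarrow> \<phi> \<in> mod_hom R K Y"
  by (auto simp: rep_def rep_by_def)

text \<open>The bridge from arbitrary middle types to \<open>Ext1\<close>: whatever sequence a
  construction yields, its class is known once a representing map is.\<close>

lemma ext_class_rep:
  assumes S: "short_exact R Y S X" and r: "rep Y S \<phi>"
  shows "ext_class R X Y S = cl Y \<phi>"
proof -
  have "extends Y (\<lambda>k. \<phi> k \<ominus>\<^bsub>Y\<^esub> \<phi> k)"
    using extends_zero[OF short_exactD(1)[OF S]]
    by (rule extends_cong) (use mod_hom_closed[OF rep_hom[OF r]] short_exactD(1)[OF S] in \<open>simp del: module_diff_zero_iff\<close>)
  then show ?thesis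
    unfolding ext_class_def cl_def using rep_transfer[OF r] rep_equiv[OF S _ r] by blast
qed

text \<open>The push-out of the presentation along \<open>\<phi>\<close> is represented by
  \<open>\<phi>\<close>; it is then moved to the type on which \<open>Ext1\<close> lives.\<close>

lemma rep_ses_exists:
  fixes Y :: "('r, 'y) module"
  assumes Y: "left_module R Y" and \<phi>: "\<phi> \<in> mod_hom R K Y"
  obtains S :: "('r, 'y, 'y \<times> 'x, 'x) ses" where "short_exact R Y S X" "rep Y S \<phi>"
proof -
  note po = pushout_facts[OF exact_T Y \<phi>]
  have r: "rep Y (ses_pushout K Y \<phi> T) \<phi>"
    unfolding rep_def rep_by_def using po \<phi> by blast
  obtain S :: "('r, 'y, 'y \<times> 'x, 'x) ses" where S: "short_exact R Y S X" "ses_equiv R Y X (ses_pushout K Y \<phi> T) S"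
    by (rule ses_transport[OF po(1)])
  show thesis by (rule that[OF S(1) rep_transfer[OF r S(2)]])
qed

lemma cl_nonempty: "left_module R Y \<Longrightarrow> \<phi> \<in> mod_hom R K Y \<Longrightarrow> \<exists>S. S \<in> cl Y \<phi>"
  by (rule rep_ses_exists[of Y \<phi>]) (auto simp: cl_def)

lemma cl_eq_iff:
  assumes Y: "left_module R Y" and \<phi>: "\<phi> \<in> mod_hom R K Y" "\<phi>' \<in> mod_hom R K Y"
  shows "cl Y \<phi> = cl Y \<phi>' \<longleftrightarrow> extends Y (\<lambda>k. \<phi> k \<ominus>\<^bsub>Y\<^esub> \<phi>' k)"
proof
  obtain S S' where S: "S \<in> cl Y \<phi>" and S': "S' \<in> cl Y \<phi>'" using cl_nonempty[OF Y] \<phi> by metis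
  then have s: "short_exact R Y S X" "rep Y S \<phi>" and s': "short_exact R Y S' X" "rep Y S' \<phi>'"
    by (auto simp: cl_def)
  {
    assume "cl Y \<phi> = cl Y \<phi>'"
    then have "S' \<in> ext_class R X Y S" using ext_class_rep[OF s] S' by simp
    then show "extends Y (\<lambda>k. \<phi> k \<ominus>\<^bsub>Y\<^esub> \<phi>' k)"
      using rep_unique[OF s(1) s'(1) s(2) s'(2)] by (simp add: ext_class_def)
  next
    assume "extends Y (\<lambda>k. \<phi> k \<ominus>\<^bsub>Y\<^esub> \<phi>' k)"
    then have "ses_equiv R Y X S' S" by (rule rep_equiv[OF s'(1) s(1) s'(2) s(2)])
    then have "rep Y S \<phi>'" by (rule rep_transfer[OF s'(2)])
    then show "cl Y \<phi> = cl Y \<phi>'" using ext_class_rep[OF s] ext_class_rep[OF s(1)] by simp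
  }
qed

section \<open>The operations of \<open>Ext1\<close> computed on representing maps\<close>

lemma Ext1_carrier:
  fixes Y :: "('r, 'y) module"
  assumes Y: "left_module R Y"
  shows "carrier (Ext1 R X Y) = cl Y ` mod_hom R K Y"
proof -
  have "ext_class R X Y S \<in> cl Y ` mod_hom R K Y" if S: "short_exact R Y S X" for S :: "('r, 'y, 'y \<times> 'x, 'x) ses"
    using rep_exists[OF S] ext_class_rep[OF S] rep_hom by (metis image_eqI rep_def)
  moreover have "cl Y \<phi> \<in> carrier (Ext1 R X Y)" if \<phi>: "\<phi> \<in> mod_hom R K Y" for \<phi>
  proof -
    obtain S :: "('r, 'y, 'y \<times> 'x, 'x) ses" where S: "short_exact R Y S X" "rep Y S \<phi>"
      by (rule rep_ses_exists[OF Y \<phi>])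
    show ?thesis using S(1) by (auto simp: Ext1_def simp flip: ext_class_rep[OF S])
  qed
  ultimately show ?thesis by (auto simp: Ext1_def)
qed

lemma Ext1_zero_cl:
  assumes Y: "left_module R Y"
  shows "\<zero>\<^bsub>Ext1 R X Y\<^esub> = cl Y (\<lambda>k. \<zero>\<^bsub>Y\<^esub>)"
proof -
  have "rep_by Y (ses_split Y X) (\<lambda>k. \<zero>\<^bsub>Y\<^esub>) (\<lambda>x. (\<zero>\<^bsub>Y\<^esub>, p x))"
    unfolding rep_by_def
    using mod_hom_pair[OF mod_hom_zero_map[OF Y] presD(5)] mod_hom_zero_map[OF Y, of K] presD(10)
    by (simp add: ses_split_def)
  then have "rep Y (ses_split Y X) (\<lambda>k. \<zero>\<^bsub>Y\<^esub>)" by (auto simp: rep_def)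
  then show ?thesis using ext_class_rep[OF short_exact_split[OF Y presD(3)]] by (simp add: Ext1_def)
qed

text \<open>Over the diagonal, \<open>\<psi>\<close> and \<open>\<psi>'\<close> combine with
  \<open>p\<close> to a map from \<open>F\<close> into the pull-back of the product sequence. The
  push-out along addition turns the pair of \<open>\<phi>\<close> and \<open>\<phi>'\<close> into
  their sum.\<close>

lemma rep_baer:
  assumes S: "short_exact R Y S X" "rep Y S \<phi>" and S': "short_exact R Y S' X" "rep Y S' \<phi>'"
  shows "short_exact R Y (baer_sum Y X S S') X" "rep Y (baer_sum Y X S S') (\<lambda>k. \<phi> k \<oplus>\<^bsub>Y\<^esub> \<phi>' k)"
proof -
  note s = short_exactD[OF S(1)]
  obtain \<psi> \<psi>' where r: "rep_by Y S \<phi> \<psi>" and r': "rep_by Y S' \<phi>' \<psi>'" using S S' by (auto simp: rep_def)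
  note rD = rep_byD[OF r] and rD' = rep_byD[OF r']
  let ?\<Delta> = "\<lambda>x. (x, x)"
  have \<Delta>: "?\<Delta> \<in> mod_hom R X (mod_prod X X)" by (rule mod_hom_pair[OF mod_hom_id mod_hom_id])
  define P where "P = ses_pullback (ses_prod S S') X ?\<Delta>"
  have P: "short_exact R (mod_prod Y Y) P X"
    unfolding P_def by (rule short_exact_pullback[OF short_exact_prod[OF S(1) S'(1)] s(3) \<Delta>])
  have plus: "(\<lambda>(y, y'). y \<oplus>\<^bsub>Y\<^esub> y') \<in> mod_hom R (mod_prod Y Y) Y"
    by (rule mod_hom_prod_sum[OF s(1) mod_hom_id mod_hom_id])
  note po = pushout_facts[OF P s(1) plus]
  have b: "baer_sum Y X S S' = ses_pushout (mod_prod Y Y) Y (\<lambda>(y, y'). y \<oplus>\<^bsub>Y\<^esub> y') P"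
    by (simp add: baer_sum_def P_def)
  show "short_exact R Y (baer_sum Y X S S') X" unfolding b by (rule po(1))
  let ?\<psi> = "\<lambda>x. ((\<psi> x, \<psi>' x), p x)"
  have \<psi>: "?\<psi> \<in> mod_hom R F (ses_mid P)"
    by (rule mod_homI) (use rD rD' presD(9) in \<open>auto simp: P_def pullback_simps ses_prod_def
      mod_hom_add[OF rD(2)] mod_hom_add[OF rD'(2)] mod_hom_add[OF presD(5)]
      mod_hom_smult[OF rD(2)] mod_hom_smult[OF rD'(2)] mod_hom_smult[OF presD(5)]\<close>)
  have Pout: "ses_out P = snd" and Pin: "ses_in P (y, y') = ((ses_in S y, ses_in S' y'), \<zero>\<^bsub>X\<^esub>)" for y y'
    by (simp_all add: P_def pullback_simps ses_prod_def)
  have k: "pushout_map (mod_prod Y Y) Y (\<lambda>(y, y'). y \<oplus>\<^bsub>Y\<^esub> y') P (?\<psi> (\<kappa> k)) =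
      ses_in (baer_sum Y X S S') (\<phi> k \<oplus>\<^bsub>Y\<^esub> \<phi>' k)" if "k \<in> carrier K" for k
    using po(3)[of "(\<phi> k, \<phi>' k)"] that rD rD' presD(10) by (simp add: b Pin)
  have "rep_by Y (baer_sum Y X S S') (\<lambda>k. \<phi> k \<oplus>\<^bsub>Y\<^esub> \<phi>' k)
      (\<lambda>x. pushout_map (mod_prod Y Y) Y (\<lambda>(y, y'). y \<oplus>\<^bsub>Y\<^esub> y') P (?\<psi> x))"
    unfolding rep_by_def
  proof (intro conjI ballI k)
    show "(\<lambda>k. \<phi> k \<oplus>\<^bsub>Y\<^esub> \<phi>' k) \<in> mod_hom R K Y" by (rule mod_hom_plus[OF s(1) rD(1) rD'(1)])
    show "(\<lambda>x. pushout_map (mod_prod Y Y) Y (\<lambda>(y, y'). y \<oplus>\<^bsub>Y\<^esub> y') P (?\<psi> x)) \<in> mod_hom R F (ses_mid (baer_sum Y X S S'))"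
      unfolding b by (rule mod_hom_compose[OF \<psi> po(2)])
    show "ses_out (baer_sum Y X S S') (pushout_map (mod_prod Y Y) Y (\<lambda>(y, y'). y \<oplus>\<^bsub>Y\<^esub> y') P (?\<psi> x)) = p x"
      if "x \<in> carrier F" for x
      unfolding b using po(4)[OF mod_hom_closed[OF \<psi> that]] by (simp add: Pout)
  qed
  then show "rep Y (baer_sum Y X S S') (\<lambda>k. \<phi> k \<oplus>\<^bsub>Y\<^esub> \<phi>' k)" by (auto simp: rep_def)
qed

lemma Ext1_add_cl:
  assumes Y: "left_module R Y" and \<phi>: "\<phi> \<in> mod_hom R K Y" and \<phi>': "\<phi>' \<in> mod_hom R K Y"
  shows "cl Y \<phi> \<oplus>\<^bsub>Ext1 R X Y\<^esub> cl Y \<phi>' = cl Y (\<lambda>k. \<phi> k \<oplus>\<^bsub>Y\<^esub> \<phi>' k)"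
proof -
  obtain S S' where S: "S \<in> cl Y \<phi>" "S' \<in> cl Y \<phi>'" using cl_nonempty[OF Y] \<phi> \<phi>' by metis
  have c: "ext_class R X Y (baer_sum Y X S S') = cl Y (\<lambda>k. \<phi> k \<oplus>\<^bsub>Y\<^esub> \<phi>' k)"
    if "S \<in> cl Y \<phi>" "S' \<in> cl Y \<phi>'" for S S'
    using that rep_baer[of Y S \<phi> S' \<phi>'] by (auto simp: cl_def[of Y \<phi>] cl_def[of Y \<phi>'] intro!: ext_class_rep)
  have "(\<Union>S\<in>cl Y \<phi>. \<Union>S'\<in>cl Y \<phi>'. ext_class R X Y (baer_sum Y X S S')) = cl Y (\<lambda>k. \<phi> k \<oplus>\<^bsub>Y\<^esub> \<phi>' k)"
    by (intro UN_eq_const[OF S(1)] UN_eq_const[OF S(2)] c)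
  then show ?thesis by (simp add: Ext1_def)
qed

text \<open>The comparison map of resolutions over \<open>h\<close>: it is lifted on the projective
  module \<open>F\<close> and then restricted to the kernels.\<close>

lemma lift_endo:
  assumes h: "h \<in> mod_hom R X X"
  obtains c c' where "c \<in> mod_hom R F F" "c' \<in> mod_hom R K K" "\<And>x. x \<in> carrier F \<Longrightarrow> p (c x) = h (p x)"
    "\<And>k. k \<in> carrier K \<Longrightarrow> \<kappa> (c' k) = c (\<kappa> k)"
proof -
  obtain c where c: "c \<in> mod_hom R F F" "\<And>x. x \<in> carrier F \<Longrightarrow> p (c x) = h (p x)"
    using retract_of_free_lift[OF retract_T presD(2,3,5,7) mod_hom_compose[OF presD(5) h]] by blast
  have "c (\<kappa> k) \<in> \<kappa> ` carrier K" if "k \<in> carrier K" for k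
    by (rule short_exact_kernel[OF exact_T])
      (use that c presD mod_hom_closed[OF c(1)] mod_hom_zero[OF h presD(3,3)] in auto)
  then obtain c' where "c' \<in> mod_hom R K K" "\<And>k. k \<in> carrier K \<Longrightarrow> \<kappa> (c' k) = c (\<kappa> k)"
    using mod_hom_through_inj[OF presD(1,1,2,4,6) mod_hom_compose[OF presD(4) c(1)]] by blast
  with c show thesis by (intro that)
qed

text \<open>The composite of \<open>c\<close> and \<open>\<psi>\<close> lies over \<open>h\<close>,
  so paired with \<open>p\<close> it maps \<open>F\<close> into the pull-back; on \<open>K\<close>
  it is \<open>\<phi>\<close> after \<open>c'\<close>.\<close>

lemma Ext1_smult_cl:
  assumes Y: "left_module R Y" and h: "h \<in> mod_hom R X X" and \<phi>: "\<phi> \<in> mod_hom R K Y"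
    and c: "c \<in> mod_hom R F F" "c' \<in> mod_hom R K K" "\<And>x. x \<in> carrier F \<Longrightarrow> p (c x) = h (p x)"
      "\<And>k. k \<in> carrier K \<Longrightarrow> \<kappa> (c' k) = c (\<kappa> k)"
  shows "h \<odot>\<^bsub>Ext1 R X Y\<^esub> cl Y \<phi> = cl Y (\<lambda>k. \<phi> (c' k))"
proof -
  have e: "ext_class R X Y (ses_pullback S X h) = cl Y (\<lambda>k. \<phi> (c' k))" if S: "S \<in> cl Y \<phi>" for S
  proof (rule ext_class_rep)
    have s: "short_exact R Y S X" using S by (simp add: cl_def)
    then show "short_exact R Y (ses_pullback S X h) X" using h presD(3) by (intro short_exact_pullback)
    obtain \<psi> where r: "rep_by Y S \<phi> \<psi>" using S by (auto simp: rep_def cl_def)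
    note rD = rep_byD[OF r]
    have \<psi>: "(\<lambda>x. (\<psi> (c x), p x)) \<in> mod_hom R F (ses_mid (ses_pullback S X h))"
      by (rule mod_homI) (use rD presD(9) c(3) mod_hom_closed[OF c(1)] in \<open>auto simp: pullback_simps
        mod_hom_add[OF rD(2)] mod_hom_add[OF c(1)] mod_hom_add[OF presD(5)]
        mod_hom_smult[OF rD(2)] mod_hom_smult[OF c(1)] mod_hom_smult[OF presD(5)]\<close>)
    have "\<psi> (c (\<kappa> k)) = ses_in S (\<phi> (c' k))" if "k \<in> carrier K" for k
      using rD(4)[OF mod_hom_closed[OF c(2) that]] c(4)[OF that] by simp
    then have "rep_by Y (ses_pullback S X h) (\<lambda>k. \<phi> (c' k)) (\<lambda>x. (\<psi> (c x), p x))"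
      using \<psi> mod_hom_compose[OF c(2) \<phi>] presD(10) by (simp add: rep_by_def pullback_simps)
    then show "rep Y (ses_pullback S X h) (\<lambda>k. \<phi> (c' k))" by (auto simp: rep_def)
  qed
  obtain S where "S \<in> cl Y \<phi>" using cl_nonempty[OF Y \<phi>] by blast
  then have "(\<Union>S\<in>cl Y \<phi>. ext_class R X Y (ses_pullback S X h)) = cl Y (\<lambda>k. \<phi> (c' k))"
    by (rule UN_eq_const) (rule e)
  then show ?thesis by (simp add: Ext1_def)
qed

text \<open>\<open>module_basis\<close> speaks of finite sums in \<open>Ext1\<close>, and these are
  unfolded one summand at a time by the laws of an abelian monoid.\<close>

lemma abelian_monoid_Ext1:
  assumes Y: "left_module R Y"
  shows "abelian_monoid (Ext1 R X Y)"
proof -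
  note c = Ext1_carrier[OF Y] and a = Ext1_add_cl[OF Y] and z = Ext1_zero_cl[OF Y]
  note pl = mod_hom_plus[OF Y] and zm = mod_hom_zero_map[OF Y, of K]
  have cong: "cl Y \<phi> = cl Y \<phi>'" if "\<phi> \<in> mod_hom R K Y" "\<phi>' \<in> mod_hom R K Y" "\<And>k. k \<in> carrier K \<Longrightarrow> \<phi> k = \<phi>' k" for \<phi> \<phi>'
    unfolding cl_eq_iff[OF Y that(1,2)]
    by (rule extends_cong[OF extends_zero[OF Y]]) (use that mod_hom_closed[OF that(2)] Y in \<open>simp del: module_diff_zero_iff\<close>)
  show ?thesis
  proof (rule abelian_monoidI)
    show "\<zero>\<^bsub>Ext1 R X Y\<^esub> \<in> carrier (Ext1 R X Y)" unfolding c z using zm by blast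
    fix A B assume "A \<in> carrier (Ext1 R X Y)" "B \<in> carrier (Ext1 R X Y)"
    then obtain \<phi> \<phi>' where p: "\<phi> \<in> mod_hom R K Y" "A = cl Y \<phi>" "\<phi>' \<in> mod_hom R K Y" "B = cl Y \<phi>'" unfolding c by blast
    show "A \<oplus>\<^bsub>Ext1 R X Y\<^esub> B \<in> carrier (Ext1 R X Y)" unfolding c p(2,4) a[OF p(1,3)] using pl[OF p(1,3)] by blast
    show "A \<oplus>\<^bsub>Ext1 R X Y\<^esub> B = B \<oplus>\<^bsub>Ext1 R X Y\<^esub> A" unfolding p(2,4) a[OF p(1,3)] a[OF p(3,1)]
      by (rule cong) (use p pl Y in \<open>simp_all add: mod_hom_closed module_add_comm\<close>)
    show "\<zero>\<^bsub>Ext1 R X Y\<^esub> \<oplus>\<^bsub>Ext1 R X Y\<^esub> A = A" unfolding p(2) z a[OF zm p(1)]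
      by (rule cong) (use p pl[OF zm p(1)] Y in \<open>simp_all add: mod_hom_closed[OF p(1)]\<close>)
    fix C assume "C \<in> carrier (Ext1 R X Y)"
    then obtain \<phi>'' where q: "\<phi>'' \<in> mod_hom R K Y" "C = cl Y \<phi>''" unfolding c by blast
    show "A \<oplus>\<^bsub>Ext1 R X Y\<^esub> B \<oplus>\<^bsub>Ext1 R X Y\<^esub> C = A \<oplus>\<^bsub>Ext1 R X Y\<^esub> (B \<oplus>\<^bsub>Ext1 R X Y\<^esub> C)"
      unfolding p(2,4) q(2) a[OF p(1,3)] a[OF p(3) q(1)] a[OF pl[OF p(1,3)] q(1)] a[OF p(1) pl[OF p(3) q(1)]]
      by (rule cong[OF pl[OF pl[OF p(1,3)] q(1)] pl[OF p(1) pl[OF p(3) q(1)]]])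
        (use Y in \<open>simp add: mod_hom_closed[OF p(1)] mod_hom_closed[OF p(3)] mod_hom_closed[OF q(1)] module_add_assoc\<close>)
  qed
qed

text \<open>Together with \<open>Hom_zero_iff\<close> this encodes the exact sequence
  \<open>0 -> Hom(X, Y) -> Hom(F, Y) -> Hom(K, Y) -> Ext^1(X, Y) -> 0\<close>. The two conditions
  say that restriction along \<open>\<kappa>\<close> is onto, respectively one-to-one.\<close>

lemma Ext1_zero_iff:
  assumes Y: "left_module R Y"
  shows "Ext1_zero R X Y \<longleftrightarrow> (\<forall>\<phi>\<in>mod_hom R K Y. extends Y \<phi>)"
proof -
  have zm: "(\<lambda>k. \<zero>\<^bsub>Y\<^esub>) \<in> mod_hom R K Y" using mod_hom_zero_map[OF Y] .
  have "extends Y (\<lambda>k. \<phi> k \<ominus>\<^bsub>Y\<^esub> \<zero>\<^bsub>Y\<^esub>) \<longleftrightarrow> extends Y \<phi>" if "\<phi> \<in> mod_hom R K Y" for \<phi>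
    using mod_hom_closed[OF that] Y by (auto simp: extends_def)
  then have "cl Y \<phi> = cl Y (\<lambda>k. \<zero>\<^bsub>Y\<^esub>) \<longleftrightarrow> extends Y \<phi>" if "\<phi> \<in> mod_hom R K Y" for \<phi>
    using cl_eq_iff[OF Y that zm] that by simp
  moreover have "cl Y ` mod_hom R K Y = {cl Y (\<lambda>k. \<zero>\<^bsub>Y\<^esub>)} \<longleftrightarrow> (\<forall>\<phi>\<in>mod_hom R K Y. cl Y \<phi> = cl Y (\<lambda>k. \<zero>\<^bsub>Y\<^esub>))"
    using zm by auto
  ultimately show ?thesis
    unfolding Ext1_zero_def Ext1_carrier[OF Y] Ext1_zero_cl[OF Y] by simp
qed

lemma Hom_zero_iff:
  assumes Y: "left_module R Y"
  shows "Hom_zero R X Y \<longleftrightarrow>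
    (\<forall>\<theta>\<in>mod_hom R F Y. (\<forall>k\<in>carrier K. \<theta> (\<kappa> k) = \<zero>\<^bsub>Y\<^esub>) \<longrightarrow> (\<forall>x\<in>carrier F. \<theta> x = \<zero>\<^bsub>Y\<^esub>))"
proof (intro iffI ballI impI)
  fix \<theta> x assume H: "Hom_zero R X Y" and \<theta>: "\<theta> \<in> mod_hom R F Y" "\<forall>k\<in>carrier K. \<theta> (\<kappa> k) = \<zero>\<^bsub>Y\<^esub>" and x: "x \<in> carrier F"
  have "\<theta> a = \<zero>\<^bsub>Y\<^esub>" if "a \<in> carrier F" "p a = \<zero>\<^bsub>X\<^esub>" for a
    using short_exact_kernel[OF exact_T that] \<theta>(2) by auto
  then obtain G where G: "G \<in> mod_hom R X Y" "\<And>a. a \<in> carrier F \<Longrightarrow> G (p a) = \<theta> a"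
    using mod_hom_through_surj[OF presD(2,3) Y presD(5,7) \<theta>(1)] by blast
  then have "G (p x) = \<zero>\<^bsub>Y\<^esub>" using H x presD(9) by (auto simp: Hom_zero_def)
  then show "\<theta> x = \<zero>\<^bsub>Y\<^esub>" using G x by simp
next
  assume H: "\<forall>\<theta>\<in>mod_hom R F Y. (\<forall>k\<in>carrier K. \<theta> (\<kappa> k) = \<zero>\<^bsub>Y\<^esub>) \<longrightarrow> (\<forall>x\<in>carrier F. \<theta> x = \<zero>\<^bsub>Y\<^esub>)"
  show "Hom_zero R X Y" unfolding Hom_zero_def
  proof (intro ballI)
    fix h x assume h: "h \<in> mod_hom R X Y" and x: "x \<in> carrier X"
    obtain a where a: "a \<in> carrier F" "p a = x" using short_exact_preimage[OF exact_T x] by blast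
    have "h (p a) = \<zero>\<^bsub>Y\<^esub>"
      using H[rule_format, OF mod_hom_compose[OF presD(5) h] _ a(1)] presD(10) mod_hom_zero[OF h presD(3) Y] by simp
    then show "h x = \<zero>\<^bsub>Y\<^esub>" using a by simp
  qed
qed

end

section \<open>Universal sequences\<close>

context base_ring
begin

lemma dsum_single_map:
  assumes "\<And>k. k \<in> K \<Longrightarrow> f k \<zero>\<^bsub>A k\<^esub> = \<zero>\<^bsub>B k\<^esub>"
  shows "(\<lambda>j\<in>K. f j (dsum_single K A k x j)) = dsum_single K B k (f k x)"
  using assms by (auto simp: dsum_single_def fun_eq_iff)

text \<open>Besides exactness and the basis property, these four facts are all that is used of a
  universal sequence: each chosen extension maps into it over \<open>Y\<close>, with outgoing part
  in a single coordinate, and maps out of the chosen extensions that agree on \<open>Y\<close>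
  extend to it.\<close>

lemma universal_ses_components:
  assumes U: "universal_ses R \<X> Y I E U"
  obtains \<epsilon> where
    "\<And>X i. X \<in> \<X> \<Longrightarrow> i \<in> I X \<Longrightarrow> \<epsilon> X i \<in> mod_hom R (ses_mid (E X i)) (ses_mid U)"
    "\<And>X i y. X \<in> \<X> \<Longrightarrow> i \<in> I X \<Longrightarrow> y \<in> carrier Y \<Longrightarrow> \<epsilon> X i (ses_in (E X i) y) = ses_in U y"
    "\<And>X i m. X \<in> \<X> \<Longrightarrow> i \<in> I X \<Longrightarrow> m \<in> carrier (ses_mid (E X i)) \<Longrightarrow>
       ses_out U (\<epsilon> X i m) = dsum_single (Sigma \<X> I) fst (X, i) (ses_out (E X i) m)"
    "\<And>(W :: ('r, 'w) module) h g. left_module R W \<Longrightarrow> h \<in> mod_hom R Y W \<Longrightarrow>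
       (\<And>X i. X \<in> \<X> \<Longrightarrow> i \<in> I X \<Longrightarrow> g X i \<in> mod_hom R (ses_mid (E X i)) W) \<Longrightarrow>
       (\<And>X i y. X \<in> \<X> \<Longrightarrow> i \<in> I X \<Longrightarrow> y \<in> carrier Y \<Longrightarrow> g X i (ses_in (E X i) y) = h y) \<Longrightarrow>
       \<exists>G\<in>mod_hom R (ses_mid U) W. \<forall>y\<in>carrier Y. G (ses_in U y) = h y"
proof -
  let ?K = "Sigma \<X> I" and ?S = "\<lambda>(X, i). E X i" and ?Z = "\<lambda>_. Y"
  let ?D = "ses_dsum ?K ?S" and ?\<Sigma> = "summation_map ?K Y"
  let ?Mk = "\<lambda>k. ses_mid (?S k)"
  have E: "short_exact R (?Z k) (?S k) (fst k)" if "k \<in> ?K" for k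
    using that U by (auto simp: universal_ses_def)
  note e = short_exactD[OF E]
  have exU: "short_exact R Y U (mod_dsum ?K fst)" using U by (simp add: universal_ses_def)
  note u = short_exactD[OF exU]
  have D: "short_exact R (mod_dsum ?K ?Z) ?D (mod_dsum ?K fst)" by (rule short_exact_dsum[OF E])
  note d = short_exactD[OF D]
  have \<Sigma>: "?\<Sigma> \<in> mod_hom R (mod_dsum ?K ?Z) Y"
    using dsum_sum_hom[where F = ?Z and K = ?K and W = Y and g = "\<lambda>_ y. y", OF u(1) u(1) mod_hom_id]
    by (simp add: summation_map_def[abs_def] dsum_sum_def[abs_def])
  have \<Sigma>_single: "?\<Sigma> (dsum_single ?K ?Z k y) = y" if "k \<in> ?K" "y \<in> carrier Y" for k y
    using dsum_sum_single[where F = ?Z and K = ?K and W = Y and g = "\<lambda>_ y. y", OF u(1) u(1) mod_hom_id that]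
    by (simp add: summation_map_def dsum_sum_def)
  define P where "P = ses_pushout (mod_dsum ?K ?Z) Y ?\<Sigma> ?D"
  define j where "j = pushout_map (mod_dsum ?K ?Z) Y ?\<Sigma> ?D"
  note po = pushout_facts[OF D u(1) \<Sigma>, folded P_def j_def]
  have eqU: "ses_equiv R Y (mod_dsum ?K fst) P U" using U by (simp add: universal_ses_def P_def)
  \<comment> \<open>\<open>U\<close> is universal only up to equivalence, so everything proved for
    the push-out \<open>P\<close> is carried over by \<open>G0\<close>.\<close>
  obtain G0 where G0: "G0 \<in> mod_hom R (ses_mid P) (ses_mid U)"
    "\<And>y. y \<in> carrier Y \<Longrightarrow> G0 (ses_in P y) = ses_in U y"
    "\<And>m. m \<in> carrier (ses_mid P) \<Longrightarrow> ses_out U (G0 m) = ses_out P m" using ses_equivE[OF eqU] by blast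
  have isoG: "G0 \<in> mod_iso R (ses_mid P) (ses_mid U)" by (rule ses_map_iso[OF po(1) exU G0])
  have midD: "ses_mid ?D = mod_dsum ?K ?Mk" by (simp add: ses_dsum_def)
  have single: "dsum_single ?K ?Mk k \<in> mod_hom R (?Mk k) (ses_mid ?D)" if "k \<in> ?K" for k
    unfolding midD by (rule dsum_single_hom[OF e(2) that])
  have single_in: "dsum_single ?K ?Mk k (ses_in (?S k) y) = ses_in ?D (dsum_single ?K ?Z k y)" for k y
    using dsum_single_map[where K = ?K and A = ?Z and B = ?Mk and f = "\<lambda>k. ses_in (?S k)" and k = k and x = y]
      mod_hom_zero[OF e(4,1,2)] by (simp add: ses_dsum_def)
  have single_out: "ses_out ?D (dsum_single ?K ?Mk k m) = dsum_single ?K fst k (ses_out (?S k) m)" for k m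
    using dsum_single_map[where K = ?K and A = ?Mk and B = fst and f = "\<lambda>k. ses_out (?S k)" and k = k and x = m]
      mod_hom_zero[OF e(5,2,3)] by (simp add: ses_dsum_def)
  define \<epsilon> where "\<epsilon> X i m = G0 (j (dsum_single ?K ?Mk (X, i) m))" for X i m
  show thesis
  proof (rule that[of \<epsilon>])
    fix X i assume "X \<in> \<X>" "i \<in> I X"
    then have k: "(X, i) \<in> ?K" by simp
    show "\<epsilon> X i \<in> mod_hom R (ses_mid (E X i)) (ses_mid U)"
      using mod_hom_compose[OF mod_hom_compose[OF single[OF k] po(2)] G0(1)] by (simp add: \<epsilon>_def[abs_def])
    show "\<epsilon> X i (ses_in (E X i) y) = ses_in U y" if y: "y \<in> carrier Y" for y
    proof -
      have "dsum_single ?K ?Z (X, i) y \<in> carrier (mod_dsum ?K ?Z)"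
        by (rule dsum_single_closed) (use u(1) k y in auto)
      then show ?thesis
        using single_in[of "(X, i)" y] po(3) G0(2)[OF y] \<Sigma>_single[OF k y] by (simp add: \<epsilon>_def)
    qed
    show "ses_out U (\<epsilon> X i m) = dsum_single ?K fst (X, i) (ses_out (E X i) m)"
      if m: "m \<in> carrier (ses_mid (E X i))" for m
    proof -
      have c: "dsum_single ?K ?Mk (X, i) m \<in> carrier (ses_mid ?D)" using mod_hom_closed[OF single[OF k]] m by simp
      then show ?thesis
        using G0(3)[OF mod_hom_closed[OF po(2) c]] po(4)[OF c] single_out[of "(X, i)" m] by (simp add: \<epsilon>_def)
    qed
  next
    fix W :: "('r, 'w) module" and h g
    assume W: "left_module R W" and h: "h \<in> mod_hom R Y W"
      and g: "\<And>X i. X \<in> \<X> \<Longrightarrow> i \<in> I X \<Longrightarrow> g X i \<in> mod_hom R (ses_mid (E X i)) W"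
      and gin: "\<And>X i y. X \<in> \<X> \<Longrightarrow> i \<in> I X \<Longrightarrow> y \<in> carrier Y \<Longrightarrow> g X i (ses_in (E X i) y) = h y"
    let ?g = "\<lambda>k. g (fst k) (snd k)"
    let ?\<rho> = "dsum_sum ?K ?Mk W ?g"
    have gk: "?g k \<in> mod_hom R (?Mk k) W" if "k \<in> ?K" for k using g that by auto
    have \<rho>: "?\<rho> \<in> mod_hom R (ses_mid ?D) W"
      unfolding midD by (rule dsum_sum_hom[OF e(2) W gk])
    \<comment> \<open>On a one-coordinate element the summation map is the identity of
      \<open>Y\<close>, and there the claim is that \<open>g X i\<close> restricts to
      \<open>h\<close>.\<close>
    have eq: "?\<rho> (ses_in ?D z) = h (?\<Sigma> z)" if z: "z \<in> carrier (mod_dsum ?K ?Z)" for z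
    proof (rule dsum_hom_eqI[OF _ W mod_hom_compose[OF d(4) \<rho>] mod_hom_compose[OF \<Sigma> h] _ z])
      fix k y assume k: "k \<in> ?K" and y: "y \<in> carrier Y"
      show "?\<rho> (ses_in ?D (dsum_single ?K ?Z k y)) = h (?\<Sigma> (dsum_single ?K ?Z k y))"
        unfolding single_in[symmetric] \<Sigma>_single[OF k y]
        using dsum_sum_single[where K = ?K and F = ?Mk and g = ?g, OF e(2) W gk k e(8)[OF k y]] gin k y by auto
    qed (rule u(1))
    \<comment> \<open>The direct sum of the chosen sequences now plays the part of the presentation,
      and the push-out \<open>P\<close> is represented by the summation map, so \<open>glue\<close>
      applies.\<close>
    interpret PP: presentation R "mod_dsum ?K ?Z" ?D "mod_dsum ?K fst"
      by unfold_locales (rule D)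
    have rep: "PP.rep_by Y P ?\<Sigma> j" unfolding PP.rep_by_def using po \<Sigma> by blast
    obtain G where G: "G \<in> mod_hom R (ses_mid P) W" "\<And>y. y \<in> carrier Y \<Longrightarrow> G (ses_in P y) = h y"
      by (rule PP.glue[OF po(1) rep W h \<rho> eq]) (assumption, rule that)
    obtain G1 where G1: "G1 \<in> mod_iso R (ses_mid U) (ses_mid P)" "\<And>x. x \<in> carrier (ses_mid P) \<Longrightarrow> G1 (G0 x) = x"
      by (rule mod_iso_inverse[OF isoG short_exactD(2)[OF po(1)] u(2)]) (rule that)
    show "\<exists>G\<in>mod_hom R (ses_mid U) W. \<forall>y\<in>carrier Y. G (ses_in U y) = h y"
    proof (intro bexI ballI)
      show "(\<lambda>m. G (G1 m)) \<in> mod_hom R (ses_mid U) W"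
        using G1 by (intro mod_hom_compose[OF _ G(1)]) (simp add: mod_iso_def)
      show "G (G1 (ses_in U y)) = h y" if y: "y \<in> carrier Y" for y
        unfolding G0(2)[OF y, symmetric] G1(2)[OF short_exactD(8)[OF po(1) y]] by (rule G(2)[OF y])
    qed
  qed
qed

text \<open>The difference of two such maps factors through the direct sum of members of
  \<open>\<X>\<close>, each of which has only the zero map to \<open>W\<close>.\<close>

lemma universal_ses_hom_unique:
  assumes U: "short_exact R Y U (mod_dsum (Sigma \<X> I) fst)" and X: "\<And>X. X \<in> \<X> \<Longrightarrow> left_module R X"
    and W: "left_module R W" "\<And>X. X \<in> \<X> \<Longrightarrow> Hom_zero R X W"
    and f: "f \<in> mod_hom R (ses_mid U) W" and g: "g \<in> mod_hom R (ses_mid U) W"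
    and eq: "\<And>y. y \<in> carrier Y \<Longrightarrow> f (ses_in U y) = g (ses_in U y)"
    and m: "m \<in> carrier (ses_mid U)"
  shows "f m = g m"
proof -
  note u = short_exactD[OF U]
  let ?K = "Sigma \<X> I" and ?d = "\<lambda>m. f m \<ominus>\<^bsub>W\<^esub> g m"
  have d: "?d \<in> mod_hom R (ses_mid U) W" by (rule mod_hom_minus[OF W(1) f g])
  have "?d a = \<zero>\<^bsub>W\<^esub>" if "a \<in> carrier (ses_mid U)" "ses_out U a = \<zero>\<^bsub>mod_dsum ?K fst\<^esub>" for a
    using short_exact_kernel[OF U that] eq W(1) mod_hom_closed[OF g] u(8) by auto
  then obtain \<delta> where \<delta>: "\<delta> \<in> mod_hom R (mod_dsum ?K fst) W" "\<And>a. a \<in> carrier (ses_mid U) \<Longrightarrow> \<delta> (ses_out U a) = ?d a"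
    using mod_hom_through_surj[OF u(2,3) W(1) u(5,7) d] by blast
  have fm: "left_module R (fst k)" if "k \<in> ?K" for k using that X by auto
  have "\<delta> z = \<zero>\<^bsub>W\<^esub>" if z: "z \<in> carrier (mod_dsum ?K fst)" for z
  proof (rule dsum_hom_eqI[OF fm W(1) \<delta>(1) mod_hom_zero_map[OF W(1)] _ z])
    fix k x assume k: "k \<in> ?K" and x: "x \<in> carrier (fst k)"
    have "(\<lambda>x. \<delta> (dsum_single ?K fst k x)) \<in> mod_hom R (fst k) W"
      by (rule mod_hom_compose[OF dsum_single_hom[OF fm k] \<delta>(1)])
    then show "\<delta> (dsum_single ?K fst k x) = \<zero>\<^bsub>W\<^esub>"
      using W(2)[of "fst k"] k x by (auto simp: Hom_zero_def)
  qed
  then have "?d m = \<zero>\<^bsub>W\<^esub>" using \<delta>(2)[OF m] u(9)[OF m] by simp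
  then show ?thesis using W(1) mod_hom_closed[OF f m] mod_hom_closed[OF g m] by simp
qed

end

section \<open>The connecting map of a universal sequence\<close>

context proj_presentation
begin

text \<open>This computes the connecting map. The tuple \<open>c\<close> is a map from
  \<open>X\<close> to the direct sum; \<open>\<Omega>\<close> lifts its composite with
  \<open>p\<close> to the middle term of \<open>U\<close>, and the restriction \<open>\<Phi>\<close>
  of \<open>\<Omega>\<close> to \<open>K\<close> represents the image in \<open>Ext^1(X, Y)\<close>,
  which is the combination of the basis classes. Both halves of the basis property are exploited
  through it.\<close>

lemma universal_combination:
  assumes U: "universal_ses R \<X> Y I E U" and X: "X \<in> \<X>" and \<X>: "\<And>X. X \<in> \<X> \<Longrightarrow> left_module R X"
    and J: "finite J'" "J' \<subseteq> I X" "c \<in> J' \<rightarrow> carrier (endo_ring R X)"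
  shows "\<exists>\<Phi>\<in>mod_hom R K Y. \<exists>\<Omega>\<in>mod_hom R F (ses_mid U).
    (\<Oplus>\<^bsub>Ext1 R X Y\<^esub>i\<in>J'. c i \<odot>\<^bsub>Ext1 R X Y\<^esub> ext_class R X Y (E X i)) = cl Y \<Phi> \<and>
    (\<forall>k\<in>carrier K. \<Omega> (\<kappa> k) = ses_in U (\<Phi> k)) \<and>
    (\<forall>x\<in>carrier F. \<forall>X'\<in>\<X>. \<forall>i\<in>I X'.
      ses_out U (\<Omega> x) (X', i) = (if X' = X \<and> i \<in> J' then c i (p x) else \<zero>\<^bsub>X'\<^esub>))"
proof -
  have exU: "short_exact R Y U (mod_dsum (Sigma \<X> I) fst)" using U by (simp add: universal_ses_def)
  note u = short_exactD[OF exU]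
  obtain \<epsilon> where \<epsilon>:
    "\<And>X i. X \<in> \<X> \<Longrightarrow> i \<in> I X \<Longrightarrow> \<epsilon> X i \<in> mod_hom R (ses_mid (E X i)) (ses_mid U)"
    "\<And>X i y. X \<in> \<X> \<Longrightarrow> i \<in> I X \<Longrightarrow> y \<in> carrier Y \<Longrightarrow> \<epsilon> X i (ses_in (E X i) y) = ses_in U y"
    "\<And>X i m. X \<in> \<X> \<Longrightarrow> i \<in> I X \<Longrightarrow> m \<in> carrier (ses_mid (E X i)) \<Longrightarrow>
       ses_out U (\<epsilon> X i m) = dsum_single (Sigma \<X> I) fst (X, i) (ses_out (E X i) m)"
    by (rule universal_ses_components[OF U]) (rule that)
  interpret V: abelian_monoid "Ext1 R X Y" by (rule abelian_monoid_Ext1[OF u(1)])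
  show ?thesis using J
  proof (induction J' rule: finite_induct)
    case empty
    show ?case
    proof (intro bexI[of _ "\<lambda>k. \<zero>\<^bsub>Y\<^esub>"] bexI[of _ "\<lambda>x. \<zero>\<^bsub>ses_mid U\<^esub>"] conjI ballI)
      show "(\<Oplus>\<^bsub>Ext1 R X Y\<^esub>i\<in>{}. c i \<odot>\<^bsub>Ext1 R X Y\<^esub> ext_class R X Y (E X i)) = cl Y (\<lambda>k. \<zero>\<^bsub>Y\<^esub>)"
        using Ext1_zero_cl[OF u(1)] by simp
    qed (use u mod_hom_zero[OF u(4,1,2)] mod_hom_zero[OF u(5,2,3)] mod_hom_zero_map in \<open>auto simp: dsum_zero\<close>)
  next
    case (insert a J')
    then obtain \<Phi> \<Omega> where \<Phi>: "\<Phi> \<in> mod_hom R K Y" and \<Omega>: "\<Omega> \<in> mod_hom R F (ses_mid U)"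
      and sum: "(\<Oplus>\<^bsub>Ext1 R X Y\<^esub>i\<in>J'. c i \<odot>\<^bsub>Ext1 R X Y\<^esub> ext_class R X Y (E X i)) = cl Y \<Phi>"
      and \<Omega>\<kappa>: "\<And>k. k \<in> carrier K \<Longrightarrow> \<Omega> (\<kappa> k) = ses_in U (\<Phi> k)"
      and \<Omega>out: "\<And>x X' i. x \<in> carrier F \<Longrightarrow> X' \<in> \<X> \<Longrightarrow> i \<in> I X' \<Longrightarrow>
        ses_out U (\<Omega> x) (X', i) = (if X' = X \<and> i \<in> J' then c i (p x) else \<zero>\<^bsub>X'\<^esub>)" by auto
    have E: "short_exact R Y (E X i) X" if "i \<in> I X" for i using U X that by (auto simp: universal_ses_def)
    \<comment> \<open>Splitting off a summand of the finite sum demands that all summands are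
      classes; an endomorphism acts on classes through its lift to the presentation.\<close>
    have smult_cl: "c i \<odot>\<^bsub>Ext1 R X Y\<^esub> ext_class R X Y (E X i) \<in> carrier (Ext1 R X Y)" if i: "i \<in> insert a J'" for i
    proof -
      have iI: "i \<in> I X" and ci: "c i \<in> mod_hom R X X" using insert.prems i by (auto simp: endo_ring_def)
      obtain \<phi> \<psi> where r: "rep_by Y (E X i) \<phi> \<psi>" using rep_exists[OF E[OF iI]] by blast
      obtain b b' where b: "b \<in> mod_hom R F F" "b' \<in> mod_hom R K K" "\<And>x. x \<in> carrier F \<Longrightarrow> p (b x) = c i (p x)"
        "\<And>k. k \<in> carrier K \<Longrightarrow> \<kappa> (b' k) = b (\<kappa> k)" using lift_endo[OF ci] by blast
      have "ext_class R X Y (E X i) = cl Y \<phi>" using r by (intro ext_class_rep[OF E[OF iI]]) (auto simp: rep_def)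
      then show ?thesis
        using Ext1_smult_cl[OF u(1) ci rep_byD(1)[OF r] b] mod_hom_compose[OF b(2) rep_byD(1)[OF r]]
        by (simp add: Ext1_carrier[OF u(1)])
    qed
    have aI: "a \<in> I X" and ca: "c a \<in> mod_hom R X X" using insert.prems by (auto simp: endo_ring_def)
    obtain \<phi> \<psi> where r: "rep_by Y (E X a) \<phi> \<psi>" using rep_exists[OF E[OF aI]] by blast
    note rD = rep_byD[OF r]
    obtain b b' where b: "b \<in> mod_hom R F F" "b' \<in> mod_hom R K K" "\<And>x. x \<in> carrier F \<Longrightarrow> p (b x) = c a (p x)"
      "\<And>k. k \<in> carrier K \<Longrightarrow> \<kappa> (b' k) = b (\<kappa> k)" using lift_endo[OF ca] by blast
    have cla: "c a \<odot>\<^bsub>Ext1 R X Y\<^esub> ext_class R X Y (E X a) = cl Y (\<lambda>k. \<phi> (b' k))"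
    proof -
      have "rep Y (E X a) \<phi>" using r by (auto simp: rep_def)
      then show ?thesis using Ext1_smult_cl[OF u(1) ca rD(1) b] ext_class_rep[OF E[OF aI]] by simp
    qed
    have \<phi>b: "(\<lambda>k. \<phi> (b' k)) \<in> mod_hom R K Y" by (rule mod_hom_compose[OF b(2) rD(1)])
    \<comment> \<open>The contribution of the index \<open>a\<close>: \<open>b\<close> lifts the
      coefficient \<open>c a\<close> to \<open>F\<close>, \<open>\<psi>\<close> enters the extension
      \<open>E X a\<close>, and \<open>\<epsilon>\<close> carries that into
      \<open>U\<close>.\<close>
    let ?w = "\<lambda>x. \<epsilon> X a (\<psi> (b x))"
    have w: "?w \<in> mod_hom R F (ses_mid U)"
      by (rule mod_hom_compose[OF mod_hom_compose[OF b(1) rD(2)] \<epsilon>(1)[OF X aI]])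
    show ?case
    proof (intro bexI[of _ "\<lambda>k. \<phi> (b' k) \<oplus>\<^bsub>Y\<^esub> \<Phi> k"] bexI[of _ "\<lambda>x. ?w x \<oplus>\<^bsub>ses_mid U\<^esub> \<Omega> x"] conjI ballI)
      show "(\<Oplus>\<^bsub>Ext1 R X Y\<^esub>i\<in>insert a J'. c i \<odot>\<^bsub>Ext1 R X Y\<^esub> ext_class R X Y (E X i)) =
          cl Y (\<lambda>k. \<phi> (b' k) \<oplus>\<^bsub>Y\<^esub> \<Phi> k)"
        using insert.hyps smult_cl Ext1_add_cl[OF u(1) \<phi>b \<Phi>]
        by (subst V.finsum_insert) (auto simp: sum, auto simp: cla)
      show "(\<lambda>x. ?w x \<oplus>\<^bsub>ses_mid U\<^esub> \<Omega> x) \<in> mod_hom R F (ses_mid U)" by (rule mod_hom_plus[OF u(2) w \<Omega>])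
      show "(\<lambda>k. \<phi> (b' k) \<oplus>\<^bsub>Y\<^esub> \<Phi> k) \<in> mod_hom R K Y" by (rule mod_hom_plus[OF u(1) \<phi>b \<Phi>])
      fix k assume k: "k \<in> carrier K"
      have "?w (\<kappa> k) = ses_in U (\<phi> (b' k))"
        using k rD(4,5) b(4)[OF k] mod_hom_closed[OF b(2)] \<epsilon>(2)[OF X aI] by (simp flip: b(4))
      then show "?w (\<kappa> k) \<oplus>\<^bsub>ses_mid U\<^esub> \<Omega> (\<kappa> k) = ses_in U (\<phi> (b' k) \<oplus>\<^bsub>Y\<^esub> \<Phi> k)"
        using k \<Omega>\<kappa> mod_hom_closed[OF \<Phi>] mod_hom_closed[OF \<phi>b] by (simp add: mod_hom_add[OF u(4)])
    next
      fix x X' i assume x: "x \<in> carrier F" and X': "X' \<in> \<X>" and i: "i \<in> I X'"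
      have wo: "ses_out U (?w x) = dsum_single (Sigma \<X> I) fst (X, a) (c a (p x))"
        using \<epsilon>(3)[OF X aI] rD(3,6) b(3) x mod_hom_closed[OF b(1)] by simp
      have cp: "c i' (p x) \<in> carrier X" if "i' \<in> insert a J'" for i'
        using insert.prems that presD(9)[OF x] by (auto simp: endo_ring_def Pi_iff intro: mod_hom_closed)
      have "ses_out U (?w x \<oplus>\<^bsub>ses_mid U\<^esub> \<Omega> x) (X', i) =
          ses_out U (?w x) (X', i) \<oplus>\<^bsub>X'\<^esub> ses_out U (\<Omega> x) (X', i)"
        using mod_hom_closed[OF w x] mod_hom_closed[OF \<Omega> x] X' i by (simp add: mod_hom_add[OF u(5)] dsum_add)
      also have "\<dots> = (if X' = X \<and> i \<in> insert a J' then c i (p x) else \<zero>\<^bsub>X'\<^esub>)"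
        using X' i insert.hyps cp[of i] cp[of a] \<X>[OF X'] by (auto simp: wo \<Omega>out[OF x X' i] dsum_single_def)
      finally show "ses_out U (?w x \<oplus>\<^bsub>ses_mid U\<^esub> \<Omega> x) (X', i) =
        (if X' = X \<and> i \<in> insert a J' then c i (p x) else \<zero>\<^bsub>X'\<^esub>)" .
    qed
  qed
qed

text \<open>The class of \<open>\<phi>\<close> is a combination of basis classes, so
  \<open>\<phi>\<close> equals the \<open>\<Phi>\<close> of that combination up to a restriction
  from \<open>F\<close>. The map \<open>\<Omega>\<close> extends \<open>\<Phi>\<close> inside
  \<open>U\<close>, and \<open>\<theta>\<close> accounts for the rest.\<close>

lemma universal_ses_extends:
  assumes U: "universal_ses R \<X> Y I E U" and X: "X \<in> \<X>" and \<X>: "\<And>X. X \<in> \<X> \<Longrightarrow> left_module R X"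
    and \<phi>: "\<phi> \<in> mod_hom R K Y"
  shows "extends (ses_mid U) (\<lambda>k. ses_in U (\<phi> k))"
proof -
  have exU: "short_exact R Y U (mod_dsum (Sigma \<X> I) fst)"
    and B: "module_basis (endo_ring R X) (Ext1 R X Y) (I X) (\<lambda>i. ext_class R X Y (E X i))"
    using U X by (auto simp: universal_ses_def)
  note u = short_exactD[OF exU]
  have "cl Y \<phi> \<in> carrier (Ext1 R X Y)" using \<phi> by (simp add: Ext1_carrier[OF u(1)])
  then obtain J' c where J: "finite J'" "J' \<subseteq> I X" "c \<in> J' \<rightarrow> carrier (endo_ring R X)"
    "cl Y \<phi> = (\<Oplus>\<^bsub>Ext1 R X Y\<^esub>i\<in>J'. c i \<odot>\<^bsub>Ext1 R X Y\<^esub> ext_class R X Y (E X i))"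
    using bspec[OF B[unfolded module_basis_def, THEN conjunct2, THEN conjunct2], of "cl Y \<phi>"] by blast
  obtain \<Phi> \<Omega> where \<Phi>: "\<Phi> \<in> mod_hom R K Y" and \<Omega>: "\<Omega> \<in> mod_hom R F (ses_mid U)" and c: "cl Y \<phi> = cl Y \<Phi>"
    and \<Omega>\<kappa>: "\<And>k. k \<in> carrier K \<Longrightarrow> \<Omega> (\<kappa> k) = ses_in U (\<Phi> k)"
    using universal_combination[OF U X \<X> J(1-3)] J(4) by auto
  obtain \<theta> where \<theta>: "\<theta> \<in> mod_hom R F Y" "\<And>k. k \<in> carrier K \<Longrightarrow> \<theta> (\<kappa> k) = \<phi> k \<ominus>\<^bsub>Y\<^esub> \<Phi> k"
    using c cl_eq_iff[OF u(1) \<phi> \<Phi>] by (auto simp: extends_def)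
  have "ses_in U (\<theta> (\<kappa> k)) \<oplus>\<^bsub>ses_mid U\<^esub> \<Omega> (\<kappa> k) = ses_in U (\<phi> k)" if k: "k \<in> carrier K" for k
    using k \<theta>(2) \<Omega>\<kappa> mod_hom_closed[OF \<phi>] mod_hom_closed[OF \<Phi>] u(1)
    by (simp flip: mod_hom_add[OF u(4)])
  then show ?thesis
    unfolding extends_def
    by (intro bexI[OF _ mod_hom_plus[OF u(2) mod_hom_compose[OF \<theta>(1) u(4)] \<Omega>]]) auto
qed

text \<open>By orthogonality a map \<open>f\<close> into the middle term has only endomorphisms of
  \<open>X\<close> as components. Let \<open>\<Omega>\<close> lift these; then
  \<open>\<Omega> - f \<circ> p\<close> has values in \<open>Y\<close>, and it restricts to
  \<open>\<Phi>\<close> on \<open>K\<close>, where \<open>f \<circ> p\<close> is zero. So the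
  combination of basis classes given by the components is zero. Independence makes the components
  vanish, hence \<open>f\<close> factors through \<open>Y\<close>.\<close>

lemma universal_ses_Hom_zero:
  assumes U: "universal_ses R \<X> Y I E U" and X: "X \<in> \<X>" and \<X>: "\<And>X. X \<in> \<X> \<Longrightarrow> left_module R X"
    and orth: "\<And>X'. X' \<in> \<X> \<Longrightarrow> X' \<noteq> X \<Longrightarrow> Hom_zero R X X'"
    and gens: "finite G" "G \<subseteq> carrier X"
      "\<And>g x. g \<in> mod_hom R X X \<Longrightarrow> (\<And>b. b \<in> G \<Longrightarrow> g b = \<zero>\<^bsub>X\<^esub>) \<Longrightarrow> x \<in> carrier X \<Longrightarrow> g x = \<zero>\<^bsub>X\<^esub>"
    and H: "Hom_zero R X Y"
  shows "Hom_zero R X (ses_mid U)"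
  unfolding Hom_zero_def
proof (rule ballI)
  fix f assume f: "f \<in> mod_hom R X (ses_mid U)"
  have exU: "short_exact R Y U (mod_dsum (Sigma \<X> I) fst)"
    and B: "module_basis (endo_ring R X) (Ext1 R X Y) (I X) (\<lambda>i. ext_class R X Y (E X i))"
    using U X by (auto simp: universal_ses_def)
  note u = short_exactD[OF exU]
  have comp: "(\<lambda>x. ses_out U (f x) (X', i)) \<in> mod_hom R X X'" if "X' \<in> \<X>" "i \<in> I X'" for X' i
    using mod_hom_compose[OF mod_hom_compose[OF f u(5)] dsum_coord[of "(X', i)"]] that by simp
  have comp0: "ses_out U (f x) (X', i) = \<zero>\<^bsub>X'\<^esub>" if "X' \<in> \<X>" "i \<in> I X'" "X' \<noteq> X" "x \<in> carrier X" for X' i x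
    using orth[OF that(1,3)] comp[OF that(1,2)] that(4) by (auto simp: Hom_zero_def)
  define c where "c i = (\<lambda>x\<in>carrier X. ses_out U (f x) (X, i))" for i
  have c: "c i \<in> carrier (endo_ring R X)" if "i \<in> I X" for i
    using mod_hom_cong[OF comp[OF X that] presD(3), of "c i"] by (auto simp: endo_ring_def c_def)
  \<comment> \<open>Independence concerns finite combinations. A nonzero component is already
    nonzero on one of the finitely many test elements in \<open>G\<close>, and the image of each of
    those has finite support.\<close>
  define J' where "J' = {i \<in> I X. \<exists>b\<in>G. ses_out U (f b) (X, i) \<noteq> \<zero>\<^bsub>X\<^esub>}"
  have "finite {i \<in> I X. ses_out U (f b) (X, i) \<noteq> \<zero>\<^bsub>X\<^esub>}" if "b \<in> G" for b
  proof -
    have "ses_out U (f b) \<in> carrier (mod_dsum (Sigma \<X> I) fst)"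
      using that gens(2) mod_hom_closed[OF f] u(9) by auto
    then have "finite {k \<in> Sigma \<X> I. ses_out U (f b) k \<noteq> \<zero>\<^bsub>fst k\<^esub>}"
      by (simp add: dsum_carrier_iff)
    then have "finite (snd ` {k \<in> Sigma \<X> I. ses_out U (f b) k \<noteq> \<zero>\<^bsub>fst k\<^esub>})" by simp
    then show ?thesis by (rule rev_finite_subset) (use X in force)
  qed
  then have "finite (\<Union>b\<in>G. {i \<in> I X. ses_out U (f b) (X, i) \<noteq> \<zero>\<^bsub>X\<^esub>})" using gens(1) by auto
  then have finJ: "finite J'" by (rule rev_finite_subset) (auto simp: J'_def)
  have JI: "J' \<subseteq> I X" by (auto simp: J'_def)
  have cJ: "ses_out U (f x) (X, i) = \<zero>\<^bsub>X\<^esub>" if i: "i \<in> I X" "i \<notin> J'" and x: "x \<in> carrier X" for i x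
    by (rule gens(3)[OF comp[OF X i(1)] _ x]) (use i in \<open>auto simp: J'_def\<close>)
  obtain \<Phi> \<Omega> where \<Phi>: "\<Phi> \<in> mod_hom R K Y" and \<Omega>: "\<Omega> \<in> mod_hom R F (ses_mid U)"
    and sum: "(\<Oplus>\<^bsub>Ext1 R X Y\<^esub>i\<in>J'. c i \<odot>\<^bsub>Ext1 R X Y\<^esub> ext_class R X Y (E X i)) = cl Y \<Phi>"
    and \<Omega>\<kappa>: "\<And>k. k \<in> carrier K \<Longrightarrow> \<Omega> (\<kappa> k) = ses_in U (\<Phi> k)"
    and \<Omega>out: "\<And>x X' i. x \<in> carrier F \<Longrightarrow> X' \<in> \<X> \<Longrightarrow> i \<in> I X' \<Longrightarrow>
      ses_out U (\<Omega> x) (X', i) = (if X' = X \<and> i \<in> J' then c i (p x) else \<zero>\<^bsub>X'\<^esub>)"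
    using universal_combination[OF U X \<X> finJ JI, of c] c JI by (auto simp: Pi_iff subset_iff)
  have fp: "(\<lambda>x. f (p x)) \<in> mod_hom R F (ses_mid U)" by (rule mod_hom_compose[OF presD(5) f])
  have oeq: "ses_out U (f (p x)) = ses_out U (\<Omega> x)" if x: "x \<in> carrier F" for x
  proof (rule dsum_eqI)
    fix k assume k: "k \<in> Sigma \<X> I"
    then show "ses_out U (f (p x)) k = ses_out U (\<Omega> x) k"
      using \<Omega>out[OF x, of "fst k" "snd k"] comp0[of "fst k" "snd k" "p x"] cJ[of "snd k" "p x"] presD(9)[OF x]
      by (cases "fst k = X") (auto simp: c_def)
  qed (use u(9) mod_hom_closed[OF fp x] mod_hom_closed[OF \<Omega> x] in auto)
  let ?d = "\<lambda>x. \<Omega> x \<ominus>\<^bsub>ses_mid U\<^esub> f (p x)"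
  have d: "?d \<in> mod_hom R F (ses_mid U)" by (rule mod_hom_minus[OF u(2) \<Omega> fp])
  have "?d x \<in> ses_in U ` carrier Y" if x: "x \<in> carrier F" for x
    by (rule short_exact_kernel[OF exU mod_hom_closed[OF d x]])
      (use x oeq u mod_hom_closed[OF fp x] mod_hom_closed[OF \<Omega> x] in \<open>simp add: mod_hom_diff[OF u(5,2,3)]\<close>)
  then obtain \<theta> where \<theta>: "\<theta> \<in> mod_hom R F Y" "\<And>x. x \<in> carrier F \<Longrightarrow> ses_in U (\<theta> x) = ?d x"
    using mod_hom_through_inj[OF presD(2) u(1,2,4,6) d] by blast
  have "\<theta> (\<kappa> k) = \<Phi> k" if k: "k \<in> carrier K" for k
  proof (rule inj_onD[OF u(6)])
    show "ses_in U (\<theta> (\<kappa> k)) = ses_in U (\<Phi> k)"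
      using k \<theta>(2) presD(8,10) \<Omega>\<kappa> mod_hom_zero[OF f presD(3) u(2)] u mod_hom_closed[OF \<Phi> k] by simp
  qed (use k presD(8) mod_hom_closed[OF \<Phi>] mod_hom_closed[OF \<theta>(1)] in auto)
  then have "extends Y (\<lambda>k. \<Phi> k \<ominus>\<^bsub>Y\<^esub> \<zero>\<^bsub>Y\<^esub>)"
    using \<theta>(1) u(1) mod_hom_closed[OF \<Phi>] by (auto simp: extends_def)
  then have "cl Y \<Phi> = \<zero>\<^bsub>Ext1 R X Y\<^esub>"
    unfolding Ext1_zero_cl[OF u(1)] using cl_eq_iff[OF u(1) \<Phi> mod_hom_zero_map[OF u(1)]] by simp
  then have "\<forall>i\<in>J'. c i = \<zero>\<^bsub>endo_ring R X\<^esub>"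
    using B[unfolded module_basis_def, THEN conjunct2, THEN conjunct1, THEN spec[of _ J'], THEN spec[of _ c]]
      finJ JI c sum by (auto simp: Pi_iff subset_iff)
  then have cz: "ses_out U (f x) (X, i) = \<zero>\<^bsub>X\<^esub>" if "i \<in> J'" "x \<in> carrier X" for i x
    using that by (auto simp: c_def endo_ring_def fun_eq_iff)
      (metis restrict_apply')
  have "ses_out U (f x) = \<zero>\<^bsub>mod_dsum (Sigma \<X> I) fst\<^esub>" if x: "x \<in> carrier X" for x
  proof (rule dsum_eqI)
    fix k assume "k \<in> Sigma \<X> I"
    then show "ses_out U (f x) k = \<zero>\<^bsub>mod_dsum (Sigma \<X> I) fst\<^esub> k"
      using comp0[of "fst k" "snd k" x] cJ[of "snd k" x] cz[of "snd k" x] x by (cases k) (auto simp: dsum_zero)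
  qed (use u(9) mod_hom_closed[OF f x] u(3) in auto)
  then have "f x \<in> ses_in U ` carrier Y" if "x \<in> carrier X" for x
    using that mod_hom_closed[OF f] by (intro short_exact_kernel[OF exU]) auto
  then obtain g where g: "g \<in> mod_hom R X Y" "\<And>x. x \<in> carrier X \<Longrightarrow> ses_in U (g x) = f x"
    using mod_hom_through_inj[OF presD(3) u(1,2,4,6) f] by blast
  show "\<forall>x\<in>carrier X. f x = \<zero>\<^bsub>ses_mid U\<^esub>"
    using g H mod_hom_zero[OF u(4,1,2)] by (metis Hom_zero_def)
qed

text \<open>The obstruction to extending \<open>h\<close> is the class of
  \<open>h \<circ> \<phi>\<close> in \<open>Ext^1(X, W)\<close>.\<close>

lemma perp_extend_ses:
  assumes S: "short_exact R Y S X" and W: "left_module R W" "Ext1_zero R X W" and h: "h \<in> mod_hom R Y W"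
  obtains G where "G \<in> mod_hom R (ses_mid S) W" "\<And>y. y \<in> carrier Y \<Longrightarrow> G (ses_in S y) = h y"
proof -
  obtain \<phi> \<psi> where r: "rep_by Y S \<phi> \<psi>" using rep_exists[OF S] by blast
  have "extends W (\<lambda>k. h (\<phi> k))"
    using Ext1_zero_iff[OF W(1)] W(2) mod_hom_compose[OF rep_byD(1)[OF r] h] by blast
  then obtain \<rho> where "\<rho> \<in> mod_hom R F W" "\<And>k. k \<in> carrier K \<Longrightarrow> \<rho> (\<kappa> k) = h (\<phi> k)" by (auto simp: extends_def)
  then show thesis using glue[OF S r W(1) h] that by blast
qed

end

section \<open>Finite presentations and direct limits\<close>

text \<open>Both terms are finite, so that maps from \<open>F\<close> and from \<open>K\<close> into
  a direct limit come from some stage. The middle term is free of rank \<open>n\<close>, while the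
  kernel is only a summand of a free module of rank \<open>m\<close>.\<close>

definition fp_presentation ::
    "'r ring \<Rightarrow> ('r, 'x) module \<Rightarrow> ('r, nat \<Rightarrow> 'r) module \<Rightarrow> ('r, nat \<Rightarrow> 'r, nat \<Rightarrow> 'r, 'x) ses \<Rightarrow> nat \<Rightarrow> nat \<Rightarrow> bool" where
  "fp_presentation R X K T m n \<longleftrightarrow>
     short_exact R K T X \<and> ses_mid T = free_module R {..<n} \<and> retract_of_free R K {..<m}"

context base_ring
begin

lemma fp_presentation_proj: "fp_presentation R X K T m n \<Longrightarrow> proj_presentation R K T X {..<n}"
  by unfold_locales (simp_all add: fp_presentation_def retract_of_free_free)

text \<open>Finite presentability provides a finitely generated kernel, while the projective
  dimension is given by an unrelated resolution. As in Schanuel's lemma, maps between the two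
  resolutions transfer projectivity to that kernel, and the splitting stays within rank
  \<open>m\<close>.\<close>

lemma fp_presentation_exists:
  assumes fp: "fin_pres R X" and pd: "proj_dim_le_1 R X"
  obtains K T m n where "fp_presentation R X K T m n"
proof -
  obtain m n :: nat and q p where q: "q \<in> mod_hom R (free_module R {..<m}) (free_module R {..<n})"
    and p: "p \<in> mod_hom R (free_module R {..<n}) X" "p ` carrier (free_module R {..<n}) = carrier X"
    and qp: "q ` carrier (free_module R {..<m}) = {x \<in> carrier (free_module R {..<n}). p x = \<zero>\<^bsub>X\<^esub>}"
    and X: "left_module R X"
    using fp unfolding fin_pres_def by blast
  obtain P :: "('r, 'a \<Rightarrow> 'r) module" and S :: "('r, 'a \<Rightarrow> 'r, 'a \<Rightarrow> 'r, 'a) ses"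
    where P: "projective_mod R P" and Q: "projective_mod R (ses_mid S)" and S: "short_exact R P S X"
    using pd unfolding proj_dim_le_1_def by blast
  let ?F = "free_module R {..<n}" and ?G = "free_module R {..<m}" and ?Q = "ses_mid S"
  define K where "K = ?F\<lparr>carrier := {x \<in> carrier ?F. p x = \<zero>\<^bsub>X\<^esub>}\<rparr>"
  define T where "T = \<lparr>ses_in = (\<lambda>x. x), ses_mid = ?F, ses_out = p\<rparr>"
  note s = short_exactD[OF S]
  have F: "left_module R ?F" and G: "left_module R ?G" by simp_all
  have K: "left_module R K" unfolding K_def by (rule submod_module[OF F submod_kernel[OF F X p(1)]])
  have incl: "(\<lambda>x. x) \<in> mod_hom R K ?F" by (rule mod_homI) (auto simp: K_def)
  have into_K: "g \<in> mod_hom R A K" if "g \<in> mod_hom R A ?F" "\<And>a. a \<in> carrier A \<Longrightarrow> p (g a) = \<zero>\<^bsub>X\<^esub>"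
    for g and A :: "('r, 'b) module"
    by (rule mod_homI) (use that in \<open>auto simp: K_def mod_hom_closed mod_hom_add mod_hom_smult\<close>)
  have Kc: "carrier K = {x \<in> carrier ?F. p x = \<zero>\<^bsub>X\<^esub>}" by (simp add: K_def)
  have Kadd: "x \<oplus>\<^bsub>K\<^esub> y = x \<oplus>\<^bsub>?F\<^esub> y" for x y by (simp add: K_def)
  have qK: "q \<in> mod_hom R ?G K"
    by (rule mod_homI) (use q qp in \<open>auto simp: K_def mod_hom_add mod_hom_smult\<close>)
  have qs: "q ` carrier ?G = carrier K" using qp by (simp add: Kc)
  have T: "short_exact R K T X"
  proof (rule short_exactI)
    show "\<exists>m\<in>carrier (ses_mid T). ses_out T m = x" if "x \<in> carrier X" for x
      using that p(2) by (auto simp: T_def) (metis imageE)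
  qed (use K X incl p in \<open>auto simp: T_def Kc K_def\<close>)
  obtain K1 :: "('a \<Rightarrow> 'r) set" where PK: "retract_of_free R P K1" using projective_retract_of_free[OF P] .
  obtain K2 :: "('a \<Rightarrow> 'r) set" where QK: "retract_of_free R ?Q K2" using projective_retract_of_free[OF Q] .
  obtain u where u: "u \<in> mod_hom R ?F ?Q" "\<And>x. x \<in> carrier ?F \<Longrightarrow> ses_out S (u x) = p x"
    by (rule retract_of_free_lift[OF retract_of_free_free s(2,3,5,7) p(1)]) (rule that)
  obtain v where v: "v \<in> mod_hom R ?Q ?F" "\<And>x. x \<in> carrier ?Q \<Longrightarrow> p (v x) = ses_out S x"
    by (rule retract_of_free_lift[OF QK F X p s(5)]) (rule that)
  \<comment> \<open>The identity of \<open>K\<close> is the restriction of \<open>1 - v u\<close> plus \<open>v t\<close>, where \<open>t\<close> is \<open>u\<close> restricted to \<open>K \<rightarrow> P\<close>;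
    both summands start in a projective module, so they lift through \<open>q\<close> and split it.\<close>
  let ?w = "\<lambda>x. x \<ominus>\<^bsub>?F\<^esub> v (u x)" and ?z = "\<lambda>y. v (ses_in S y)"
  have vu: "v (u x) \<in> carrier ?F" "p (v (u x)) = p x" if "x \<in> carrier ?F" for x
    using that u(2) v(2) mod_hom_closed[OF u(1) that] mod_hom_closed[OF v(1)] by auto
  have w: "?w \<in> mod_hom R ?F K"
  proof (rule into_K)
    show "?w \<in> mod_hom R ?F ?F" by (rule mod_hom_minus[OF F mod_hom_id mod_hom_compose[OF u(1) v(1)]])
    show "p (?w x) = \<zero>\<^bsub>X\<^esub>" if "x \<in> carrier ?F" for x
      using that vu[OF that] X mod_hom_closed[OF p(1)] by (simp add: mod_hom_diff[OF p(1) F X])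
  qed
  have z: "?z \<in> mod_hom R P K"
    by (rule into_K[OF mod_hom_compose[OF s(4) v(1)]]) (use v(2) s(8,10) in auto)
  have "u k \<in> ses_in S ` carrier P" if "k \<in> carrier K" for k
    by (rule short_exact_kernel[OF S]) (use that u mod_hom_closed[OF u(1)] in \<open>auto simp: Kc\<close>)
  then obtain t where t: "t \<in> mod_hom R K P" "\<And>k. k \<in> carrier K \<Longrightarrow> ses_in S (t k) = u k"
    using mod_hom_through_inj[OF K s(1,2,4,6) mod_hom_compose[OF incl u(1)]] by blast
  obtain a where a: "a \<in> mod_hom R ?F ?G" "\<And>x. x \<in> carrier ?F \<Longrightarrow> q (a x) = ?w x"
    by (rule retract_of_free_lift[OF retract_of_free_free G K qK qs w]) (rule that)
  obtain b where b: "b \<in> mod_hom R P ?G" "\<And>x. x \<in> carrier P \<Longrightarrow> q (b x) = ?z x"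
    by (rule retract_of_free_lift[OF PK G K qK qs z]) (rule that)
  have "retract_of_free R K {..<m}" unfolding retract_of_free_def
  proof (intro conjI exI ballI)
    show "(\<lambda>k. a k \<oplus>\<^bsub>?G\<^esub> b (t k)) \<in> mod_hom R K ?G"
      by (rule mod_hom_plus[OF G mod_hom_compose[OF incl a(1)] mod_hom_compose[OF t(1) b(1)]])
    fix k assume k: "k \<in> carrier K"
    then have kF: "k \<in> carrier ?F" by (simp add: Kc)
    show "q (a k \<oplus>\<^bsub>?G\<^esub> b (t k)) = k"
      using kF vu[OF kF] mod_hom_closed[OF t(1) k]
      by (simp add: mod_hom_add[OF qK] mod_hom_closed[OF a(1)] mod_hom_closed[OF b(1)] a(2) b(2) t(2)[OF k] Kadd)
  qed (use K qK in auto)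
  then have "fp_presentation R X K T m n" using T by (simp add: fp_presentation_def T_def)
  then show thesis by (rule that)
qed

end

section \<open>Direct limits of chains of monomorphisms\<close>

locale module_chain = base_ring R for R :: "'r ring" (structure) +
  fixes Y :: "nat \<Rightarrow> ('r, 'm) module" and f :: "nat \<Rightarrow> 'm \<Rightarrow> 'm"
  assumes Y [simp]: "left_module R (Y n)" and f: "f n \<in> mod_hom R (Y n) (Y (Suc n))"
    and f_inj: "inj_on (f n) (carrier (Y n))"
begin

abbreviation tr :: "nat \<Rightarrow> nat \<Rightarrow> 'm \<Rightarrow> 'm" where "tr i k \<equiv> fold f [i..<k]"

abbreviation emb :: "nat \<Rightarrow> 'm \<Rightarrow> (nat \<times> 'm) set" where "emb \<equiv> lim_class Y f"

abbreviation "L \<equiv> direct_limit Y f"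

lemma tr_trans: "i \<le> j \<Longrightarrow> j \<le> k \<Longrightarrow> tr i k x = tr j k (tr i j x)"
  by (metis append_is_Nil_conv comp_apply fold_append le_add_diff_inverse upt_add_eq_append)

lemma tr_hom: "i \<le> k \<Longrightarrow> tr i k \<in> mod_hom R (Y i) (Y k)"
proof (induction k rule: dec_induct)
  case base
  then show ?case using mod_hom_id[of "Y i"] by (simp add: id_def)
next
  case (step k)
  then show ?case using mod_hom_compose[OF step.IH f] by (simp add: comp_def)
qed

lemma tr_closed: "i \<le> k \<Longrightarrow> x \<in> carrier (Y i) \<Longrightarrow> tr i k x \<in> carrier (Y k)"
  using mod_hom_closed[OF tr_hom] .

lemma tr_inj: "i \<le> k \<Longrightarrow> inj_on (tr i k) (carrier (Y i))"
proof (induction k rule: dec_induct)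
  case (step k)
  have "inj_on (f k) (tr i k ` carrier (Y i))"
    using step.hyps by (intro inj_on_subset[OF f_inj]) (auto intro: tr_closed)
  then show ?case using comp_inj_on[OF step.IH, of "f k"] step.hyps by (simp add: comp_def)
qed (simp add: inj_on_def)

lemma emb_mem: "(j, y) \<in> emb i x \<longleftrightarrow> y \<in> carrier (Y j) \<and> (\<exists>k\<ge>max i j. tr i k x = tr j k y)"
  by (simp add: lim_class_def)

lemma emb_self: "x \<in> carrier (Y i) \<Longrightarrow> (i, x) \<in> emb i x"
  by (auto simp: emb_mem)

text \<open>Equality at one stage persists at all later ones, so two witnesses are compared at the
  maximum of their stages.\<close>

lemma emb_eqI:
  assumes k: "k \<ge> i" "k \<ge> j" and e: "tr i k x = tr j k y"
  shows "emb i x = emb j y"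
proof -
  have *: "emb i x \<subseteq> emb j y" if k: "k \<ge> i" "k \<ge> j" and e: "tr i k x = tr j k y" for i j x y
  proof (rule subrelI)
    fix l z assume "(l, z) \<in> emb i x"
    then obtain k' where z: "z \<in> carrier (Y l)" and k': "k' \<ge> i" "k' \<ge> l" "tr i k' x = tr l k' z" by (auto simp: emb_mem)
    let ?k = "max k k'"
    have "tr j ?k y = tr k ?k (tr j k y)" using k by (intro tr_trans) auto
    also have "\<dots> = tr i ?k x" unfolding e[symmetric] using k by (intro tr_trans[symmetric]) auto
    also have "\<dots> = tr k' ?k (tr i k' x)" using k' by (intro tr_trans) auto
    also have "\<dots> = tr l ?k z" unfolding k'(3) using k' by (intro tr_trans[symmetric]) auto
    finally show "(l, z) \<in> emb j y" using z k k' by (auto simp: emb_mem intro!: exI[of _ ?k])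
  qed
  show ?thesis using *[OF k e] *[OF k(2,1) e[symmetric]] by simp
qed

lemma emb_eq_iff:
  assumes "x \<in> carrier (Y i)" "y \<in> carrier (Y j)"
  shows "emb i x = emb j y \<longleftrightarrow> (\<exists>k\<ge>max i j. tr i k x = tr j k y)"
proof
  assume "emb i x = emb j y"
  then have "(j, y) \<in> emb i x" using emb_self[OF assms(2)] by simp
  then show "\<exists>k\<ge>max i j. tr i k x = tr j k y" by (auto simp: emb_mem)
next
  assume "\<exists>k\<ge>max i j. tr i k x = tr j k y"
  then obtain k where "k \<ge> i" "k \<ge> j" "tr i k x = tr j k y" by auto
  then show "emb i x = emb j y" by (rule emb_eqI)
qed



lemma emb_tr: "i \<le> k \<Longrightarrow> emb k (tr i k x) = emb i x"
  by (rule emb_eqI[where k = k]) auto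

text \<open>Since the transition maps are injective, every stage embeds into the limit, and
  vanishing in the limit can be tested at a stage.\<close>

lemma emb_inj:
  assumes "x \<in> carrier (Y i)" "y \<in> carrier (Y i)" "emb i x = emb i y" shows "x = y"
proof -
  obtain k where "k \<ge> i" "tr i k x = tr i k y" using emb_eq_iff[OF assms(1,2)] assms(3) by auto
  then show ?thesis using tr_inj[of i k] assms by (auto dest: inj_onD)
qed

lemma L_carrierE:
  assumes "A \<in> carrier L" obtains i x where "x \<in> carrier (Y i)" "A = emb i x"
  using assms by (auto simp: direct_limit_def)

lemma emb_closed: "x \<in> carrier (Y i) \<Longrightarrow> emb i x \<in> carrier L"
  by (auto simp: direct_limit_def)

lemma emb_zero: "emb i \<zero>\<^bsub>Y i\<^esub> = \<zero>\<^bsub>L\<^esub>"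
proof -
  have "\<zero>\<^bsub>L\<^esub> = emb 0 \<zero>\<^bsub>Y 0\<^esub>" by (simp add: direct_limit_def)
  also have "\<dots> = emb i (tr 0 i \<zero>\<^bsub>Y 0\<^esub>)" by (simp add: emb_tr)
  also have "tr 0 i \<zero>\<^bsub>Y 0\<^esub> = \<zero>\<^bsub>Y i\<^esub>" by (rule mod_hom_zero[OF tr_hom]) auto
  finally show ?thesis by simp
qed

lemma emb_add:
  assumes xy: "x \<in> carrier (Y i)" "y \<in> carrier (Y i)"
  shows "emb i x \<oplus>\<^bsub>L\<^esub> emb i y = emb i (x \<oplus>\<^bsub>Y i\<^esub> y)"
proof -
  \<comment> \<open>Independence of representatives: each is compared with its original at a stage
    beyond all indices involved.\<close>
  have *: "emb (max j j') (tr j (max j j') x' \<oplus>\<^bsub>Y (max j j')\<^esub> tr j' (max j j') y') = emb i (x \<oplus>\<^bsub>Y i\<^esub> y)"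
    if x': "(j, x') \<in> emb i x" and y': "(j', y') \<in> emb i y" for j j' x' y'
  proof -
    obtain k where k: "k \<ge> i" "k \<ge> j" "tr i k x = tr j k x'" and x'c: "x' \<in> carrier (Y j)" using x' by (auto simp: emb_mem)
    obtain k' where k': "k' \<ge> i" "k' \<ge> j'" "tr i k' y = tr j' k' y'" and y'c: "y' \<in> carrier (Y j')" using y' by (auto simp: emb_mem)
    let ?k = "max k k'" and ?j = "max j j'"
    have jk: "?j \<le> ?k" using k k' by auto
    have ex: "tr i ?k x = tr j ?k x'"
      using tr_trans[of i k ?k x] tr_trans[of j k ?k x'] k by simp
    have ey: "tr i ?k y = tr j' ?k y'"
      using tr_trans[of i k' ?k y] tr_trans[of j' k' ?k y'] k' by simp
    have "tr ?j ?k (tr j ?j x' \<oplus>\<^bsub>Y ?j\<^esub> tr j' ?j y') = tr ?j ?k (tr j ?j x') \<oplus>\<^bsub>Y ?k\<^esub> tr ?j ?k (tr j' ?j y')"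
      using k k' x'c y'c by (intro mod_hom_add[OF tr_hom] tr_closed) auto
    also have "\<dots> = tr i ?k x \<oplus>\<^bsub>Y ?k\<^esub> tr i ?k y"
      using ex ey tr_trans[OF max.cobounded1 jk, of x'] tr_trans[OF max.cobounded2 jk, of y'] by simp
    also have "\<dots> = tr i ?k (x \<oplus>\<^bsub>Y i\<^esub> y)"
      using k xy by (intro mod_hom_add[OF tr_hom, symmetric]) auto
    finally show ?thesis using k k' by (intro emb_eqI[where k = ?k]) auto
  qed
  have "(\<Union>(j, x')\<in>emb i x. \<Union>(j', y')\<in>emb i y. emb (max j j') (tr j (max j j') x' \<oplus>\<^bsub>Y (max j j')\<^esub> tr j' (max j j') y'))
      = emb i (x \<oplus>\<^bsub>Y i\<^esub> y)"
    by (rule UN_eq_const[OF emb_self[OF xy(1)]], clarsimp simp del: fold_simps,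
        rule UN_eq_const[OF emb_self[OF xy(2)]], clarsimp simp del: fold_simps, rule *)
  then show ?thesis by (simp add: direct_limit_def)
qed

lemma emb_smult:
  assumes x: "x \<in> carrier (Y i)" and r: "r \<in> carrier R"
  shows "r \<odot>\<^bsub>L\<^esub> emb i x = emb i (r \<odot>\<^bsub>Y i\<^esub> x)"
proof -
  have *: "emb j (r \<odot>\<^bsub>Y j\<^esub> x') = emb i (r \<odot>\<^bsub>Y i\<^esub> x)" if x': "(j, x') \<in> emb i x" for j x'
  proof -
    obtain k where k: "k \<ge> i" "k \<ge> j" "tr i k x = tr j k x'" and x'c: "x' \<in> carrier (Y j)" using x' by (auto simp: emb_mem)
    have "tr j k (r \<odot>\<^bsub>Y j\<^esub> x') = tr i k (r \<odot>\<^bsub>Y i\<^esub> x)"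
      using k x r x'c mod_hom_smult[OF tr_hom[of j k] r x'c] mod_hom_smult[OF tr_hom[of i k] r x] by simp
    then show ?thesis using k by (intro emb_eqI[where k = k]) auto
  qed
  have "(\<Union>(j, x')\<in>emb i x. emb j (r \<odot>\<^bsub>Y j\<^esub> x')) = emb i (r \<odot>\<^bsub>Y i\<^esub> x)"
    by (rule UN_eq_const[OF emb_self[OF x]]) (clarsimp, rule *)
  then show ?thesis by (simp add: direct_limit_def)
qed

lemma emb_hom: "emb i \<in> mod_hom R (Y i) L"
  by (rule mod_homI) (auto simp: emb_closed emb_add emb_smult)

text \<open>Any three elements live at a common stage, from which the module laws are inherited
  through \<open>left_module_locally\<close>.\<close>

lemma left_module_limit [simp]: "left_module R L"
proof (rule left_module_locally)
  show "carrier L \<noteq> {}" using emb_closed[OF module_zero_closed[OF Y]] by auto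
  fix A B C assume "A \<in> carrier L" "B \<in> carrier L" "C \<in> carrier L"
  then obtain i x j y k z where c: "x \<in> carrier (Y i)" "A = emb i x" "y \<in> carrier (Y j)" "B = emb j y"
    "z \<in> carrier (Y k)" "C = emb k z" by (metis L_carrierE)
  let ?n = "max i (max j k)"
  have "A = emb ?n (tr i ?n x)" "B = emb ?n (tr j ?n y)" "C = emb ?n (tr k ?n z)"
    using c by (simp_all add: emb_tr)
  moreover have "tr i ?n x \<in> carrier (Y ?n)" "tr j ?n y \<in> carrier (Y ?n)" "tr k ?n z \<in> carrier (Y ?n)"
    using c by (auto intro: tr_closed)
  ultimately have "{A, B, C} \<subseteq> emb ?n ` carrier (Y ?n)" by blast
  then show "\<exists>(M :: ('r, 'm) module) \<pi>. left_module R M \<and> \<pi> \<in> mod_hom R M L \<and> \<pi> \<zero>\<^bsub>M\<^esub> = \<zero>\<^bsub>L\<^esub> \<and>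
      {A, B, C} \<subseteq> \<pi> ` carrier M"
    by (intro exI[of _ "Y ?n"] exI[of _ "emb ?n"]) (simp add: emb_hom emb_zero)
qed

lemma emb_f: "emb (Suc n) (f n x) = emb n x"
  using emb_tr[of n "Suc n" x] by simp

lemma limit_hom_exists:
  assumes W: "left_module R W" and h: "\<And>n. h n \<in> mod_hom R (Y n) W"
    and comp: "\<And>n x. x \<in> carrier (Y n) \<Longrightarrow> h (Suc n) (f n x) = h n x"
  obtains H where "H \<in> mod_hom R L W" "\<And>n x. x \<in> carrier (Y n) \<Longrightarrow> H (emb n x) = h n x"
proof
  have ht: "h k (tr i k x) = h i x" if "i \<le> k" "x \<in> carrier (Y i)" for i k x
    using that by (induction k rule: dec_induct) (auto simp: comp tr_closed)
  \<comment> \<open>Any representative may be chosen: by compatibility all of them have the value of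
    \<open>h\<close> at a common later stage.\<close>
  define H where "H A = (SOME w. \<exists>i x. (i, x) \<in> A \<and> w = h i x)" for A
  have *: "H (emb n x) = h n x" if x: "x \<in> carrier (Y n)" for n x
  proof -
    have "w = h n x" if iy: "(i, y) \<in> emb n x" and w: "w = h i y" for i y w
    proof -
      obtain k where "y \<in> carrier (Y i)" "k \<ge> n" "k \<ge> i" "tr n k x = tr i k y"
        using iy by (auto simp: emb_mem)
      then show ?thesis using ht[of n k x] ht[of i k y] x w by simp
    qed
    then show ?thesis unfolding H_def using emb_self[OF x] by (intro some_equality) blast+
  qed
  show "H (emb n x) = h n x" if "x \<in> carrier (Y n)" for n x by (rule *[OF that])
  show "H \<in> mod_hom R L W"
  proof (rule mod_homI)
    fix A assume "A \<in> carrier L"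
    then obtain i x where A: "x \<in> carrier (Y i)" "A = emb i x" by (rule L_carrierE)
    then show "H A \<in> carrier W" using * mod_hom_closed[OF h] by simp
    show "H (r \<odot>\<^bsub>L\<^esub> A) = r \<odot>\<^bsub>W\<^esub> H A" if "r \<in> carrier R" for r
      using A that * by (simp add: emb_smult mod_hom_smult[OF h])
    fix B assume "B \<in> carrier L"
    then obtain j y where B: "y \<in> carrier (Y j)" "B = emb j y" by (rule L_carrierE)
    let ?k = "max i j"
    have "A = emb ?k (tr i ?k x)" "B = emb ?k (tr j ?k y)" using A B by (simp_all add: emb_tr)
    moreover have "tr i ?k x \<in> carrier (Y ?k)" "tr j ?k y \<in> carrier (Y ?k)" using A B by (auto intro: tr_closed)
    ultimately show "H (A \<oplus>\<^bsub>L\<^esub> B) = H A \<oplus>\<^bsub>W\<^esub> H B"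
      using * by (simp add: emb_add mod_hom_add[OF h])
  qed
qed

text \<open>A map from a free module of finite rank is determined by finitely many elements of the
  limit, and these have a common stage.\<close>

lemma free_lift_stage:
  fixes n :: nat
  assumes g: "g \<in> mod_hom R (free_module R {..<n}) L"
  obtains N \<theta> where "\<theta> \<in> mod_hom R (free_module R {..<n}) (Y N)"
    "\<And>x. x \<in> carrier (free_module R {..<n}) \<Longrightarrow> emb N (\<theta> x) = g x"
proof -
  have "\<exists>i x. x \<in> carrier (Y i) \<and> g (free_gen R {..<n} j) = emb i x" if "j < n" for j
    using mod_hom_closed[OF g free_gen_closed[of j "{..<n}"]] that L_carrierE by (metis lessThan_iff)
  then obtain i x where ix: "\<And>j. j < n \<Longrightarrow> x j \<in> carrier (Y (i j))"
    "\<And>j. j < n \<Longrightarrow> g (free_gen R {..<n} j) = emb (i j) (x j)" by metis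
  \<comment> \<open>The sum of finitely many stages bounds each of them.\<close>
  define N where "N = (\<Sum>j<n. i j)"
  have N: "i j \<le> N" if "j < n" for j unfolding N_def using that by (intro member_le_sum) auto
  obtain \<theta> where \<theta>: "\<theta> \<in> mod_hom R (free_module R {..<n}) (Y N)"
    "\<And>j. j \<in> {..<n} \<Longrightarrow> \<theta> (free_gen R {..<n} j) = tr (i j) N (x j)"
    by (rule free_extend[OF Y, of "{..<n}" "\<lambda>j. tr (i j) N (x j)" N]) (use ix N in \<open>auto intro!: tr_closed\<close>)
  have "emb N (\<theta> y) = g y" if "y \<in> carrier (free_module R {..<n})" for y
    by (rule free_hom_eqI[OF left_module_limit mod_hom_compose[OF \<theta>(1) emb_hom] g _ that])
      (use \<theta>(2) ix(2) N emb_tr in auto)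
  with \<theta>(1) show thesis by (rule that)
qed

end

section \<open>The reflection\<close>

context base_ring
begin

lemma mod_iso_Hom_zero:
  assumes h: "h \<in> mod_iso R M N" and M: "left_module R M" and N: "left_module R N" and H: "Hom_zero R X M"
  shows "Hom_zero R X N"
  unfolding Hom_zero_def
proof (intro ballI)
  fix g x assume g: "g \<in> mod_hom R X N" and x: "x \<in> carrier X"
  obtain k where k: "k \<in> mod_iso R N M" "\<And>y. y \<in> carrier N \<Longrightarrow> h (k y) = y"
    by (rule mod_iso_inverse[OF h M N]) (rule that)
  then have kh: "k \<in> mod_hom R N M" and hh: "h \<in> mod_hom R M N" using h by (auto simp: mod_iso_def)
  have "k (g x) = \<zero>\<^bsub>M\<^esub>" using H mod_hom_compose[OF g kh] x by (auto simp: Hom_zero_def)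
  then have "h (k (g x)) = \<zero>\<^bsub>N\<^esub>" using mod_hom_zero[OF hh M N] by simp
  then show "g x = \<zero>\<^bsub>N\<^esub>" using k(2) mod_hom_closed[OF g x] by simp
qed

section \<open>Restriction of scalars\<close>

lemma left_module_restrict_scalars:
  assumes S: "ring S" and \<phi>: "\<phi> \<in> ring_hom R S" and V: "left_module S V"
  shows "left_module R (restrict_scalars \<phi> V)"
proof -
  interpret S: base_ring S using S by (simp add: base_ring_def)
  have c: "\<phi> r \<in> carrier S" if "r \<in> carrier R" for r using ring_hom_closed[OF \<phi> that] .
  have "abelian_group (restrict_scalars \<phi> V)"
  proof (rule abelian_groupI)
    show "\<exists>y\<in>carrier (restrict_scalars \<phi> V). y \<oplus>\<^bsub>restrict_scalars \<phi> V\<^esub> x = \<zero>\<^bsub>restrict_scalars \<phi> V\<^esub>"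
      if "x \<in> carrier (restrict_scalars \<phi> V)" for x
      using V that by (intro bexI[of _ "\<ominus>\<^bsub>V\<^esub> x"]) (auto simp: restrict_scalars_def)
  qed (use V in \<open>auto simp: restrict_scalars_def S.module_add_ac\<close>)
  then show ?thesis
    by (rule left_moduleI)
      (use V c in \<open>auto simp: restrict_scalars_def ring_hom_add[OF \<phi>] ring_hom_mult[OF \<phi>] ring_hom_one[OF \<phi>]
        S.module_smult_l_distr S.module_smult_r_distr S.module_smult_assoc\<close>)
qed

lemma restrict_scalars_simps [simp]:
  "carrier (restrict_scalars \<phi> V) = carrier V" "\<zero>\<^bsub>restrict_scalars \<phi> V\<^esub> = \<zero>\<^bsub>V\<^esub>"
  "x \<oplus>\<^bsub>restrict_scalars \<phi> V\<^esub> y = x \<oplus>\<^bsub>V\<^esub> y" "r \<odot>\<^bsub>restrict_scalars \<phi> V\<^esub> x = \<phi> r \<odot>\<^bsub>V\<^esub> x"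
  by (simp_all add: restrict_scalars_def)

lemma mod_hom_restrict_scalars:
  assumes "\<phi> \<in> ring_hom R S" "g \<in> mod_hom S V W"
  shows "g \<in> mod_hom R (restrict_scalars \<phi> V) (restrict_scalars \<phi> W)"
  using assms ring_hom_closed[OF assms(1)] by (auto simp: mod_hom_def)

end

section \<open>The tower of universal sequences over \<open>R\<close>\<close>

locale localization_setup = base_ring R for R :: "'r ring" (structure) +
  fixes \<X> :: "('r, 'x) module set"
    and \<iota> :: "'r \<Rightarrow> 'm"
    and Y :: "nat \<Rightarrow> ('r, 'm) module"
    and I :: "nat \<Rightarrow> ('r, 'x) module \<Rightarrow> 'i set"
    and E :: "nat \<Rightarrow> ('r, 'x) module \<Rightarrow> 'i \<Rightarrow> ('r, 'm, 'e, 'x) ses"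
    and U :: "nat \<Rightarrow> ('r, 'm, 'm, ('r, 'x) module \<times> 'i \<Rightarrow> 'x) ses"
  assumes semi: "semibrick R \<X>"
    and pd: "\<And>X. X \<in> \<X> \<Longrightarrow> proj_dim_le_1 R X"
    and Hom_R: "\<And>X. X \<in> \<X> \<Longrightarrow> Hom_zero R X (regular_module R)"
    and tower: "universal_tower R \<X> (regular_module R) \<iota> Y I E U"
begin

lemma universal: "universal_ses R \<X> (Y n) (I n) (E n) (U n)"
  using tower by (simp add: universal_tower_def)

lemma mid_U: "ses_mid (U n) = Y (Suc n)"
  using tower by (simp add: universal_tower_def)

lemma exact_U: "short_exact R (Y n) (U n) (mod_dsum (Sigma \<X> (I n)) fst)"
  using universal by (simp add: universal_ses_def)

lemmas U_D = short_exactD[OF exact_U, unfolded mid_U]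

sublocale chain: module_chain R Y "\<lambda>n. ses_in (U n)"
  by (rule module_chain.intro[OF base_ring_axioms], rule module_chain_axioms.intro) (rule U_D(1,4,6))+

abbreviation "L \<equiv> tower_limit Y U"
abbreviation "\<alpha> \<equiv> tower_embedding \<iota> Y U"

lemma L_eq: "direct_limit Y (\<lambda>n. ses_in (U n)) = L"
  by (simp add: tower_limit_def)

lemma left_module_L [simp]: "left_module R L"
  using chain.left_module_limit by (simp add: tower_limit_def)

lemma \<iota>: "\<iota> \<in> mod_iso R (regular_module R) (Y 0)"
  using tower by (simp add: universal_tower_def)

lemma \<alpha>_hom: "\<alpha> \<in> mod_hom R (regular_module R) L"
  using mod_hom_compose[OF _ chain.emb_hom[of 0, unfolded L_eq], of \<iota>] \<iota>
  by (simp add: tower_embedding_def mod_iso_def)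

lemma X_fin_pres: "X \<in> \<X> \<Longrightarrow> fin_pres R X"
  using semi by (simp add: semibrick_def brick_def)

lemma X_module: "X \<in> \<X> \<Longrightarrow> left_module R X"
  using X_fin_pres by (simp add: fin_pres_def)

lemma X_presentation:
  assumes "X \<in> \<X>"
  obtains K T m n where "fp_presentation R X K T m n"
  using fp_presentation_exists[OF X_fin_pres[OF assms] pd[OF assms]] by blast

text \<open>Stage zero is a copy of \<open>R\<close>. Going up one stage is where linear
  independence of the basis and orthogonality are used.\<close>

lemma Hom_zero_Y:
  assumes X: "X \<in> \<X>"
  shows "Hom_zero R X (Y n)"
proof (induction n)
  case 0
  show ?case using mod_iso_Hom_zero[OF \<iota> left_module_regular chain.Y Hom_R[OF X]] .
next
  case (Suc n)
  obtain K T m k where fp: "fp_presentation R X K T m k" by (rule X_presentation[OF X])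
  interpret P: proj_presentation R K T X "{..<k}" by (rule fp_presentation_proj[OF fp])
  have F: "P.F = free_module R {..<k}" using fp by (simp add: fp_presentation_def)
  \<comment> \<open>The images of the free generators of \<open>F\<close> generate \<open>X\<close>,
    which makes them a finite test set for endomorphisms.\<close>
  let ?G = "(\<lambda>j. P.p (free_gen R {..<k} j)) ` {..<k}"
  have "Hom_zero R X (ses_mid (U n))"
  proof (rule P.universal_ses_Hom_zero[OF universal X X_module _ _ _ _ Suc])
    show "Hom_zero R X X'" if "X' \<in> \<X>" "X' \<noteq> X" for X'
      using semi X that by (auto simp: semibrick_def)
    show "finite ?G" by simp
    show "?G \<subseteq> carrier X" using P.presD(9) free_gen_closed[of _ "{..<k}"] F by auto
    fix g x assume g: "g \<in> mod_hom R X X" "\<And>b. b \<in> ?G \<Longrightarrow> g b = \<zero>\<^bsub>X\<^esub>" and x: "x \<in> carrier X"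
    obtain a where a: "a \<in> carrier P.F" "P.p a = x" using short_exact_preimage[OF P.exact_T x] by blast
    have "g (P.p a) = \<zero>\<^bsub>X\<^esub>"
      by (rule free_hom_eqI[OF P.presD(3) mod_hom_compose[OF P.presD(5) g(1), unfolded F] mod_hom_zero_map[OF P.presD(3)]])
        (use g(2) a F in auto)
    then show "g x = \<zero>\<^bsub>X\<^esub>" using a by simp
  qed
  then show ?case by (simp add: mid_U)
qed

lemma L_perp: "L \<in> perp01 R \<X>"
  unfolding perp01_def
proof (intro CollectI conjI ballI)
  fix X assume X: "X \<in> \<X>"
  obtain K T m k where fp: "fp_presentation R X K T m k" by (rule X_presentation[OF X])
  interpret P: proj_presentation R K T X "{..<k}" by (rule fp_presentation_proj[OF fp])
  have F: "P.F = free_module R {..<k}" using fp by (simp add: fp_presentation_def)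
  show "Hom_zero R X L"
    unfolding P.Hom_zero_iff[OF left_module_L]
  proof (intro ballI impI)
    fix g x assume g: "g \<in> mod_hom R P.F L" "\<forall>k\<in>carrier K. g (P.\<kappa> k) = \<zero>\<^bsub>L\<^esub>" and x: "x \<in> carrier P.F"
    \<comment> \<open>\<open>F\<close> is free of finite rank, so \<open>g\<close> comes from a
      stage; as that stage embeds into the limit, the lift already vanishes on
      \<open>K\<close>.\<close>
    obtain N \<theta> where "\<theta> \<in> mod_hom R (free_module R {..<k}) (Y N)"
        "\<And>x. x \<in> carrier (free_module R {..<k}) \<Longrightarrow> chain.emb N (\<theta> x) = g x"
      by (rule chain.free_lift_stage[OF g(1)[unfolded F, folded L_eq]]) (rule that)
    note \<theta> = this[folded F]
    have "\<theta> (P.\<kappa> a) = \<zero>\<^bsub>Y N\<^esub>" if a: "a \<in> carrier K" for a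
    proof (rule chain.emb_inj[of _ N])
      show "chain.emb N (\<theta> (P.\<kappa> a)) = chain.emb N \<zero>\<^bsub>Y N\<^esub>"
        using \<theta>(2) g(2) a P.presD(8) chain.emb_zero by (simp add: L_eq)
    qed (use mod_hom_closed[OF \<theta>(1)] P.presD(8) a in auto)
    then have "\<theta> x = \<zero>\<^bsub>Y N\<^esub>"
      using Hom_zero_Y[OF X, of N] P.Hom_zero_iff[OF chain.Y] \<theta>(1) x by blast
    then show "g x = \<zero>\<^bsub>L\<^esub>" using \<theta>(2)[OF x] chain.emb_zero by (simp add: L_eq)
  qed
  show "Ext1_zero R X L"
    unfolding P.Ext1_zero_iff[OF left_module_L]
  proof (intro ballI)
    fix \<phi> assume \<phi>: "\<phi> \<in> mod_hom R K L"
    obtain s q where sq: "s \<in> mod_hom R K (free_module R {..<m})" "q \<in> mod_hom R (free_module R {..<m}) K"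
      "\<And>x. x \<in> carrier K \<Longrightarrow> q (s x) = x" using fp by (auto simp: fp_presentation_def retract_of_free_def)
    \<comment> \<open>Only a free module lifts to a stage directly. So \<open>\<phi>\<close> is
      extended by \<open>q\<close> from \<open>K\<close> to the free module of rank
      \<open>m\<close>, lifted there, and brought back to \<open>K\<close> by \<open>s\<close>. The
      resulting class dies one stage later, hence the target \<open>Y (Suc N)\<close> of
      \<open>\<rho>\<close>.\<close>
    obtain N \<theta> where \<theta>: "\<theta> \<in> mod_hom R (free_module R {..<m}) (Y N)"
        "\<And>x. x \<in> carrier (free_module R {..<m}) \<Longrightarrow> chain.emb N (\<theta> x) = \<phi> (q x)"
      by (rule chain.free_lift_stage[OF mod_hom_compose[OF sq(2) \<phi>, folded L_eq]]) (rule that)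
    obtain \<rho> where \<rho>: "\<rho> \<in> mod_hom R P.F (Y (Suc N))" "\<And>k. k \<in> carrier K \<Longrightarrow> \<rho> (P.\<kappa> k) = ses_in (U N) (\<theta> (s k))"
      using P.universal_ses_extends[OF universal X X_module mod_hom_compose[OF sq(1) \<theta>(1)]]
      by (auto simp: P.extends_def mid_U)
    have "chain.emb (Suc N) (\<rho> (P.\<kappa> k)) = \<phi> k" if "k \<in> carrier K" for k
      using that \<rho>(2) \<theta>(2) sq(3) mod_hom_closed[OF sq(1)] by (simp add: chain.emb_f)
    then show "P.extends L \<phi>"
      unfolding P.extends_def by (intro bexI[OF _ mod_hom_compose[OF \<rho>(1) chain.emb_hom[unfolded L_eq]]]) auto
  qed
qed simp

lemma perpD:
  assumes "W \<in> perp01 R \<X>"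
  shows "left_module R W" "\<And>X. X \<in> \<X> \<Longrightarrow> Hom_zero R X W" "\<And>X. X \<in> \<X> \<Longrightarrow> Ext1_zero R X W"
  using assms by (auto simp: perp01_def)

text \<open>As \<open>Ext^1(X, W) = 0\<close>, a map into \<open>W\<close> extends over each chosen
  extension, hence over the universal sequence, hence stage by stage to the limit.\<close>

lemma \<alpha>_extend:
  fixes W :: "('r, 'w) module"
  assumes W: "W \<in> perp01 R \<X>" and h: "h \<in> mod_hom R (regular_module R) W"
  obtains g where "g \<in> mod_hom R L W" "\<And>r. r \<in> carrier R \<Longrightarrow> g (\<alpha> r) = h r"
proof -
  note w = perpD[OF W]
  obtain \<iota>' where \<iota>': "\<iota>' \<in> mod_iso R (Y 0) (regular_module R)" "\<And>r. r \<in> carrier R \<Longrightarrow> \<iota>' (\<iota> r) = r"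
    by (rule mod_iso_inverse[OF \<iota> left_module_regular chain.Y]) (rule that, simp_all)
  have step: "\<exists>G. G \<in> mod_hom R (Y (Suc n)) W \<and> (\<forall>y\<in>carrier (Y n). G (ses_in (U n) y) = g y)"
    if g: "g \<in> mod_hom R (Y n) W" for n g
  proof -
    have E: "short_exact R (Y n) (E n X i) X" if "X \<in> \<X>" "i \<in> I n X" for X i
      using universal[of n] that by (auto simp: universal_ses_def)
    have "\<exists>G. G \<in> mod_hom R (ses_mid (E n X i)) W \<and> (\<forall>y\<in>carrier (Y n). G (ses_in (E n X i) y) = g y)"
      if Xi: "X \<in> \<X>" "i \<in> I n X" for X i
    proof -
      obtain K T m k where fp: "fp_presentation R X K T m k" by (rule X_presentation[OF Xi(1)])
      interpret P: proj_presentation R K T X "{..<k}" by (rule fp_presentation_proj[OF fp])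
      show ?thesis
        by (rule P.perp_extend_ses[OF E[OF Xi] w(1) w(3)[OF Xi(1)] g]) blast
    qed
    then obtain G where G: "\<And>X i. X \<in> \<X> \<Longrightarrow> i \<in> I n X \<Longrightarrow> G X i \<in> mod_hom R (ses_mid (E n X i)) W"
      "\<And>X i y. X \<in> \<X> \<Longrightarrow> i \<in> I n X \<Longrightarrow> y \<in> carrier (Y n) \<Longrightarrow> G X i (ses_in (E n X i) y) = g y"
      by metis
    have "\<exists>G\<in>mod_hom R (ses_mid (U n)) W. \<forall>y\<in>carrier (Y n). G (ses_in (U n) y) = g y"
      by (rule universal_ses_components[OF universal[of n], where ?'w = 'w]) (use w(1) g G in blast)
    then show ?thesis by (auto simp: mid_U)
  qed
  \<comment> \<open>The extensions are chosen recursively, so consecutive ones are compatible by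
    construction. The recursion starts with \<open>h\<close>, moved to the copy \<open>Y 0\<close>
    of \<open>R\<close>.\<close>
  define \<phi> where "\<phi> = rec_nat (\<lambda>y. h (\<iota>' y)) (\<lambda>n g. SOME G. G \<in> mod_hom R (Y (Suc n)) W \<and> (\<forall>y\<in>carrier (Y n). G (ses_in (U n) y) = g y))"
  have \<phi>S: "\<phi> (Suc n) \<in> mod_hom R (Y (Suc n)) W \<and> (\<forall>y\<in>carrier (Y n). \<phi> (Suc n) (ses_in (U n) y) = \<phi> n y)"
    if "\<phi> n \<in> mod_hom R (Y n) W" for n
    using someI_ex[OF step[OF that]] by (simp add: \<phi>_def)
  have \<phi>0: "\<phi> 0 \<in> mod_hom R (Y 0) W"
    using mod_hom_compose[OF _ h, of \<iota>'] \<iota>'(1) by (simp add: \<phi>_def mod_iso_def)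
  have \<phi>: "\<phi> n \<in> mod_hom R (Y n) W" for n by (induction n) (use \<phi>0 \<phi>S in auto)
  obtain H where H: "H \<in> mod_hom R L W" "\<And>n x. x \<in> carrier (Y n) \<Longrightarrow> H (chain.emb n x) = \<phi> n x"
    using chain.limit_hom_exists[OF w(1), of \<phi>] \<phi> \<phi>S by (auto simp: L_eq)
  have "H (\<alpha> r) = h r" if "r \<in> carrier R" for r
    using H(2)[of "\<iota> r" 0] \<iota>'(2)[OF that] \<iota> that mod_hom_closed[of \<iota> "regular_module R" "Y 0" r]
    by (simp add: tower_embedding_def \<phi>_def mod_iso_def)
  with H(1) show thesis by (rule that)
qed

text \<open>From one stage to the next, a map into \<open>W\<close> has at most one extension
  because \<open>Hom(X, W) = 0\<close>. This lemma is the source of nearly all identities below: two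
  \<open>R\<close>-linear maps on \<open>L\<close> are compared on the image of
  \<open>\<alpha>\<close> only.\<close>

lemma \<alpha>_unique:
  assumes W: "W \<in> perp01 R \<X>" and g: "g \<in> mod_hom R L W" and h: "h \<in> mod_hom R L W"
    and eq: "\<And>r. r \<in> carrier R \<Longrightarrow> g (\<alpha> r) = h (\<alpha> r)" and x: "x \<in> carrier L"
  shows "g x = h x"
proof -
  note w = perpD[OF W]
  have "\<forall>y\<in>carrier (Y n). g (chain.emb n y) = h (chain.emb n y)" for n
  proof (induction n)
    case 0
    have "\<iota> ` carrier R = carrier (Y 0)" using \<iota> by (auto simp: mod_iso_def bij_betw_def)
    then show ?case using eq by (metis imageE tower_embedding_def)
  next
    case (Suc n)
    note c = mod_hom_compose[OF chain.emb_hom[unfolded L_eq]]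
    show ?case
    proof
      fix y assume "y \<in> carrier (Y (Suc n))"
      then show "g (chain.emb (Suc n) y) = h (chain.emb (Suc n) y)"
        using universal_ses_hom_unique[OF exact_U X_module w(1,2), unfolded mid_U, OF _ _ c[OF g] c[OF h], of n] Suc
        by (simp add: chain.emb_f)
    qed
  qed
  then show ?thesis using x chain.L_carrierE[of x] unfolding L_eq by metis
qed

end

section \<open>The ring structure\<close>

context localization_setup
begin

definition \<rho> :: "(nat \<times> 'm) set \<Rightarrow> (nat \<times> 'm) set \<Rightarrow> (nat \<times> 'm) set" where
  "\<rho> y = (SOME g. g \<in> mod_hom R L L \<and> (\<forall>r\<in>carrier R. g (\<alpha> r) = r \<odot>\<^bsub>L\<^esub> y))"

lemma \<rho>_hom: "y \<in> carrier L \<Longrightarrow> \<rho> y \<in> mod_hom R L L"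
  and \<rho>_\<alpha>: "y \<in> carrier L \<Longrightarrow> r \<in> carrier R \<Longrightarrow> \<rho> y (\<alpha> r) = r \<odot>\<^bsub>L\<^esub> y"
proof -
  assume y: "y \<in> carrier L"
  have "\<exists>g. g \<in> mod_hom R L L \<and> (\<forall>r\<in>carrier R. g (\<alpha> r) = r \<odot>\<^bsub>L\<^esub> y)"
    by (rule \<alpha>_extend[OF L_perp mod_hom_smult_right[OF left_module_L y]]) blast
  then have *: "\<rho> y \<in> mod_hom R L L \<and> (\<forall>r\<in>carrier R. \<rho> y (\<alpha> r) = r \<odot>\<^bsub>L\<^esub> y)"
    unfolding \<rho>_def by (rule someI_ex)
  then show "\<rho> y \<in> mod_hom R L L" by simp
  show "r \<in> carrier R \<Longrightarrow> \<rho> y (\<alpha> r) = r \<odot>\<^bsub>L\<^esub> y" using * by simp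
qed

text \<open>The arguments of \<open>\<rho>\<close> are swapped in the product because right
  multiplications, and not left ones, are homomorphisms of left modules.\<close>

definition S :: "(nat \<times> 'm) set ring" where
  "S = \<lparr>carrier = carrier L, monoid.mult = (\<lambda>x y. \<rho> y x), one = \<alpha> \<one>\<^bsub>R\<^esub>,
     ring.zero = \<zero>\<^bsub>L\<^esub>, ring.add = ring.add L\<rparr>"

lemma S_simps [simp]: "carrier S = carrier L" "x \<otimes>\<^bsub>S\<^esub> y = \<rho> y x" "\<one>\<^bsub>S\<^esub> = \<alpha> \<one>\<^bsub>R\<^esub>"
  "\<zero>\<^bsub>S\<^esub> = \<zero>\<^bsub>L\<^esub>" "x \<oplus>\<^bsub>S\<^esub> y = x \<oplus>\<^bsub>L\<^esub> y"
  by (simp_all add: S_def)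

lemma \<alpha>_closed [simp]: "r \<in> carrier R \<Longrightarrow> \<alpha> r \<in> carrier L"
  using mod_hom_closed[OF \<alpha>_hom] by simp

lemma \<rho>_closed [simp]: "x \<in> carrier L \<Longrightarrow> y \<in> carrier L \<Longrightarrow> \<rho> y x \<in> carrier L"
  using mod_hom_closed[OF \<rho>_hom] by simp

lemma \<alpha>_mult: "r \<in> carrier R \<Longrightarrow> s \<in> carrier R \<Longrightarrow> \<alpha> (r \<otimes>\<^bsub>R\<^esub> s) = r \<odot>\<^bsub>L\<^esub> \<alpha> s"
  using mod_hom_smult[OF \<alpha>_hom, of r s] by simp

text \<open>Distributivity in the left factor and the left unit law come from \<open>\<rho>\<close>
  directly. The right unit law, associativity and distributivity in the right factor each compare
  two \<open>R\<close>-linear endomorphisms of \<open>L\<close> that agree on the image of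
  \<open>\<alpha>\<close>.\<close>

lemma ring_S: "ring S"
proof (rule ringI)
  show "abelian_group S"
  proof (rule abelian_groupI)
    show "\<exists>y\<in>carrier S. y \<oplus>\<^bsub>S\<^esub> x = \<zero>\<^bsub>S\<^esub>" if "x \<in> carrier S" for x
      using that by (intro bexI[of _ "\<ominus>\<^bsub>L\<^esub> x"]) auto
  qed (auto simp: module_add_ac)
  show "monoid S"
  proof (rule monoidI)
    show "\<one>\<^bsub>S\<^esub> \<otimes>\<^bsub>S\<^esub> x = x" if "x \<in> carrier S" for x using that by (simp add: \<rho>_\<alpha>)
    show "x \<otimes>\<^bsub>S\<^esub> \<one>\<^bsub>S\<^esub> = x" if "x \<in> carrier S" for x
      using \<alpha>_unique[OF L_perp \<rho>_hom mod_hom_id, of "\<alpha> \<one>" x] that by (simp add: \<rho>_\<alpha> flip: \<alpha>_mult)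
    \<comment> \<open>As functions of \<open>x\<close>, the two sides are
      \<open>\<rho> z \<circ> \<rho> y\<close> and \<open>\<rho> (\<rho> z y)\<close>; at
      \<open>\<alpha> r\<close> both give the multiple of \<open>\<rho> z y\<close> by
      \<open>r\<close>.\<close>
    show "x \<otimes>\<^bsub>S\<^esub> y \<otimes>\<^bsub>S\<^esub> z = x \<otimes>\<^bsub>S\<^esub> (y \<otimes>\<^bsub>S\<^esub> z)"
      if "x \<in> carrier S" "y \<in> carrier S" "z \<in> carrier S" for x y z
      using \<alpha>_unique[OF L_perp mod_hom_compose[OF \<rho>_hom \<rho>_hom] \<rho>_hom, of y z "\<rho> z y" x] that
      by (simp add: \<rho>_\<alpha> mod_hom_smult[OF \<rho>_hom])
  qed auto
  fix x y z assume xyz: "x \<in> carrier S" "y \<in> carrier S" "z \<in> carrier S"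
  then show "(x \<oplus>\<^bsub>S\<^esub> y) \<otimes>\<^bsub>S\<^esub> z = x \<otimes>\<^bsub>S\<^esub> z \<oplus>\<^bsub>S\<^esub> y \<otimes>\<^bsub>S\<^esub> z"
    by (simp add: mod_hom_add[OF \<rho>_hom])
  show "z \<otimes>\<^bsub>S\<^esub> (x \<oplus>\<^bsub>S\<^esub> y) = z \<otimes>\<^bsub>S\<^esub> x \<oplus>\<^bsub>S\<^esub> z \<otimes>\<^bsub>S\<^esub> y"
    using \<alpha>_unique[OF L_perp \<rho>_hom mod_hom_plus[OF left_module_L \<rho>_hom \<rho>_hom], of "x \<oplus>\<^bsub>L\<^esub> y" x y z] xyz
    by (simp add: \<rho>_\<alpha> module_smult_r_distr)
qed

sublocale S: base_ring S by (simp add: base_ring_def ring_S)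

lemma \<alpha>_ring_hom: "\<alpha> \<in> ring_hom R S"
  by (rule ring_hom_memI) (auto simp: \<rho>_\<alpha> \<alpha>_mult mod_hom_add[OF \<alpha>_hom, simplified])

lemma ring_structure_S: "ring_structure_on R L \<alpha> S"
  unfolding ring_structure_on_def using ring_S \<alpha>_ring_hom by (auto simp: \<rho>_\<alpha>)

text \<open>In any compatible ring structure, right multiplication by \<open>y\<close> is
  \<open>R\<close>-linear and sends \<open>\<alpha> r\<close> to the multiple of \<open>y\<close> by
  \<open>r\<close>. This determines it.\<close>

lemma ring_structure_unique:
  assumes S': "ring_structure_on R L \<alpha> S'" and xy: "x \<in> carrier L" "y \<in> carrier L"
  shows "x \<otimes>\<^bsub>S'\<^esub> y = x \<otimes>\<^bsub>S\<^esub> y"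
proof -
  interpret S': ring S' using S' by (simp add: ring_structure_on_def)
  have c: "carrier S' = carrier L" and a: "\<And>x y. x \<in> carrier L \<Longrightarrow> y \<in> carrier L \<Longrightarrow> x \<oplus>\<^bsub>S'\<^esub> y = x \<oplus>\<^bsub>L\<^esub> y"
    and s: "\<And>r x. r \<in> carrier R \<Longrightarrow> x \<in> carrier L \<Longrightarrow> r \<odot>\<^bsub>L\<^esub> x = \<alpha> r \<otimes>\<^bsub>S'\<^esub> x"
    using S' by (auto simp: ring_structure_on_def)
  have m: "x \<otimes>\<^bsub>S'\<^esub> y \<in> carrier L" if "x \<in> carrier L" "y \<in> carrier L" for x y
    using S'.m_closed that c by simp
  have h: "(\<lambda>x. x \<otimes>\<^bsub>S'\<^esub> y) \<in> mod_hom R L L"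
  proof (rule mod_homI)
    fix u v assume u: "u \<in> carrier L" 
    then show "u \<otimes>\<^bsub>S'\<^esub> y \<in> carrier L" using m xy by simp
    show "(r \<odot>\<^bsub>L\<^esub> u) \<otimes>\<^bsub>S'\<^esub> y = r \<odot>\<^bsub>L\<^esub> (u \<otimes>\<^bsub>S'\<^esub> y)" if "r \<in> carrier R" for r
      using u xy m s that S'.m_assoc[of "\<alpha> r" u y] c by simp
    assume v: "v \<in> carrier L"
    then show "(u \<oplus>\<^bsub>L\<^esub> v) \<otimes>\<^bsub>S'\<^esub> y = u \<otimes>\<^bsub>S'\<^esub> y \<oplus>\<^bsub>L\<^esub> v \<otimes>\<^bsub>S'\<^esub> y"
      using u xy m a S'.l_distr[of u v y] c by simp
  qed
  show ?thesis using \<alpha>_unique[OF L_perp h \<rho>_hom[OF xy(2)] _ xy(1)] xy s by (simp add: \<rho>_\<alpha>)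
qed

section \<open>Modules over \<open>S\<close> and the perpendicular class\<close>

lemma restrict_module: "left_module S V \<Longrightarrow> left_module R (restrict_scalars \<alpha> V)"
  by (rule left_module_restrict_scalars[OF ring_S \<alpha>_ring_hom])

text \<open>The unit of extension of scalars for a free module of rank \<open>n\<close>, written in
  coordinates.\<close>

definition \<alpha>vec :: "nat \<Rightarrow> (nat \<Rightarrow> 'r) \<Rightarrow> nat \<Rightarrow> (nat \<times> 'm) set" where
  "\<alpha>vec n x = (\<lambda>j\<in>{..<n}. \<alpha> (x j))"

lemma freeS_fin_carrier:
  "x \<in> carrier (free_module S {..<n::nat}) \<longleftrightarrow> x \<in> extensional {..<n} \<and> (\<forall>j<n. x j \<in> carrier L)"
  unfolding free_module_def S.dsum_carrier_iff by auto

lemma vec_hom: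
  assumes t: "\<And>j. j < n \<Longrightarrow> t j \<in> mod_hom R A L"
  shows "(\<lambda>x. \<lambda>j\<in>{..<n}. t j x) \<in> mod_hom R A (restrict_scalars \<alpha> (free_module S {..<n::nat}))"
proof (rule mod_homI)
  fix x assume x: "x \<in> carrier A"
  show "(\<lambda>j\<in>{..<n}. t j x) \<in> carrier (restrict_scalars \<alpha> (free_module S {..<n}))"
    using mod_hom_closed[OF t x] by (simp add: freeS_fin_carrier)
  show "(\<lambda>j\<in>{..<n}. t j (x \<oplus>\<^bsub>A\<^esub> y)) = (\<lambda>j\<in>{..<n}. t j x) \<oplus>\<^bsub>restrict_scalars \<alpha> (free_module S {..<n})\<^esub> (\<lambda>j\<in>{..<n}. t j y)"
    if "y \<in> carrier A" for y
    using x that mod_hom_add[OF t] by (auto simp: free_module_def dsum_add fun_eq_iff)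
  show "(\<lambda>j\<in>{..<n}. t j (r \<odot>\<^bsub>A\<^esub> x)) = r \<odot>\<^bsub>restrict_scalars \<alpha> (free_module S {..<n})\<^esub> (\<lambda>j\<in>{..<n}. t j x)"
    if "r \<in> carrier R" for r
    using x that mod_hom_smult[OF t] mod_hom_closed[OF t x] \<rho>_\<alpha> by (auto simp: free_module_def dsum_smult fun_eq_iff)
qed

lemma coord_hom:
  assumes j: "j < n"
  shows "(\<lambda>x. x j) \<in> mod_hom R (restrict_scalars \<alpha> (free_module S {..<n::nat})) L"
  by (rule mod_homI) (use j in \<open>auto simp: freeS_fin_carrier\<close>,
    use j in \<open>auto simp: free_module_def dsum_add dsum_smult S.dsum_carrier_iff \<rho>_\<alpha>\<close>)

lemma \<alpha>vec_hom: "\<alpha>vec n \<in> mod_hom R (free_module R {..<n}) (restrict_scalars \<alpha> (free_module S {..<n}))"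
proof -
  have "(\<lambda>x. \<alpha> (x j)) \<in> mod_hom R (free_module R {..<n}) L" if "j < n" for j
    using mod_hom_compose[OF dsum_coord[of j "{..<n}" "\<lambda>_. regular_module R"] \<alpha>_hom] that by (simp add: free_module_def)
  then show ?thesis unfolding \<alpha>vec_def[abs_def] by (rule vec_hom)
qed

lemma \<alpha>vec_gen: "j < n \<Longrightarrow> \<alpha>vec n (free_gen R {..<n} j) = free_gen S {..<n} j"
  using mod_hom_zero[OF \<alpha>_hom left_module_regular left_module_L]
  by (auto simp: \<alpha>vec_def free_gen_def dsum_single_def fun_eq_iff)

text \<open>Vanishing is known for \<open>L\<close> only. It is applied to the finitely many
  coordinates of maps into \<open>S^m\<close> and \<open>S^n\<close>. Maps into an arbitrary
  \<open>V\<close> are then reached through \<open>S\<close>-linear maps out of \<open>S^m\<close>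
  and \<open>S^n\<close>, which are determined freely on generators.\<close>

lemma restrict_perp:
  fixes V :: "((nat \<times> 'm) set, 'v) module"
  assumes V: "left_module S V"
  shows "restrict_scalars \<alpha> V \<in> perp01 R \<X>"
  unfolding perp01_def
proof (intro CollectI conjI ballI)
  let ?V = "restrict_scalars \<alpha> V"
  show V': "left_module R ?V" by (rule restrict_module[OF V])
  fix X assume X: "X \<in> \<X>"
  obtain K T m n where fp: "fp_presentation R X K T m n" by (rule X_presentation[OF X])
  interpret P: proj_presentation R K T X "{..<n}" by (rule fp_presentation_proj[OF fp])
  have F: "P.F = free_module R {..<n}" using fp by (simp add: fp_presentation_def)
  obtain s q where s: "s \<in> mod_hom R K (free_module R {..<m})" and q: "q \<in> mod_hom R (free_module R {..<m}) K"
    and qs: "\<And>x. x \<in> carrier K \<Longrightarrow> q (s x) = x" using fp by (auto simp: fp_presentation_def retract_of_free_def)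
  have FS: "left_module S (free_module S {..<k::nat})" for k by simp
  note FSR = restrict_module[OF FS]
  note resh = mod_hom_restrict_scalars[OF \<alpha>_ring_hom]
  \<comment> \<open>The coordinates of the composite \<open>K -> R^m -> S^m\<close> are maps from
    \<open>K\<close> to \<open>L\<close>. Each extends to \<open>F\<close> because
    \<open>Ext^1(X, L) = 0\<close>.\<close>
  have "\<exists>t. t \<in> mod_hom R P.F L \<and> (\<forall>k\<in>carrier K. t (P.\<kappa> k) = \<alpha>vec m (s k) i)" if i: "i < m" for i
  proof -
    have "(\<lambda>k. \<alpha>vec m (s k) i) \<in> mod_hom R K L"
      by (rule mod_hom_compose[OF mod_hom_compose[OF s \<alpha>vec_hom] coord_hom[OF i]])
    then show ?thesis using P.Ext1_zero_iff[OF left_module_L] perpD(3)[OF L_perp X] by (auto simp: P.extends_def)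
  qed
  then obtain t where t: "\<And>i. i < m \<Longrightarrow> t i \<in> mod_hom R P.F L"
    "\<And>i k. i < m \<Longrightarrow> k \<in> carrier K \<Longrightarrow> t i (P.\<kappa> k) = \<alpha>vec m (s k) i" by metis
  \<comment> \<open>\<open>\<tau>\<close> is the inverse of the inclusion \<open>K \<rightarrow> F\<close> after extension of scalars to \<open>S\<close>, with values
    in \<open>S\<^sup>m\<close> instead of its direct summand \<open>S \<otimes> K\<close>.\<close>
  define \<tau> where "\<tau> x = (\<lambda>i\<in>{..<m}. t i x)" for x
  have \<tau>: "\<tau> \<in> mod_hom R P.F (restrict_scalars \<alpha> (free_module S {..<m}))"
    unfolding \<tau>_def[abs_def] by (rule vec_hom[OF t(1)])
  have \<tau>\<kappa>: "\<tau> (P.\<kappa> k) = \<alpha>vec m (s k)" if "k \<in> carrier K" for k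
    using t(2) that by (auto simp: \<tau>_def fun_eq_iff \<alpha>vec_def)
  have gen: "free_gen R {..<k} i \<in> carrier (free_module R {..<k})" if "i < k" for i k :: nat
    using that by (simp add: free_gen_closed)
  show "Ext1_zero R X ?V"
    unfolding P.Ext1_zero_iff[OF V']
  proof (intro ballI)
    fix \<phi> assume \<phi>: "\<phi> \<in> mod_hom R K ?V"
    \<comment> \<open>\<open>\<gamma>\<close> is the \<open>S\<close>-linear extension of
      \<open>\<phi> \<circ> q\<close>. Following \<open>\<tau>\<close> by \<open>\<gamma>\<close>
      extends \<open>\<phi>\<close> to \<open>F\<close>, as \<open>q \<circ> s\<close> is the
      identity on \<open>K\<close>.\<close>
    obtain \<gamma> where \<gamma>: "\<gamma> \<in> mod_hom S (free_module S {..<m}) V"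
        "\<And>i. i \<in> {..<m} \<Longrightarrow> \<gamma> (free_gen S {..<m} i) = \<phi> (q (free_gen R {..<m} i))"
      by (rule S.free_extend[OF V, of "{..<m}" "\<lambda>i. \<phi> (q (free_gen R {..<m} i))"])
        (use mod_hom_closed[OF \<phi> mod_hom_closed[OF q gen]] in auto)
    have "\<gamma> (\<alpha>vec m y) = \<phi> (q y)" if "y \<in> carrier (free_module R {..<m})" for y
      by (rule free_hom_eqI[OF V' mod_hom_compose[OF \<alpha>vec_hom resh[OF \<gamma>(1)]] mod_hom_compose[OF q \<phi>] _ that])
        (simp add: \<alpha>vec_gen \<gamma>(2))
    then have "\<gamma> (\<tau> (P.\<kappa> k)) = \<phi> k" if "k \<in> carrier K" for k
      using that \<tau>\<kappa> qs mod_hom_closed[OF s] by simp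
    then show "P.extends ?V \<phi>" unfolding P.extends_def
      by (intro bexI[OF _ mod_hom_compose[OF \<tau> resh[OF \<gamma>(1)]]]) auto
  qed
  show "Hom_zero R X ?V"
    unfolding P.Hom_zero_iff[OF V']
  proof (intro ballI impI)
    fix \<theta> x assume \<theta>: "\<theta> \<in> mod_hom R P.F ?V" "\<forall>k\<in>carrier K. \<theta> (P.\<kappa> k) = \<zero>\<^bsub>?V\<^esub>" and x: "x \<in> carrier P.F"
    obtain \<gamma> where \<gamma>: "\<gamma> \<in> mod_hom S (free_module S {..<n}) V"
        "\<And>j. j \<in> {..<n} \<Longrightarrow> \<gamma> (free_gen S {..<n} j) = \<theta> (free_gen R {..<n} j)"
      by (rule S.free_extend[OF V, of "{..<n}" "\<lambda>j. \<theta> (free_gen R {..<n} j)"])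
        (use mod_hom_closed[OF \<theta>(1)] gen F in auto)
    have \<theta>\<gamma>: "\<theta> y = \<gamma> (\<alpha>vec n y)" if "y \<in> carrier P.F" for y
      by (rule free_hom_eqI[OF V' \<theta>(1)[unfolded F] mod_hom_compose[OF \<alpha>vec_hom resh[OF \<gamma>(1)]] _ that[unfolded F]])
        (simp add: \<alpha>vec_gen \<gamma>(2))
    have \<kappa>q: "P.\<kappa> (q y) \<in> carrier P.F" if "y \<in> carrier (free_module R {..<m})" for y
      using that mod_hom_closed[OF q] P.presD(8) by simp
    note \<alpha>n = \<alpha>vec_hom[of n, folded F]
    \<comment> \<open>\<open>B\<close> is the matrix over \<open>S\<close> of the composite
      \<open>R^m -> K -> F\<close>.\<close>
    obtain B where B: "B \<in> mod_hom S (free_module S {..<m}) (free_module S {..<n})"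
        "\<And>i. i \<in> {..<m} \<Longrightarrow> B (free_gen S {..<m} i) = \<alpha>vec n (P.\<kappa> (q (free_gen R {..<m} i)))"
      by (rule S.free_extend[OF FS[of n], of "{..<m}" "\<lambda>i. \<alpha>vec n (P.\<kappa> (q (free_gen R {..<m} i)))"])
        (use mod_hom_closed[OF \<alpha>n \<kappa>q[OF gen]] in auto)
    have B\<alpha>: "B (\<alpha>vec m y) = \<alpha>vec n (P.\<kappa> (q y))" if "y \<in> carrier (free_module R {..<m})" for y
      by (rule free_hom_eqI[OF FSR mod_hom_compose[OF \<alpha>vec_hom resh[OF B(1)]]
            mod_hom_compose[OF mod_hom_compose[OF q P.presD(4)] \<alpha>n] _ that])
        (simp add: \<alpha>vec_gen B(2))
    note B\<tau> = mod_hom_compose[OF \<tau> resh[OF B(1)]]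
    \<comment> \<open>Coordinatewise, both sides are maps from \<open>F\<close> to \<open>L\<close>
      that agree on \<open>K\<close>; since \<open>Hom(X, L) = 0\<close>, they agree on
      \<open>F\<close>.\<close>
    have "B (\<tau> x) = \<alpha>vec n x"
    proof (rule extensionalityI[of _ "{..<n}"])
      show "B (\<tau> x) \<in> extensional {..<n}" using mod_hom_closed[OF B\<tau> x] by (simp add: freeS_fin_carrier)
      show "\<alpha>vec n x \<in> extensional {..<n}" using mod_hom_closed[OF \<alpha>n x] by (simp add: freeS_fin_carrier)
      fix j assume "j \<in> {..<n}"
      then have j: "j < n" by simp
      let ?d = "\<lambda>x. B (\<tau> x) j \<ominus>\<^bsub>L\<^esub> \<alpha>vec n x j"
      have c1: "(\<lambda>x. B (\<tau> x) j) \<in> mod_hom R P.F L" and c2: "(\<lambda>x. \<alpha>vec n x j) \<in> mod_hom R P.F L"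
        by (rule mod_hom_compose[OF B\<tau> coord_hom[OF j]], rule mod_hom_compose[OF \<alpha>n coord_hom[OF j]])
      have "?d (P.\<kappa> k) = \<zero>\<^bsub>L\<^esub>" if k: "k \<in> carrier K" for k
        using \<tau>\<kappa>[OF k] B\<alpha>[OF mod_hom_closed[OF s k]] qs[OF k] mod_hom_closed[OF c2 P.presD(8)[OF k]] by simp
      then have "?d x = \<zero>\<^bsub>L\<^esub>"
        using P.Hom_zero_iff[OF left_module_L, THEN iffD1, OF perpD(2)[OF L_perp X],
            THEN bspec, OF mod_hom_minus[OF left_module_L c1 c2]] x by simp
      then show "B (\<tau> x) j = \<alpha>vec n x j" using mod_hom_closed[OF c1 x] mod_hom_closed[OF c2 x] by simp
    qed
    then have "\<theta> x = \<gamma> (B (\<tau> x))" using \<theta>\<gamma>[OF x] by simp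
    \<comment> \<open>\<open>\<gamma> \<circ> B\<close> is the \<open>S\<close>-linear extension of
      \<open>\<theta> \<circ> \<kappa> \<circ> q\<close>, which is zero.\<close>
    also have "\<dots> = \<zero>\<^bsub>V\<^esub>"
    proof (rule S.free_hom_eqI[OF V S.mod_hom_compose[OF B(1) \<gamma>(1)] S.mod_hom_zero_map[OF V]])
      show "\<tau> x \<in> carrier (free_module S {..<m})" using mod_hom_closed[OF \<tau> x] by simp
      show "\<gamma> (B (free_gen S {..<m} i)) = \<zero>\<^bsub>V\<^esub>" if "i \<in> {..<m}" for i
        using that \<theta>(2) \<theta>\<gamma>[OF \<kappa>q[OF gen], of i] mod_hom_closed[OF q gen, of i] by (simp add: B(2))
    qed
    finally show "\<theta> x = \<zero>\<^bsub>?V\<^esub>" by simp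
  qed
qed

lemma mod_iso_perp:
  fixes M :: "('r, 'a) module" and N :: "('r, 'b) module"
  assumes h: "h \<in> mod_iso R M N" and M: "M \<in> perp01 R \<X>" and N: "left_module R N"
  shows "N \<in> perp01 R \<X>"
  unfolding perp01_def
proof (intro CollectI conjI ballI N)
  note m = perpD[OF M]
  fix X assume X: "X \<in> \<X>"
  show "Hom_zero R X N" by (rule mod_iso_Hom_zero[OF h m(1) N m(2)[OF X]])
  obtain K T k n where fp: "fp_presentation R X K T k n" by (rule X_presentation[OF X])
  interpret P: proj_presentation R K T X "{..<n}" by (rule fp_presentation_proj[OF fp])
  obtain g where g: "g \<in> mod_iso R N M" "\<And>y. y \<in> carrier N \<Longrightarrow> h (g y) = y"
    by (rule mod_iso_inverse[OF h m(1) N]) (rule that)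
  have gh: "g \<in> mod_hom R N M" "h \<in> mod_hom R M N" using g h by (auto simp: mod_iso_def)
  show "Ext1_zero R X N"
    unfolding P.Ext1_zero_iff[OF N]
  proof
    fix \<phi> assume \<phi>: "\<phi> \<in> mod_hom R K N"
    have "P.extends M (\<lambda>k. g (\<phi> k))"
      using m(3)[OF X] P.Ext1_zero_iff[OF m(1)] mod_hom_compose[OF \<phi> gh(1)] by blast
    then obtain \<theta> where \<theta>: "\<theta> \<in> mod_hom R P.F M" "\<And>k. k \<in> carrier K \<Longrightarrow> \<theta> (P.\<kappa> k) = g (\<phi> k)"
      by (auto simp: P.extends_def)
    show "P.extends N \<phi>" unfolding P.extends_def
      by (intro bexI[OF _ mod_hom_compose[OF \<theta>(1) gh(2)]]) (auto simp: \<theta>(2) g(2) mod_hom_closed[OF \<phi>])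
  qed
qed

text \<open>For \<open>W\<close> in the perpendicular class, the orbit map of \<open>w\<close> on
  \<open>R\<close> extends uniquely to \<open>L\<close>, and its value at \<open>s\<close> is
  declared to be the action of \<open>s\<close> on \<open>w\<close>. Uniqueness turns the module
  laws over \<open>R\<close> into those over \<open>S\<close>.\<close>

lemma restriction_image_eq: "restriction_image R S \<alpha> = (perp01 R \<X> :: ('r, 'u) module set)"
proof (intro equalityI subsetI)
  fix W :: "('r, 'u) module" assume "W \<in> restriction_image R S \<alpha>"
  then obtain V :: "((nat \<times> 'm) set, 'u) module" and h where W: "left_module R W" and V: "left_module S V"
    and h: "h \<in> mod_iso R W (restrict_scalars \<alpha> V)"
    by (auto simp: restriction_image_def mod_isomorphic_def)
  obtain g where g: "g \<in> mod_iso R (restrict_scalars \<alpha> V) W"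
    by (rule mod_iso_inverse[OF h W restrict_module[OF V]]) (rule that)
  show "W \<in> perp01 R \<X>" by (rule mod_iso_perp[OF g restrict_perp[OF V] W])
next
  fix W :: "('r, 'u) module" assume Wp: "W \<in> perp01 R \<X>"
  note W = perpD(1)[OF Wp]
  define act where "act w = (SOME g. g \<in> mod_hom R L W \<and> (\<forall>r\<in>carrier R. g (\<alpha> r) = r \<odot>\<^bsub>W\<^esub> w))" for w
  have act: "act w \<in> mod_hom R L W \<and> (\<forall>r\<in>carrier R. act w (\<alpha> r) = r \<odot>\<^bsub>W\<^esub> w)" if w: "w \<in> carrier W" for w
  proof -
    have "\<exists>g. g \<in> mod_hom R L W \<and> (\<forall>r\<in>carrier R. g (\<alpha> r) = r \<odot>\<^bsub>W\<^esub> w)"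
      by (rule \<alpha>_extend[OF Wp mod_hom_smult_right[OF W w]]) blast
    then show ?thesis unfolding act_def by (rule someI_ex)
  qed
  then have ah: "act w \<in> mod_hom R L W" and a\<alpha>: "\<And>r. r \<in> carrier R \<Longrightarrow> act w (\<alpha> r) = r \<odot>\<^bsub>W\<^esub> w" if "w \<in> carrier W" for w
    using that by auto
  define V :: "((nat \<times> 'm) set, 'u) module" where "V = \<lparr>carrier = carrier W, monoid.mult = undefined, one = undefined,
    ring.zero = \<zero>\<^bsub>W\<^esub>, ring.add = ring.add W, smult = (\<lambda>s w. act w s)\<rparr>"
  have V: "left_module S V"
  proof (rule S.left_moduleI)
    show "abelian_group V"
    proof (rule abelian_groupI)
      show "\<exists>y\<in>carrier V. y \<oplus>\<^bsub>V\<^esub> x = \<zero>\<^bsub>V\<^esub>" if "x \<in> carrier V" for x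
        using that W by (intro bexI[of _ "\<ominus>\<^bsub>W\<^esub> x"]) (auto simp: V_def)
    qed (use W in \<open>auto simp: V_def module_add_ac\<close>)
    fix a x assume a: "a \<in> carrier S" and x: "x \<in> carrier V"
    have x': "x \<in> carrier W" using x by (simp add: V_def)
    show "a \<odot>\<^bsub>V\<^esub> x \<in> carrier V" using a x mod_hom_closed[OF ah] by (simp add: V_def)
    show "(a \<oplus>\<^bsub>S\<^esub> b) \<odot>\<^bsub>V\<^esub> x = a \<odot>\<^bsub>V\<^esub> x \<oplus>\<^bsub>V\<^esub> b \<odot>\<^bsub>V\<^esub> x" if "b \<in> carrier S" for b
      using a x that mod_hom_add[OF ah] by (simp add: V_def)
    show "a \<odot>\<^bsub>V\<^esub> (x \<oplus>\<^bsub>V\<^esub> y) = a \<odot>\<^bsub>V\<^esub> x \<oplus>\<^bsub>V\<^esub> a \<odot>\<^bsub>V\<^esub> y" if "y \<in> carrier V" for y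
    proof -
      have y': "y \<in> carrier W" using that by (simp add: V_def)
      have xy: "x \<oplus>\<^bsub>W\<^esub> y \<in> carrier W" using x' y' W by simp
      show ?thesis
        using \<alpha>_unique[OF Wp ah[OF xy] mod_hom_plus[OF W ah[OF x'] ah[OF y']], of a] a W x' y'
        by (simp add: V_def a\<alpha> module_smult_r_distr)
    qed
    show "(a \<otimes>\<^bsub>S\<^esub> b) \<odot>\<^bsub>V\<^esub> x = a \<odot>\<^bsub>V\<^esub> (b \<odot>\<^bsub>V\<^esub> x)" if b: "b \<in> carrier S" for b
    proof -
      have b': "b \<in> carrier L" using b by simp
      have bx: "act x b \<in> carrier W" using mod_hom_closed[OF ah[OF x'] b'] .
      show ?thesis
        using \<alpha>_unique[OF Wp mod_hom_compose[OF \<rho>_hom[OF b'] ah[OF x']] ah[OF bx], of a] a W b' bx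
        by (simp add: V_def a\<alpha> \<rho>_\<alpha> mod_hom_smult[OF ah[OF x']])
    qed
  next
    fix x assume "x \<in> carrier V"
    then show "\<one>\<^bsub>S\<^esub> \<odot>\<^bsub>V\<^esub> x = x" using W by (simp add: V_def a\<alpha>)
  qed
  \<comment> \<open>The action of \<open>\<alpha> r\<close> is the given action of \<open>r\<close>,
    so the identity is an isomorphism.\<close>
  have "(\<lambda>x. x) \<in> mod_iso R W (restrict_scalars \<alpha> V)"
    unfolding mod_iso_def using W a\<alpha> by (auto intro!: mod_homI simp: V_def bij_betw_def)
  then show "W \<in> restriction_image R S \<alpha>"
    using W V by (auto simp: restriction_image_def mod_isomorphic_def)
qed

lemma ring_module:
  assumes T: "ring T" and g: "g \<in> ring_hom S T"
  shows "left_module S (restrict_scalars g (regular_module T))"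
proof -
  interpret T: base_ring T using T by (simp add: base_ring_def)
  show ?thesis by (rule S.left_module_restrict_scalars[OF T g T.left_module_regular])
qed

text \<open>Made an \<open>S\<close>-module through \<open>g\<close>, the ring \<open>T\<close> lies
  in the perpendicular class. As \<open>h\<close> agrees with \<open>g\<close> on the image of
  \<open>\<alpha>\<close>, both are \<open>R\<close>-linear into this one module, and
  \<open>\<alpha>_unique\<close> applies.\<close>

lemma \<alpha>_ring_epi: "ring_epi TYPE('t) R S \<alpha>"
  unfolding ring_epi_def
proof (intro conjI allI impI ballI \<alpha>_ring_hom)
  fix T :: "'t ring" and g h s
  assume T: "ring T" and g: "g \<in> ring_hom S T" and h: "h \<in> ring_hom S T"
    and eq: "\<forall>r\<in>carrier R. g (\<alpha> r) = h (\<alpha> r)" and s: "s \<in> carrier S"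
  interpret T: base_ring T using T by (simp add: base_ring_def)
  let ?W = "restrict_scalars \<alpha> (restrict_scalars g (regular_module T))"
  have lin: "f \<in> mod_hom R L ?W" if f: "f \<in> ring_hom S T" and e: "\<forall>r\<in>carrier R. g (\<alpha> r) = f (\<alpha> r)" for f
  proof (rule mod_homI)
    show "f (r \<odot>\<^bsub>L\<^esub> x) = r \<odot>\<^bsub>?W\<^esub> f x" if "r \<in> carrier R" "x \<in> carrier L" for r x
      using ring_hom_mult[OF f, of "\<alpha> r" x] that e by (simp add: \<rho>_\<alpha>)
  qed (use ring_hom_closed[OF f] ring_hom_add[OF f] in auto)
  show "g s = h s"
    by (rule \<alpha>_unique[OF restrict_perp[OF ring_module[OF T g]] lin[OF g] lin[OF h eq]]) (use eq s in auto)
qed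

lemma \<alpha>_reflection: "perp01_reflection TYPE('u) R \<X> (regular_module R) L \<alpha>"
  unfolding perp01_reflection_def
proof (intro conjI ballI L_perp \<alpha>_hom)
  fix W :: "('r, 'u) module" and h assume W: "W \<in> perp01 R \<X>" and h: "h \<in> mod_hom R (regular_module R) W"
  obtain g where g: "g \<in> mod_hom R L W" "\<And>r. r \<in> carrier R \<Longrightarrow> g (\<alpha> r) = h r"
    by (rule \<alpha>_extend[OF W h]) (rule that)
  show "\<exists>!g. g \<in> mod_hom R L W \<inter> extensional (carrier L) \<and> (\<forall>x\<in>carrier (regular_module R). g (\<alpha> x) = h x)"
  proof (rule ex1I[of _ "restrict g (carrier L)"])
    show "restrict g (carrier L) \<in> mod_hom R L W \<inter> extensional (carrier L) \<and>
        (\<forall>x\<in>carrier (regular_module R). restrict g (carrier L) (\<alpha> x) = h x)"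
      using mod_hom_cong[OF g(1) left_module_L, of "restrict g (carrier L)"] g(2) by auto
    fix k assume k: "k \<in> mod_hom R L W \<inter> extensional (carrier L) \<and> (\<forall>x\<in>carrier (regular_module R). k (\<alpha> x) = h x)"
    show "k = restrict g (carrier L)"
      by (rule extensionalityI[of _ "carrier L"]) (use k \<alpha>_unique[OF W _ g(1)] g(2) in auto)
  qed
qed

end

section \<open>Extension of scalars\<close>

text \<open>The target ring is generic: the locale is interpreted for the ring on \<open>L\<close>
  and for the test rings of the universal property.\<close>

locale scalar_extension = base_ring R + S: base_ring S
  for R :: "'r ring" (structure) and S :: "'s ring" +
  fixes \<phi> :: "'r \<Rightarrow> 's"
  assumes \<phi>: "\<phi> \<in> ring_hom R S"
begin

abbreviation "rel P \<equiv> tensor_rel R S \<phi> P"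
abbreviation "tc P \<equiv> tensor_class R S \<phi> P"
abbreviation "ten P \<equiv> tensor R S \<phi> P"
abbreviation "res V \<equiv> restrict_scalars \<phi> V"
abbreviation "supported P c \<equiv> Poly_Mapping.keys c \<subseteq> carrier S \<times> carrier P"

text \<open>The unit of extension of scalars, sending \<open>x\<close> to the tensor
  \<open>1 \<otimes> x\<close>.\<close>

definition unit_map :: "('r, 'p) module \<Rightarrow> 'p \<Rightarrow> ('s \<times> 'p \<Rightarrow>\<^sub>0 int) set" where
  "unit_map P x = tc P (frag_of (\<one>\<^bsub>S\<^esub>, x))"

text \<open>Multiplication by \<open>s\<close> on formal sums, before the relations are divided
  out.\<close>

definition act :: "'s \<Rightarrow> ('s \<times> 'p \<Rightarrow>\<^sub>0 int) \<Rightarrow> ('s \<times> 'p \<Rightarrow>\<^sub>0 int)" where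
  "act s = frag_extend (\<lambda>(t, x). frag_of (s \<otimes>\<^bsub>S\<^esub> t, x))"

section \<open>Formal sums and the tensor relations\<close>

lemma \<phi>_closed [simp]: "r \<in> carrier R \<Longrightarrow> \<phi> r \<in> carrier S"
  by (rule ring_hom_closed[OF \<phi>])

lemma supported_diff: "supported P c \<Longrightarrow> supported P d \<Longrightarrow> supported P (c - d)"
  using keys_diff[of c d] by blast

lemma supported_add: "supported P c \<Longrightarrow> supported P d \<Longrightarrow> supported P (c + d)"
  using Poly_Mapping.keys_add[of c d] by blast

lemma supported_induct [consumes 1, case_names zero diff gen]:
  assumes "supported P c" "Q 0"
    "\<And>c d. supported P c \<Longrightarrow> supported P d \<Longrightarrow> Q c \<Longrightarrow> Q d \<Longrightarrow> Q (c - d)"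
    "\<And>s x. s \<in> carrier S \<Longrightarrow> x \<in> carrier P \<Longrightarrow> Q (frag_of (s, x))"
  shows "Q c"
  using assms by (intro free_Abelian_group_induct[of c "carrier S \<times> carrier P" Q]) auto

lemma rel_subgroup:
  assumes P: "left_module R P"
  shows "subgroup (rel P) (free_Abelian_group (carrier S \<times> carrier P))"
  unfolding tensor_rel_def
proof (rule group.generate_is_subgroup)
  have *: "frag_of (s, x) \<in> carrier (free_Abelian_group (carrier S \<times> carrier P))"
    if "s \<in> carrier S" "x \<in> carrier P" for s x using that by simp
  have d: "c - d \<in> carrier (free_Abelian_group (carrier S \<times> carrier P))"
    if "c \<in> carrier (free_Abelian_group (carrier S \<times> carrier P))"
      "d \<in> carrier (free_Abelian_group (carrier S \<times> carrier P))" for c d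
    using that supported_diff by simp
  show "{frag_of (s \<oplus>\<^bsub>S\<^esub> t, x) - frag_of (s, x) - frag_of (t, x) | s t x.
         s \<in> carrier S \<and> t \<in> carrier S \<and> x \<in> carrier P} \<union>
      {frag_of (s, x \<oplus>\<^bsub>P\<^esub> y) - frag_of (s, x) - frag_of (s, y) | s x y.
         s \<in> carrier S \<and> x \<in> carrier P \<and> y \<in> carrier P} \<union>
      {frag_of (s \<otimes>\<^bsub>S\<^esub> \<phi> r, x) - frag_of (s, r \<odot>\<^bsub>P\<^esub> x) | s r x.
         s \<in> carrier S \<and> r \<in> carrier R \<and> x \<in> carrier P}
    \<subseteq> carrier (free_Abelian_group (carrier S \<times> carrier P))"
    using P by (auto simp del: carrier_free_Abelian_group_iff intro!: d *)
qed simp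

lemma rel_zero: "left_module R P \<Longrightarrow> 0 \<in> rel P"
  using subgroup.one_closed[OF rel_subgroup] by simp

lemma rel_add: "left_module R P \<Longrightarrow> c \<in> rel P \<Longrightarrow> d \<in> rel P \<Longrightarrow> c + d \<in> rel P"
  using subgroup.m_closed[OF rel_subgroup] by simp

lemma rel_supported: "left_module R P \<Longrightarrow> c \<in> rel P \<Longrightarrow> supported P c"
  using subgroup.subset[OF rel_subgroup, of P] carrier_free_Abelian_group_iff[of c "carrier S \<times> carrier P"] by blast

lemma rel_neg: "left_module R P \<Longrightarrow> c \<in> rel P \<Longrightarrow> - c \<in> rel P"
  using subgroup.m_inv_closed[OF rel_subgroup, of P c] rel_supported[of P c] by simp

lemma rel_diff: "left_module R P \<Longrightarrow> c \<in> rel P \<Longrightarrow> d \<in> rel P \<Longrightarrow> c - d \<in> rel P"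
  using rel_add[of P c "- d"] rel_neg[of P d] by simp

lemma rel_l:
  "s \<in> carrier S \<Longrightarrow> t \<in> carrier S \<Longrightarrow> x \<in> carrier P \<Longrightarrow>
    frag_of (s \<oplus>\<^bsub>S\<^esub> t, x) - frag_of (s, x) - frag_of (t, x) \<in> rel P"
  unfolding tensor_rel_def by (rule generate.incl) blast

lemma rel_r:
  "s \<in> carrier S \<Longrightarrow> x \<in> carrier P \<Longrightarrow> y \<in> carrier P \<Longrightarrow>
    frag_of (s, x \<oplus>\<^bsub>P\<^esub> y) - frag_of (s, x) - frag_of (s, y) \<in> rel P"
  unfolding tensor_rel_def by (rule generate.incl) blast

lemma rel_b:
  "s \<in> carrier S \<Longrightarrow> r \<in> carrier R \<Longrightarrow> x \<in> carrier P \<Longrightarrow>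
    frag_of (s \<otimes>\<^bsub>S\<^esub> \<phi> r, x) - frag_of (s, r \<odot>\<^bsub>P\<^esub> x) \<in> rel P"
  unfolding tensor_rel_def by (rule generate.incl) blast

text \<open>\<open>generate\<close> closes under products and under inverses of generators, whereas
  \<open>Q\<close> is closed under differences. Hence \<open>- h\<close> is written as
  \<open>0 - h\<close>, and \<open>h1 + h2\<close> as \<open>h1 - (0 - h2)\<close>.\<close>

lemma rel_induct [consumes 2, case_names zero diff l r b]:
  assumes P: "left_module R P" and c: "c \<in> rel P" and "Q 0"
    and diff: "\<And>c d. c \<in> rel P \<Longrightarrow> d \<in> rel P \<Longrightarrow> Q c \<Longrightarrow> Q d \<Longrightarrow> Q (c - d)"
    and l: "\<And>s t x. s \<in> carrier S \<Longrightarrow> t \<in> carrier S \<Longrightarrow> x \<in> carrier P \<Longrightarrow>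
      Q (frag_of (s \<oplus>\<^bsub>S\<^esub> t, x) - frag_of (s, x) - frag_of (t, x))"
    and r: "\<And>s x y. s \<in> carrier S \<Longrightarrow> x \<in> carrier P \<Longrightarrow> y \<in> carrier P \<Longrightarrow>
      Q (frag_of (s, x \<oplus>\<^bsub>P\<^esub> y) - frag_of (s, x) - frag_of (s, y))"
    and b: "\<And>s r x. s \<in> carrier S \<Longrightarrow> r \<in> carrier R \<Longrightarrow> x \<in> carrier P \<Longrightarrow>
      Q (frag_of (s \<otimes>\<^bsub>S\<^esub> \<phi> r, x) - frag_of (s, r \<odot>\<^bsub>P\<^esub> x))"
  shows "Q c"
proof -
  have *: "Q c" if "c \<in> rel P" for c
    using that unfolding tensor_rel_def
  proof (induction rule: generate.induct)
    case one then show ?case using assms(3) by simp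
  next
    case (incl h) then show ?case using l r b by auto
  next
    case (inv h)
    then have hr: "h \<in> rel P" unfolding tensor_rel_def by (rule generate.incl)
    have "Q h" using inv l r b by auto
    then have "Q (0 - h)" using diff[OF rel_zero[OF P] hr] assms(3) by simp
    then show ?case using rel_supported[OF P hr] by simp
  next
    case (eng h1 h2)
    then have h: "h1 \<in> rel P" "h2 \<in> rel P" by (simp_all add: tensor_rel_def)
    have "Q (0 - h2)" using diff[OF rel_zero[OF P] h(2)] eng assms(3) by simp
    then have "Q (h1 - (0 - h2))" using diff[OF h(1) rel_neg[OF P h(2)]] eng by simp
    then show ?case by simp
  qed
  show ?thesis by (rule *[OF c])
qed

lemma tc_mem: "d \<in> tc P c \<longleftrightarrow> d - c \<in> rel P"
  by (auto simp: tensor_class_def r_coset_def) (metis diff_add_cancel)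

lemma tc_eq_iff:
  assumes P: "left_module R P" shows "tc P c = tc P d \<longleftrightarrow> c - d \<in> rel P"
proof
  assume "tc P c = tc P d"
  moreover have "c \<in> tc P c" using rel_zero[OF P] by (simp add: tc_mem)
  ultimately show "c - d \<in> rel P" by (simp add: tc_mem)
next
  assume cd: "c - d \<in> rel P"
  have "e - c \<in> rel P \<longleftrightarrow> e - d \<in> rel P" for e
    using rel_add[OF P _ cd, of "e - c"] rel_diff[OF P _ cd, of "e - d"] by auto
  then show "tc P c = tc P d" by (auto simp: tc_mem)
qed

lemma tc_self: "left_module R P \<Longrightarrow> c \<in> tc P c"
  using rel_zero by (simp add: tc_mem)

section \<open>The tensor product as a module\<close>

lemma ten_carrier: "carrier (ten P) = tc P ` {c. supported P c}"
  by (auto simp: tensor_def FactGroup_def RCOSETS_def tensor_class_def)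

lemma tc_closed: "supported P c \<Longrightarrow> tc P c \<in> carrier (ten P)"
  unfolding ten_carrier by (rule imageI) (rule CollectI)

lemma ten_zero:
  assumes "left_module R P" shows "\<zero>\<^bsub>ten P\<^esub> = tc P 0"
  using assms by (auto simp: tensor_def FactGroup_def tc_mem)

lemma ten_add:
  assumes P: "left_module R P" shows "tc P c \<oplus>\<^bsub>ten P\<^esub> tc P d = tc P (c + d)"
proof -
  have "tc P c \<oplus>\<^bsub>ten P\<^esub> tc P d = {a + b | a b. a \<in> tc P c \<and> b \<in> tc P d}"
    by (auto simp: tensor_def FactGroup_def set_mult_def)
  also have "\<dots> = tc P (c + d)"
  proof (intro equalityI subsetI)
    fix e assume "e \<in> {a + b | a b. a \<in> tc P c \<and> b \<in> tc P d}"
    then obtain a b where ab: "e = a + b" "a - c \<in> rel P" "b - d \<in> rel P" by (auto simp: tc_mem)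
    have eq: "e - (c + d) = (a - c) + (b - d)" using ab by simp
    show "e \<in> tc P (c + d)" unfolding tc_mem eq by (rule rel_add[OF P ab(2,3)])
  next
    fix e assume "e \<in> tc P (c + d)"
    then have "e - d \<in> tc P c" by (simp add: tc_mem algebra_simps)
    then show "e \<in> {a + b | a b. a \<in> tc P c \<and> b \<in> tc P d}"
      using tc_self[OF P, of d] by (intro CollectI exI[of _ "e - d"] exI[of _ d]) simp
  qed
  finally show ?thesis .
qed

lemma act_of [simp]: "act s (frag_of (t, x)) = frag_of (s \<otimes>\<^bsub>S\<^esub> t, x)"
  by (simp add: act_def)

lemma act_diff: "act s (c - d) = act s c - act s d"
  by (simp add: act_def frag_extend_diff)

lemma act_add: "act s (c + d) = act s c + act s d"
  by (simp add: act_def frag_extend_add)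

lemma act_zero [simp]: "act s 0 = 0"
  by (simp add: act_def)

lemma act_supported: "s \<in> carrier S \<Longrightarrow> supported P c \<Longrightarrow> supported P (act s c)"
  unfolding act_def by (rule order_trans[OF keys_frag_extend]) (auto split: prod.splits)

lemma act_rel:
  assumes P: "left_module R P" and s: "s \<in> carrier S" and c: "c \<in> rel P"
  shows "act s c \<in> rel P"
  using P c
proof (induction rule: rel_induct)
  case zero then show ?case using rel_zero[OF P] by simp
next
  case (diff c d) then show ?case using rel_diff[OF P] by (simp add: act_diff)
next
  case (l t u x) then show ?case using rel_l[of "s \<otimes>\<^bsub>S\<^esub> t" "s \<otimes>\<^bsub>S\<^esub> u" x P] s by (simp add: act_diff S.r_distr)
next
  case (r t x y) then show ?case using rel_r[of "s \<otimes>\<^bsub>S\<^esub> t" x P y] s by (simp add: act_diff)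
next
  case (b t r x) then show ?case using rel_b[of "s \<otimes>\<^bsub>S\<^esub> t" r x P] s by (simp add: act_diff S.m_assoc)
qed

lemma ten_smult:
  assumes P: "left_module R P" and s: "s \<in> carrier S"
  shows "s \<odot>\<^bsub>ten P\<^esub> tc P c = tc P (act s c)"
proof -
  have "(\<Union>d\<in>tc P c. tc P (act s d)) = tc P (act s c)"
    by (rule UN_eq_const[OF tc_self[OF P]])
      (use act_rel[OF P s] in \<open>auto simp: tc_eq_iff[OF P] tc_mem simp flip: act_diff\<close>)
  then show ?thesis by (simp add: tensor_def act_def)
qed

lemma ten_left_module:
  assumes P: "left_module R P"
  shows "left_module S (ten P)"
proof (rule S.left_moduleI)
  note z = ten_zero[OF P] and a = ten_add[OF P] and sm = ten_smult[OF P] and e = tc_eq_iff[OF P]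
  show "abelian_group (ten P)"
  proof (rule abelian_groupI)
    fix x y w assume "x \<in> carrier (ten P)" "y \<in> carrier (ten P)" "w \<in> carrier (ten P)"
    then obtain c d f where c: "supported P c" "x = tc P c" "supported P d" "y = tc P d" "supported P f" "w = tc P f"
      by (auto simp: ten_carrier)
    then show "x \<oplus>\<^bsub>ten P\<^esub> y \<in> carrier (ten P)" using tc_closed[OF supported_add[of c P d]] by (simp add: a)
    show "x \<oplus>\<^bsub>ten P\<^esub> y \<oplus>\<^bsub>ten P\<^esub> w = x \<oplus>\<^bsub>ten P\<^esub> (y \<oplus>\<^bsub>ten P\<^esub> w)" by (simp add: c a add.assoc)
    show "x \<oplus>\<^bsub>ten P\<^esub> y = y \<oplus>\<^bsub>ten P\<^esub> x" by (simp add: c a add.commute)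
    show "\<zero>\<^bsub>ten P\<^esub> \<oplus>\<^bsub>ten P\<^esub> x = x" by (simp add: c a z)
    show "\<exists>y\<in>carrier (ten P). y \<oplus>\<^bsub>ten P\<^esub> x = \<zero>\<^bsub>ten P\<^esub>"
      using c by (intro bexI[of _ "tc P (- c)"]) (auto simp: c a z ten_carrier)
  qed (auto simp: z ten_carrier)
  fix s x assume s: "s \<in> carrier S" and "x \<in> carrier (ten P)"
  then obtain c where c: "supported P c" "x = tc P c" by (auto simp: ten_carrier)
  show "s \<odot>\<^bsub>ten P\<^esub> x \<in> carrier (ten P)" using tc_closed[OF act_supported[OF s c(1)]] s by (simp add: c(2) sm)
  show "s \<odot>\<^bsub>ten P\<^esub> (x \<oplus>\<^bsub>ten P\<^esub> y) = s \<odot>\<^bsub>ten P\<^esub> x \<oplus>\<^bsub>ten P\<^esub> s \<odot>\<^bsub>ten P\<^esub> y" if "y \<in> carrier (ten P)" for y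
    using c s that by (auto simp: sm a ten_carrier act_add)
  fix t assume t: "t \<in> carrier S"
  \<comment> \<open>Distributivity holds only modulo the relations, since the two sides are
    different formal sums. The associative law below is an identity of formal sums.\<close>
  have "act (s \<oplus>\<^bsub>S\<^esub> t) c - (act s c + act t c) \<in> rel P"
    using c(1)
  proof (induction rule: supported_induct)
    case (diff c d)
    have "act (s \<oplus>\<^bsub>S\<^esub> t) (c - d) - (act s (c - d) + act t (c - d)) =
      (act (s \<oplus>\<^bsub>S\<^esub> t) c - (act s c + act t c)) - (act (s \<oplus>\<^bsub>S\<^esub> t) d - (act s d + act t d))"
      by (simp add: act_diff)
    then show ?case using rel_diff[OF P diff(3,4)] by simp
  next
    case (gen u y)
    then show ?case using rel_l[of "s \<otimes>\<^bsub>S\<^esub> u" "t \<otimes>\<^bsub>S\<^esub> u" y P] s t by (simp add: S.l_distr diff_diff_add)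
  qed (use rel_zero[OF P] in simp)
  then show "(s \<oplus>\<^bsub>S\<^esub> t) \<odot>\<^bsub>ten P\<^esub> x = s \<odot>\<^bsub>ten P\<^esub> x \<oplus>\<^bsub>ten P\<^esub> t \<odot>\<^bsub>ten P\<^esub> x"
    using s t by (simp add: c(2) sm a e)
  have "act (s \<otimes>\<^bsub>S\<^esub> t) c = act s (act t c)"
    using c(1) by (induction rule: supported_induct) (use s t in \<open>auto simp: act_diff S.m_assoc\<close>)
  then show "(s \<otimes>\<^bsub>S\<^esub> t) \<odot>\<^bsub>ten P\<^esub> x = s \<odot>\<^bsub>ten P\<^esub> (t \<odot>\<^bsub>ten P\<^esub> x)"
    using s t by (simp add: c(2) sm)
next
  fix x assume "x \<in> carrier (ten P)"
  then obtain c where c: "supported P c" "x = tc P c" by (auto simp: ten_carrier)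
  have "act \<one>\<^bsub>S\<^esub> c = c" using c(1) by (induction rule: supported_induct) (auto simp: act_diff)
  then show "\<one>\<^bsub>S\<^esub> \<odot>\<^bsub>ten P\<^esub> x = x" by (simp add: c(2) ten_smult[OF P])
qed

section \<open>The adjunction between extension and restriction of scalars\<close>

lemma res_left_module: "left_module S V \<Longrightarrow> left_module R (res V)"
  by (rule left_module_restrict_scalars[OF S.ring_axioms \<phi>])

lemma res_hom: "g \<in> mod_hom S V W \<Longrightarrow> g \<in> mod_hom R (res V) (res W)"
  by (rule mod_hom_restrict_scalars[OF \<phi>])

lemma unit_map_hom:
  assumes P: "left_module R P"
  shows "unit_map P \<in> mod_hom R P (res (ten P))"
proof (rule mod_homI)
  note a = ten_add[OF P] and sm = ten_smult[OF P] and e = tc_eq_iff[OF P]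
  fix x assume x: "x \<in> carrier P"
  then show "unit_map P x \<in> carrier (res (ten P))" by (auto simp: unit_map_def ten_carrier)
  show "unit_map P (x \<oplus>\<^bsub>P\<^esub> y) = unit_map P x \<oplus>\<^bsub>res (ten P)\<^esub> unit_map P y" if "y \<in> carrier P" for y
    using rel_r[of "\<one>\<^bsub>S\<^esub>" x P y] x that by (simp add: unit_map_def a e diff_diff_add)
  show "unit_map P (r \<odot>\<^bsub>P\<^esub> x) = r \<odot>\<^bsub>res (ten P)\<^esub> unit_map P x" if r: "r \<in> carrier R" for r
    using rel_neg[OF P rel_b[of "\<one>\<^bsub>S\<^esub>" r x P]] x r by (simp add: unit_map_def sm e)
qed

text \<open>The tensor product is generated over \<open>S\<close> by the elements
  \<open>1 \<otimes> x\<close>.\<close>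

lemma ten_hom_eqI:
  assumes P: "left_module R P" and V: "left_module S V"
    and g: "g \<in> mod_hom S (ten P) V" and h: "h \<in> mod_hom S (ten P) V"
    and eq: "\<And>x. x \<in> carrier P \<Longrightarrow> g (unit_map P x) = h (unit_map P x)" and z: "z \<in> carrier (ten P)"
  shows "g z = h z"
proof -
  obtain c where c: "supported P c" "z = tc P c" using z by (auto simp: ten_carrier)
  note T = ten_left_module[OF P]
  have "g (tc P c) = h (tc P c)" using c(1)
  proof (induction rule: supported_induct)
    case zero then show ?case using S.mod_hom_zero[OF g T V] S.mod_hom_zero[OF h T V] by (simp add: ten_zero[OF P])
  next
    case (diff c d)
    have cd: "tc P c = tc P (c - d) \<oplus>\<^bsub>ten P\<^esub> tc P d" by (simp add: ten_add[OF P])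
    have "tc P (c - d) \<in> carrier (ten P)" "tc P d \<in> carrier (ten P)" using diff tc_closed[OF supported_diff[of c P d]] tc_closed[of d P] by simp_all
    note k = this S.mod_hom_closed[OF g] S.mod_hom_closed[OF h]
    have "g (tc P (c - d)) = g (tc P c) \<ominus>\<^bsub>V\<^esub> g (tc P d)" unfolding cd using k V by (simp add: S.mod_hom_add[OF g])
    moreover have "h (tc P (c - d)) = h (tc P c) \<ominus>\<^bsub>V\<^esub> h (tc P d)" unfolding cd using k V by (simp add: S.mod_hom_add[OF h])
    ultimately show ?case using diff by simp
  next
    case (gen s x)
    have u: "unit_map P x \<in> carrier (ten P)" using mod_hom_closed[OF unit_map_hom[OF P] gen(2)] by simp
    have "tc P (frag_of (s, x)) = s \<odot>\<^bsub>ten P\<^esub> unit_map P x" using gen by (simp add: unit_map_def ten_smult[OF P])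
    then show ?case using gen u eq by (simp add: S.mod_hom_smult[OF g] S.mod_hom_smult[OF h])
  qed
  then show ?thesis by (simp add: c)
qed

text \<open>The existence half of the adjunction, of which \<open>ten_hom_eqI\<close> is the
  uniqueness half. The map is built on formal sums from the balanced assignment
  \<open>(s, x) \<mapsto> s \<odot> f x\<close> and kills the three kinds of relations.\<close>

lemma ten_extend:
  assumes P: "left_module R P" and V: "left_module S V" and f: "f \<in> mod_hom R P (res V)"
  obtains g where "g \<in> mod_hom S (ten P) V" "\<And>x. x \<in> carrier P \<Longrightarrow> g (unit_map P x) = f x"
proof -
  let ?A = "free_Abelian_group (carrier S \<times> carrier P)"
  interpret VG: abelian_group V using V by simp
  have fc: "f x \<in> carrier V" if "x \<in> carrier P" for x using mod_hom_closed[OF f that] by simp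
  obtain \<Phi> where \<Phi>: "\<Phi> \<in> hom ?A (add_monoid V)"
      "\<And>z. z \<in> carrier S \<times> carrier P \<Longrightarrow> \<Phi> (frag_of z) = (case z of (s, x) \<Rightarrow> s \<odot>\<^bsub>V\<^esub> f x)"
    by (rule VG.a_comm_group[THEN comm_group.free_Abelian_group_universal,
          of "\<lambda>(s, x). s \<odot>\<^bsub>V\<^esub> f x" "carrier S \<times> carrier P"]) (use V fc in auto)
  have of: "\<Phi> (frag_of (s, x)) = s \<odot>\<^bsub>V\<^esub> f x" if "s \<in> carrier S" "x \<in> carrier P" for s x using \<Phi>(2) that by simp
  have cl: "\<Phi> c \<in> carrier V" if "supported P c" for c using \<Phi>(1) that by (auto simp: hom_def Pi_iff)
  have add: "\<Phi> (c + d) = \<Phi> c \<oplus>\<^bsub>V\<^esub> \<Phi> d" if "supported P c" "supported P d" for c d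
    using \<Phi>(1) that by (auto simp: hom_def)
  have \<Phi>diff: "\<Phi> (c - d) = \<Phi> c \<ominus>\<^bsub>V\<^esub> \<Phi> d" if "supported P c" "supported P d" for c d
    using add[of "c - d" d] that supported_diff[OF that] cl V by simp
  have sup: "supported P (frag_of (s, x))" if "s \<in> carrier S" "x \<in> carrier P" for s x using that by simp
  have zero: "\<Phi> 0 = \<zero>\<^bsub>V\<^esub>" using \<Phi>diff[of 0 0] cl[of 0] V by simp
  have kill: "\<Phi> c = \<zero>\<^bsub>V\<^esub>" if "c \<in> rel P" for c
    using P that
  proof (induction rule: rel_induct)
    case zero show ?case by (rule \<open>\<Phi> 0 = \<zero>\<^bsub>V\<^esub>\<close>)
  next
    case (diff c d) then show ?case using \<Phi>diff[of c d] rel_supported[OF P] V by simp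
  next
    case (l s t x)
    then show ?case using V fc
      by (simp add: \<Phi>diff sup supported_diff of S.module_smult_l_distr)
  next
    case (r s x y)
    then show ?case using V fc P mod_hom_add[OF f]
      by (simp add: \<Phi>diff sup supported_diff of S.module_smult_r_distr)
  next
    case (b s r x)
    then show ?case using V fc P mod_hom_smult[OF f]
      by (simp add: \<Phi>diff sup of S.module_smult_assoc)
  qed
  \<comment> \<open>Representatives are restricted to supported sums, since nothing is known about
    \<open>\<Phi>\<close> on the others.\<close>
  define g where "g A = (SOME v. \<exists>c. supported P c \<and> c \<in> A \<and> v = \<Phi> c)" for A
  have g: "g (tc P c) = \<Phi> c" if c: "supported P c" for c
    unfolding g_def
  proof (rule some_equality)
    show "\<exists>d. supported P d \<and> d \<in> tc P c \<and> \<Phi> c = \<Phi> d" using c tc_self[OF P] by blast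
    fix v assume "\<exists>d. supported P d \<and> d \<in> tc P c \<and> v = \<Phi> d"
    then obtain d where d: "supported P d" "d - c \<in> rel P" "v = \<Phi> d" by (auto simp: tc_mem)
    then have "\<Phi> d \<ominus>\<^bsub>V\<^esub> \<Phi> c = \<zero>\<^bsub>V\<^esub>" using kill \<Phi>diff[of d c] c by simp
    then show "v = \<Phi> c" using d cl c V by simp
  qed
  have \<Phi>act: "\<Phi> (act s c) = s \<odot>\<^bsub>V\<^esub> \<Phi> c" if s: "s \<in> carrier S" and c: "supported P c" for s c
    using c
  proof (induction rule: supported_induct)
    case zero then show ?case using \<open>\<Phi> 0 = \<zero>\<^bsub>V\<^esub>\<close> s V by simp
  next
    case (diff c d)
    then show ?case using s V cl
      by (simp add: act_diff \<Phi>diff act_supported S.module_diff_eq S.module_smult_r_distr S.module_smult_neg)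
  next
    case (gen t x)
    then show ?case using s V fc by (simp add: of S.module_smult_assoc)
  qed
  show thesis
  proof (rule that)
    show "g \<in> mod_hom S (ten P) V"
    proof (rule S.mod_homI)
      fix x assume "x \<in> carrier (ten P)"
      then obtain c where c: "supported P c" "x = tc P c" by (auto simp: ten_carrier)
      then show "g x \<in> carrier V" using g cl by simp
      show "g (s \<odot>\<^bsub>ten P\<^esub> x) = s \<odot>\<^bsub>V\<^esub> g x" if "s \<in> carrier S" for s
        using that g[OF act_supported[OF that c(1)]] g[OF c(1)] \<Phi>act[OF that c(1)] by (simp add: c(2) ten_smult[OF P])
      fix y assume "y \<in> carrier (ten P)"
      then obtain d where d: "supported P d" "y = tc P d" by (auto simp: ten_carrier)
      show "g (x \<oplus>\<^bsub>ten P\<^esub> y) = g x \<oplus>\<^bsub>V\<^esub> g y"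
        using g[OF supported_add[OF c(1) d(1)]] g[OF c(1)] g[OF d(1)] add[OF c(1) d(1)] by (simp add: c(2) d(2) ten_add[OF P])
    qed
    show "g (unit_map P x) = f x" if "x \<in> carrier P" for x
      using g[OF sup[OF S.one_closed that]] of[OF S.one_closed that] V fc[OF that] by (simp add: unit_map_def)
  qed
qed

lemma tensor_map_facts:
  assumes P: "left_module R P" and Q: "left_module R Q" and \<sigma>: "\<sigma> \<in> mod_hom R P Q"
  shows "tensor_map R S \<phi> Q \<sigma> \<in> mod_hom S (ten P) (ten Q)"
    and "\<And>x. x \<in> carrier P \<Longrightarrow> tensor_map R S \<phi> Q \<sigma> (unit_map P x) = unit_map Q (\<sigma> x)"
proof -
  have \<sigma>c: "\<sigma> x \<in> carrier Q" if "x \<in> carrier P" for x using mod_hom_closed[OF \<sigma> that] .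
  have rel: "frag_extend (\<lambda>(t, x). frag_of (t, \<sigma> x)) c \<in> rel Q" if "c \<in> rel P" for c
    using P that
  proof (induction rule: rel_induct)
    case zero then show ?case using rel_zero[OF Q] by simp
  next
    case (diff c d) then show ?case using rel_diff[OF Q] by (simp add: frag_extend_diff)
  next
    case (l t u x) then show ?case using rel_l[of t u "\<sigma> x" Q] \<sigma>c by (simp add: frag_extend_diff)
  next
    case (r t x y) then show ?case using rel_r[of t "\<sigma> x" Q "\<sigma> y"] \<sigma>c by (simp add: frag_extend_diff mod_hom_add[OF \<sigma>])
  next
    case (b t r x) then show ?case using rel_b[of t r "\<sigma> x" Q] \<sigma>c by (simp add: frag_extend_diff mod_hom_smult[OF \<sigma>])
  qed
  have tm: "tensor_map R S \<phi> Q \<sigma> (tc P c) = tc Q (frag_extend (\<lambda>(t, x). frag_of (t, \<sigma> x)) c)" for c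
    unfolding tensor_map_def
    by (rule UN_eq_const[OF tc_self[OF P]])
      (use rel in \<open>auto simp: tc_eq_iff[OF Q] tc_mem simp flip: frag_extend_diff\<close>)
  have sup: "supported Q (frag_extend (\<lambda>(t, x). frag_of (t, \<sigma> x)) c)" if "supported P c" for c
    using that \<sigma>c by (intro order_trans[OF keys_frag_extend]) (auto split: prod.splits)
  show "tensor_map R S \<phi> Q \<sigma> \<in> mod_hom S (ten P) (ten Q)"
  proof (rule S.mod_homI)
    fix x assume "x \<in> carrier (ten P)"
    then obtain c where c: "supported P c" "x = tc P c" by (auto simp: ten_carrier)
    then show "tensor_map R S \<phi> Q \<sigma> x \<in> carrier (ten Q)" using sup tm by (auto simp: ten_carrier)
    show "tensor_map R S \<phi> Q \<sigma> (s \<odot>\<^bsub>ten P\<^esub> x) = s \<odot>\<^bsub>ten Q\<^esub> tensor_map R S \<phi> Q \<sigma> x" if s: "s \<in> carrier S" for s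
    proof -
      have "frag_extend (\<lambda>(t, x). frag_of (t, \<sigma> x)) (act s c) = act s (frag_extend (\<lambda>(t, x). frag_of (t, \<sigma> x)) c)"
        using c(1) by (induction rule: supported_induct) (auto simp: act_diff frag_extend_diff)
      then show ?thesis using c s by (simp add: tm ten_smult[OF P] ten_smult[OF Q])
    qed
    fix y assume "y \<in> carrier (ten P)"
    then obtain d where d: "supported P d" "y = tc P d" by (auto simp: ten_carrier)
    show "tensor_map R S \<phi> Q \<sigma> (x \<oplus>\<^bsub>ten P\<^esub> y) = tensor_map R S \<phi> Q \<sigma> x \<oplus>\<^bsub>ten Q\<^esub> tensor_map R S \<phi> Q \<sigma> y"
      by (simp add: c d tm ten_add[OF P] ten_add[OF Q] frag_extend_add)
  qed
  show "tensor_map R S \<phi> Q \<sigma> (unit_map P x) = unit_map Q (\<sigma> x)" if "x \<in> carrier P" for x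
    by (simp add: unit_map_def tm)
qed

end

section \<open>Universal localization\<close>

context localization_setup
begin

section \<open>Inverting presentations and the universal property\<close>

lemma presentation_proj:
  fixes \<Sigma> :: "('r, 'p, 'q, 'x) ses"
  assumes "fg_proj_presentation R P \<Sigma> X"
  obtains J :: "'q set" where "proj_presentation R P \<Sigma> X J"
proof -
  have "projective_mod R (ses_mid \<Sigma>)" and ex: "short_exact R P \<Sigma> X"
    using assms by (auto simp: fg_proj_presentation_def)
  then obtain J :: "'q set" where J: "retract_of_free R (ses_mid \<Sigma>) J" using projective_retract_of_free by blast
  have "proj_presentation R P \<Sigma> X J" by unfold_locales (rule ex, rule J)
  then show thesis by (rule that)
qed

text \<open>By the adjunction, \<open>R\<close>-linear maps from \<open>P X\<close> and from
  \<open>F\<close> into \<open>V\<close> are \<open>T\<close>-linear maps from their tensor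
  products. An inverse of the tensored \<open>\<kappa>\<close> then makes restriction along
  \<open>\<kappa>\<close> bijective.\<close>

lemma inverts_perp:
  fixes P :: "('r, 'x) module \<Rightarrow> ('r, 'p) module" and \<Sigma> :: "('r, 'x) module \<Rightarrow> ('r, 'p, 'q, 'x) ses"
  assumes pres: "\<And>X. X \<in> \<X> \<Longrightarrow> fg_proj_presentation R (P X) (\<Sigma> X) X"
    and T: "ring T" and \<phi>: "\<phi> \<in> ring_hom R T" and inv: "inverts R \<X> P \<Sigma> T \<phi>" and V: "left_module T V"
  shows "restrict_scalars \<phi> V \<in> perp01 R \<X>"
  unfolding perp01_def
proof (intro CollectI conjI ballI)
  interpret T: base_ring T using T by (simp add: base_ring_def)
  interpret X: scalar_extension R T \<phi> by unfold_locales (rule \<phi>)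
  show V': "left_module R (X.res V)" by (rule X.res_left_module[OF V])
  fix X assume X: "X \<in> \<X>"
  obtain J :: "'q set" where "proj_presentation R (P X) (\<Sigma> X) X J" by (rule presentation_proj[OF pres[OF X]])
  then interpret Pr: proj_presentation R "P X" "\<Sigma> X" X J .
  let ?tm = "tensor_map R T \<phi> Pr.F Pr.\<kappa>"
  note PD = Pr.presD
  note tm = X.tensor_map_facts[OF PD(1,2,4)]
  have iso: "?tm \<in> mod_iso T (X.ten (P X)) (X.ten Pr.F)" using inv X by (simp add: inverts_def)
  obtain \<nu> where \<nu>: "\<nu> \<in> mod_iso T (X.ten Pr.F) (X.ten (P X))" "\<And>z. z \<in> carrier (X.ten (P X)) \<Longrightarrow> \<nu> (?tm z) = z"
      "\<And>z. z \<in> carrier (X.ten Pr.F) \<Longrightarrow> ?tm (\<nu> z) = z"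
    by (rule T.mod_iso_inverse[OF iso X.ten_left_module[OF PD(1)] X.ten_left_module[OF PD(2)]]) (rule that)
  have \<nu>h: "\<nu> \<in> mod_hom T (X.ten Pr.F) (X.ten (P X))" using \<nu>(1) by (simp add: mod_iso_def)
  show "Ext1_zero R X (X.res V)"
    unfolding Pr.Ext1_zero_iff[OF V']
  proof
    fix f assume f: "f \<in> mod_hom R (P X) (X.res V)"
    obtain g where g: "g \<in> mod_hom T (X.ten (P X)) V" "\<And>x. x \<in> carrier (P X) \<Longrightarrow> g (X.unit_map (P X) x) = f x"
      by (rule X.ten_extend[OF PD(1) V f]) (rule that)
    \<comment> \<open>The extension of \<open>f\<close> to \<open>F\<close> is the unit of
      \<open>F\<close>, followed by the inverse \<open>\<nu>\<close> and the linear extension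
      \<open>g\<close> of \<open>f\<close>.\<close>
    have "g (\<nu> (X.unit_map Pr.F (Pr.\<kappa> k))) = f k" if k: "k \<in> carrier (P X)" for k
      using \<nu>(2)[of "X.unit_map (P X) k"] tm(2)[OF k] g(2)[OF k] mod_hom_closed[OF X.unit_map_hom[OF PD(1)] k] by simp
    then show "Pr.extends (X.res V) f"
      unfolding Pr.extends_def
      by (intro bexI[OF _ mod_hom_compose[OF X.unit_map_hom[OF PD(2)] X.res_hom[OF T.mod_hom_compose[OF \<nu>h g(1)]]]]) auto
  qed
  show "Hom_zero R X (X.res V)"
    unfolding Pr.Hom_zero_iff[OF V']
  proof (intro ballI impI)
    fix \<theta> x assume \<theta>: "\<theta> \<in> mod_hom R Pr.F (X.res V)" "\<forall>k\<in>carrier (P X). \<theta> (Pr.\<kappa> k) = \<zero>\<^bsub>X.res V\<^esub>" and x: "x \<in> carrier Pr.F"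
    obtain g where g: "g \<in> mod_hom T (X.ten Pr.F) V" "\<And>x. x \<in> carrier Pr.F \<Longrightarrow> g (X.unit_map Pr.F x) = \<theta> x"
      by (rule X.ten_extend[OF PD(2) V \<theta>(1)]) (rule that)
    have "g (?tm z) = \<zero>\<^bsub>V\<^esub>" if z: "z \<in> carrier (X.ten (P X))" for z
      by (rule X.ten_hom_eqI[OF PD(1) V T.mod_hom_compose[OF tm(1) g(1)] T.mod_hom_zero_map[OF V] _ z])
        (use tm(2) g(2) \<theta>(2) PD(8) in simp)
    moreover have u: "X.unit_map Pr.F x \<in> carrier (X.ten Pr.F)" using mod_hom_closed[OF X.unit_map_hom[OF PD(2)] x] by simp
    ultimately have "g (?tm (\<nu> (X.unit_map Pr.F x))) = \<zero>\<^bsub>V\<^esub>" using T.mod_hom_closed[OF \<nu>h u] by simp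
    then show "\<theta> x = \<zero>\<^bsub>X.res V\<^esub>" using \<nu>(3)[OF u] g(2)[OF x] by simp
  qed
qed

text \<open>Orthogonality is applied to two particular \<open>S\<close>-modules. Vanishing of
  \<open>Ext^1\<close> into \<open>S \<otimes> P X\<close> extends the unit of \<open>P X\<close> to
  \<open>F\<close> and yields a left inverse \<open>\<nu>\<close>; vanishing of \<open>Hom\<close>
  into \<open>S \<otimes> F\<close> shows that it is also a right inverse.\<close>

lemma S_inverts:
  fixes P :: "('r, 'x) module \<Rightarrow> ('r, 'p) module" and \<Sigma> :: "('r, 'x) module \<Rightarrow> ('r, 'p, 'q, 'x) ses"
  assumes pres: "\<And>X. X \<in> \<X> \<Longrightarrow> fg_proj_presentation R (P X) (\<Sigma> X) X"
  shows "inverts R \<X> P \<Sigma> S \<alpha>"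
  unfolding inverts_def
proof
  interpret X: scalar_extension R S \<alpha> by unfold_locales (rule \<alpha>_ring_hom)
  fix X assume X: "X \<in> \<X>"
  obtain J :: "'q set" where "proj_presentation R (P X) (\<Sigma> X) X J" by (rule presentation_proj[OF pres[OF X]])
  then interpret Pr: proj_presentation R "P X" "\<Sigma> X" X J .
  let ?tm = "tensor_map R S \<alpha> Pr.F Pr.\<kappa>"
  note PD = Pr.presD
  note tm = X.tensor_map_facts[OF PD(1,2,4)]
  note TP = X.ten_left_module[OF PD(1)] and TQ = X.ten_left_module[OF PD(2)]
  note perpP = restrict_perp[OF TP] and perpQ = restrict_perp[OF TQ]
  have "Pr.extends (X.res (X.ten (P X))) (X.unit_map (P X))"
    using Pr.Ext1_zero_iff[OF perpD(1)[OF perpP], THEN iffD1, OF perpD(3)[OF perpP X]] X.unit_map_hom[OF PD(1)] by (rule bspec)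
  then obtain \<theta> where \<theta>: "\<theta> \<in> mod_hom R Pr.F (X.res (X.ten (P X)))" "\<And>k. k \<in> carrier (P X) \<Longrightarrow> \<theta> (Pr.\<kappa> k) = X.unit_map (P X) k"
    by (auto simp: Pr.extends_def)
  obtain \<nu> where \<nu>: "\<nu> \<in> mod_hom S (X.ten Pr.F) (X.ten (P X))" "\<And>x. x \<in> carrier Pr.F \<Longrightarrow> \<nu> (X.unit_map Pr.F x) = \<theta> x"
    by (rule X.ten_extend[OF PD(2) TP \<theta>(1)]) (rule that)
  have 1: "\<nu> (?tm z) = z" if z: "z \<in> carrier (X.ten (P X))" for z
    by (rule X.ten_hom_eqI[OF PD(1) TP S.mod_hom_compose[OF tm(1) \<nu>(1)] S.mod_hom_id _ z])
      (use tm(2) \<nu>(2) \<theta>(2) PD(8) in simp)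
  have "?tm (\<theta> x) = X.unit_map Pr.F x" if x: "x \<in> carrier Pr.F" for x
  proof -
    let ?W = "X.res (X.ten Pr.F)" and ?d = "\<lambda>x. ?tm (\<theta> x) \<ominus>\<^bsub>X.res (X.ten Pr.F)\<^esub> X.unit_map Pr.F x"
    note W = perpD(1)[OF perpQ]
    have h1: "(\<lambda>x. ?tm (\<theta> x)) \<in> mod_hom R Pr.F ?W" by (rule mod_hom_compose[OF \<theta>(1) X.res_hom[OF tm(1)]])
    note h2 = X.unit_map_hom[OF PD(2)]
    have "?d (Pr.\<kappa> k) = \<zero>\<^bsub>?W\<^esub>" if k: "k \<in> carrier (P X)" for k
      using \<theta>(2)[OF k] tm(2)[OF k] module_diff_self[OF W mod_hom_closed[OF h2 PD(8)[OF k]]] by simp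
    then have "?d x = \<zero>\<^bsub>?W\<^esub>"
      using Pr.Hom_zero_iff[OF W, THEN iffD1, OF perpD(2)[OF perpQ X], THEN bspec, OF mod_hom_minus[OF W h1 h2]] x by simp
    then show ?thesis using module_diff_zero_iff[OF W mod_hom_closed[OF h1 x] mod_hom_closed[OF h2 x]] by simp
  qed
  then have 2: "?tm (\<nu> z) = z" if z: "z \<in> carrier (X.ten Pr.F)" for z
    by (intro X.ten_hom_eqI[OF PD(2) TQ S.mod_hom_compose[OF \<nu>(1) tm(1)] S.mod_hom_id _ z]) (simp add: \<nu>(2))
  have "bij_betw ?tm (carrier (X.ten (P X))) (carrier (X.ten Pr.F))"
    by (rule bij_betw_byWitness[where f' = \<nu>]) (use 1 2 S.mod_hom_closed[OF tm(1)] S.mod_hom_closed[OF \<nu>(1)] in auto)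
  then show "?tm \<in> mod_iso S (X.ten (P X)) (X.ten Pr.F)" using tm(1) by (simp add: mod_iso_def)
qed

text \<open>If \<open>\<phi>\<close> inverts the presentations, \<open>T\<close> lies in the
  perpendicular class as an \<open>R\<close>-module, so \<open>\<phi>\<close> extends uniquely to an
  \<open>R\<close>-linear map on \<open>L\<close>. What remains is that this map is
  multiplicative.\<close>

lemma universal_localization_S:
  fixes P :: "('r, 'x) module \<Rightarrow> ('r, 'p) module" and \<Sigma> :: "('r, 'x) module \<Rightarrow> ('r, 'p, 'q, 'x) ses"
  assumes pres: "\<And>X. X \<in> \<X> \<Longrightarrow> fg_proj_presentation R (P X) (\<Sigma> X) X"
  shows "universal_localization TYPE('t) R \<X> P \<Sigma> S \<alpha>"
  unfolding universal_localization_def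
proof (intro conjI allI impI ring_S \<alpha>_ring_hom S_inverts[OF pres])
  fix T :: "'t ring" and \<phi> assume "ring T \<and> \<phi> \<in> ring_hom R T \<and> inverts R \<X> P \<Sigma> T \<phi>"
  then have T: "ring T" and \<phi>: "\<phi> \<in> ring_hom R T" and inv: "inverts R \<X> P \<Sigma> T \<phi>" by auto
  interpret T: base_ring T using T by (simp add: base_ring_def)
  let ?W = "restrict_scalars \<phi> (regular_module T)"
  have W: "?W \<in> perp01 R \<X>" by (rule inverts_perp[OF pres T \<phi> inv T.left_module_regular])
  have \<phi>h: "\<phi> \<in> mod_hom R (regular_module R) ?W"
    by (rule mod_homI) (auto simp: ring_hom_closed[OF \<phi>] ring_hom_add[OF \<phi>] ring_hom_mult[OF \<phi>])
  obtain g where g: "g \<in> mod_hom R L ?W" "\<And>r. r \<in> carrier R \<Longrightarrow> g (\<alpha> r) = \<phi> r"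
    by (rule \<alpha>_extend[OF W \<phi>h]) (rule that)
  have gc: "g x \<in> carrier T" if "x \<in> carrier L" for x using mod_hom_closed[OF g(1) that] by simp
  \<comment> \<open>For fixed \<open>y\<close>, both sides are \<open>R\<close>-linear in
    \<open>x\<close> and agree on the image of \<open>\<alpha>\<close>.\<close>
  have gm: "g (x \<otimes>\<^bsub>S\<^esub> y) = g x \<otimes>\<^bsub>T\<^esub> g y" if x: "x \<in> carrier L" and y: "y \<in> carrier L" for x y
  proof -
    have h: "(\<lambda>x. g x \<otimes>\<^bsub>T\<^esub> g y) \<in> mod_hom R L ?W"
      by (rule mod_homI) (use gc y mod_hom_add[OF g(1)] mod_hom_smult[OF g(1)] in
        \<open>auto simp: T.l_distr T.m_assoc ring_hom_closed[OF \<phi>]\<close>)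
    show ?thesis
      using \<alpha>_unique[OF W mod_hom_compose[OF \<rho>_hom[OF y] g(1)] h _ x] y g(2) mod_hom_smult[OF g(1)]
      by (simp add: \<rho>_\<alpha>)
  qed
  have lin: "k \<in> mod_hom R L ?W" if k: "k \<in> ring_hom S T" and e: "\<And>r. r \<in> carrier R \<Longrightarrow> k (\<alpha> r) = \<phi> r" for k
  proof (rule mod_homI)
    show "k (r \<odot>\<^bsub>L\<^esub> x) = r \<odot>\<^bsub>?W\<^esub> k x" if "r \<in> carrier R" "x \<in> carrier L" for r x
      using ring_hom_mult[OF k, of "\<alpha> r" x] that e by (simp add: \<rho>_\<alpha>)
  qed (use ring_hom_closed[OF k] ring_hom_add[OF k] in auto)
  show "\<exists>!g. g \<in> ring_hom S T \<inter> extensional (carrier S) \<and> (\<forall>r\<in>carrier R. g (\<alpha> r) = \<phi> r)"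
  proof (rule ex1I[of _ "restrict g (carrier L)"])
    have "restrict g (carrier L) \<in> ring_hom S T"
      by (rule ring_hom_memI) (use gc gm mod_hom_add[OF g(1)] g(2)[of \<one>] ring_hom_one[OF \<phi>] in auto)
    then show "restrict g (carrier L) \<in> ring_hom S T \<inter> extensional (carrier S) \<and> (\<forall>r\<in>carrier R. restrict g (carrier L) (\<alpha> r) = \<phi> r)"
      using g(2) by auto
    fix k assume k: "k \<in> ring_hom S T \<inter> extensional (carrier S) \<and> (\<forall>r\<in>carrier R. k (\<alpha> r) = \<phi> r)"
    then have kh: "k \<in> mod_hom R L ?W" by (intro lin) auto
    show "k = restrict g (carrier L)"
      by (rule extensionalityI[of _ "carrier L"]) (use k \<alpha>_unique[OF W kh g(1)] g(2) in auto)
  qed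
qed

text \<open>Universality of \<open>A\<close> is tested on two types: on the type of \<open>L\<close>
  it provides the map \<open>A -> S\<close>, and on its own type it gives the uniqueness that
  identifies the composite \<open>A -> S -> A\<close>. The other composite is the identity because
  \<open>\<alpha>\<close> is an epimorphism.\<close>

lemma localization_unique:
  fixes P :: "('r, 'x) module \<Rightarrow> ('r, 'p) module" and \<Sigma> :: "('r, 'x) module \<Rightarrow> ('r, 'p, 'q, 'x) ses"
    and A :: "'l ring"
  assumes pres: "\<And>X. X \<in> \<X> \<Longrightarrow> fg_proj_presentation R (P X) (\<Sigma> X) X"
    and A1: "universal_localization TYPE('l) R \<X> P \<Sigma> A \<psi>"
    and A2: "universal_localization TYPE((nat \<times> 'm) set) R \<X> P \<Sigma> A \<psi>"
  shows "S \<simeq> A"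
proof -
  have A: "ring A" "\<psi> \<in> ring_hom R A" "inverts R \<X> P \<Sigma> A \<psi>" using A1 by (auto simp: universal_localization_def)
  have Si: "inverts R \<X> P \<Sigma> S \<alpha>" by (rule S_inverts[OF pres])
  obtain g where g: "g \<in> ring_hom S A" "\<And>r. r \<in> carrier R \<Longrightarrow> g (\<alpha> r) = \<psi> r"
    using universal_localization_S[OF pres, where ?'t = 'l] A unfolding universal_localization_def by blast
  obtain h where h: "h \<in> ring_hom A S" "\<And>r. r \<in> carrier R \<Longrightarrow> h (\<psi> r) = \<alpha> r"
    using A2 ring_S \<alpha>_ring_hom Si unfolding universal_localization_def by blast
  have hg: "h (g s) = s" if s: "s \<in> carrier S" for s
  proof -
    have k: "(\<lambda>x. h (g x)) \<in> ring_hom S S" "(\<lambda>x. x) \<in> ring_hom S S"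
      using ring_hom_trans[OF g(1) h(1)] id_ring_hom[of S] by (simp_all add: comp_def id_def)
    have "\<forall>r\<in>carrier R. h (g (\<alpha> r)) = \<alpha> r" using g(2) h(2) by simp
    then show ?thesis
      using \<alpha>_ring_epi[unfolded ring_epi_def, THEN conjunct2, THEN spec, THEN mp, OF ring_S,
          THEN bspec, OF k(1), THEN bspec, OF k(2)] s by simp
  qed
  have gh: "g (h a) = a" if a: "a \<in> carrier A" for a
  proof -
    interpret A: ring A by (rule A(1))
    \<comment> \<open>Uniqueness is asserted among extensional functions, so the composite and the
      identity are compared after restriction to the carrier.\<close>
    let ?Q = "\<lambda>k. k \<in> ring_hom A A \<inter> extensional (carrier A) \<and> (\<forall>r\<in>carrier R. k (\<psi> r) = \<psi> r)"
    have ex: "\<exists>!k. ?Q k" using A1 A unfolding universal_localization_def by blast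
    have Q: "?Q (restrict k (carrier A))" if "k \<in> ring_hom A A" "\<And>r. r \<in> carrier R \<Longrightarrow> k (\<psi> r) = \<psi> r" for k
      using that ring_hom_closed[OF A(2)] by (auto simp: ring_hom_def)
    have "(\<lambda>x. g (h x)) \<in> ring_hom A A" "(\<lambda>x. x) \<in> ring_hom A A"
      using ring_hom_trans[OF h(1) g(1)] id_ring_hom[of A] by (simp_all add: comp_def id_def)
    then have "?Q (restrict (\<lambda>x. g (h x)) (carrier A))" "?Q (restrict (\<lambda>x. x) (carrier A))"
      using g(2) h(2) by (intro Q; simp)+
    then have "restrict (\<lambda>x. g (h x)) (carrier A) = restrict (\<lambda>x. x) (carrier A)"
      using the1_equality[OF ex] by (metis (no_types, lifting))
    then show ?thesis using a by (metis restrict_apply')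
  qed
  have "bij_betw g (carrier S) (carrier A)"
    by (rule bij_betw_byWitness[where f' = h]) (use hg gh ring_hom_closed[OF g(1)] ring_hom_closed[OF h(1)] in auto)
  then have "g \<in> ring_iso S A" using g(1) by (simp add: ring_iso_def)
  then show ?thesis by (auto simp: is_ring_iso_def)
qed

end

theorem mainTheorem4:
  fixes R :: "'r ring"
    and \<X> :: "('r, 'x) module set"
    and \<iota> :: "'r \<Rightarrow> 'm"
    and Y :: "nat \<Rightarrow> ('r, 'm) module"
    and I :: "nat \<Rightarrow> ('r, 'x) module \<Rightarrow> 'i set"
    and E :: "nat \<Rightarrow> ('r, 'x) module \<Rightarrow> 'i \<Rightarrow> ('r, 'm, 'e, 'x) ses"
    and U :: "nat \<Rightarrow> ('r, 'm, 'm, ('r, 'x) module \<times> 'i \<Rightarrow> 'x) ses"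
  assumes "ring R"
    and "semibrick R \<X>"
    and "\<And>X. X \<in> \<X> \<Longrightarrow> proj_dim_le_1 R X"
    and "\<And>X. X \<in> \<X> \<Longrightarrow> Hom_zero R X (regular_module R)"
    and "universal_tower R \<X> (regular_module R) \<iota> Y I E U"
  shows "perp01_reflection TYPE('u) R \<X> (regular_module R)
           (tower_limit Y U) (tower_embedding \<iota> Y U) \<and>
         (\<exists>S. ring_structure_on R (tower_limit Y U) (tower_embedding \<iota> Y U) S \<and>
            (\<forall>S'. ring_structure_on R (tower_limit Y U) (tower_embedding \<iota> Y U) S' \<longrightarrow>
               (\<forall>x\<in>carrier S. \<forall>y\<in>carrier S. x \<otimes>\<^bsub>S'\<^esub> y = x \<otimes>\<^bsub>S\<^esub> y)) \<and>
            ring_epi TYPE('t) R S (tower_embedding \<iota> Y U) \<and>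
            restriction_image R S (tower_embedding \<iota> Y U) = (perp01 R \<X> :: ('r, 'u) module set) \<and>
            (\<forall>(P :: ('r, 'x) module \<Rightarrow> ('r, 'p) module)
               (\<Sigma> :: ('r, 'x) module \<Rightarrow> ('r, 'p, 'q, 'x) ses).
               (\<forall>X\<in>\<X>. fg_proj_presentation R (P X) (\<Sigma> X) X) \<longrightarrow>
               universal_localization TYPE('t) R \<X> P \<Sigma> S (tower_embedding \<iota> Y U) \<and>
               (\<forall>(L :: 'l ring) \<psi>.
                  universal_localization TYPE('l) R \<X> P \<Sigma> L \<psi> \<and>
                  universal_localization TYPE((nat \<times> 'm) set) R \<X> P \<Sigma> L \<psi> \<longrightarrow>
                  S \<simeq> L)))"
proof -
  interpret localization_setup R \<X> \<iota> Y I E U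
    using assms by (intro localization_setup.intro localization_setup_axioms.intro) (auto simp: base_ring_def)
  show ?thesis
  \<comment> \<open>One ring serves for all presentations, as its construction from the tower
    involves none of the prescribed ones.\<close>
  proof (intro conjI exI[of _ S] allI impI ballI \<alpha>_reflection ring_structure_S \<alpha>_ring_epi restriction_image_eq)
    show "x \<otimes>\<^bsub>S'\<^esub> y = x \<otimes>\<^bsub>S\<^esub> y"
      if "ring_structure_on R L \<alpha> S'" "x \<in> carrier S" "y \<in> carrier S" for S' x y
      using ring_structure_unique[OF that(1)] that(2,3) by simp
    fix P :: "('r, 'x) module \<Rightarrow> ('r, 'p) module" and \<Sigma> :: "('r, 'x) module \<Rightarrow> ('r, 'p, 'q, 'x) ses"
    assume pres: "\<forall>X\<in>\<X>. fg_proj_presentation R (P X) (\<Sigma> X) X"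
    show "universal_localization TYPE('t) R \<X> P \<Sigma> S \<alpha>"
      by (rule universal_localization_S[OF bspec[OF pres]])
    show "S \<simeq> A"
      if "universal_localization TYPE('l) R \<X> P \<Sigma> A \<psi> \<and> universal_localization TYPE((nat \<times> 'm) set) R \<X> P \<Sigma> A \<psi>"
      for A :: "'l ring" and \<psi>
      using localization_unique[OF bspec[OF pres]] that by blast
  qed
qed

end
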